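(* Assume $\mathcal E_0$ is composed of hyperbolic equilibria only, and let $u_*^0\in\mathcal E_0$. Then for $\varepsilon$ sufficiently small (still denoted $\varepsilon\in(0,\varepsilon_0]$), there is $\delta>0$ such that the equation $A_\varepsilon u-f(u)=0$ has only one solution $u_*^\varepsilon\in\{u\in X_\varepsilon^{1/2}:\|u-u_*^0\|_{X_\varepsilon^{1/2}}\le\delta\}$. Moreover, $$\|u_*^\varepsilon-u_*^0\|_{X_\varepsilon^{1/2}}\le C\big(\|p_\varepsilon-p_0\|_{L^\infty(\Omega_1)}+\varepsilon\big)^{1/2},$$ where $C$ is a positive constant independent of $\varepsilon$.
   Context: Setting. Fix $0<\varepsilon_0\le 1$, $\lambda>0$, $m_0>0$ and a partition $0=x_0<x_1<x_2<x_3=1$. Put $\Omega_0=(x_1,x_2)$ and $\Omega_1=[0,x_1]\cup[x_2,1]$. For $\varepsilon\in(0,\varepsilon_0]$ let $p_\varepsilon\in C^2([0,1])$, and let $p_0\in C^2(\Omega_1)$, be such that: $p_\varepsilon\to p_0$ uniformly in $\Omega_1$ as $\varepsilon\to0$; $p_\varepsilon(x)\ge 1/\varepsilon$ for $x\in[x_1+\varepsilon,x_2-\varepsilon]$; $p_\varepsilon\ge m_0$ in $(0,1)$ (hence $p_0\ge m_0$ in $\Omega_1$). Let $f\in C^2(\mathbb R)$ satisfy $\limsup_{|x|\to\infty}f(x)/x<\lambda$; without loss of generality $f$ is globally bounded with globally bounded derivatives up to second order. $f$ also denotes the associated Nemytskii operator $u\mapsto f\circ u$. Spaces. $L^2_{\Omega_0}(0,1)=\{u\in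 L^2(0,1): u \text{ is constant a.e. in }\Omega_0\}$ and $H^1_{\Omega_0}(0,1)=\{u\in H^1(0,1): u_x=0 \text{ in }\Omega_0\}$. For $\varepsilon\in(0,\varepsilon_0]$, $X_\varepsilon^{1/2}=H^1(0,1)$ with scalar product $\langle u,v\rangle_{X_\varepsilon^{1/2}}=\int_0^1p_\varepsilon u_xv_x\,dx+\int_0^1\lambda uv\,dx$; it contains $H^1_{\Omega_0}(0,1)$ as a closed subspace. Operators. For $\varepsilon\in(0,\varepsilon_0]$, $A_\varepsilon$ is the operator in $L^2(0,1)$ with domain $\{u\in H^2(0,1):u_x(0)=u_x(1)=0\}$ and $A_\varepsilon u=-(p_\varepsilon u_x)_x+\lambda u$. $A_0$ is the operator in $L^2_{\Omega_0}(0,1)$ with domain $\{u\in H^1_{\Omega_0}(0,1): -(p_0u_x)_x\in L^2(\Omega_1),\ u_x(0)=u_x(1)=0\}$ and $A_0u=\big[-(p_0u_x)_x+\lambda u\big]\chi_{\Omega_1}+\big[\lambda u_{\Omega_0}\big]\chi_{\Omega_0}$, where $u_{\Omega_0}$ is the constant value of $u$ in $\Omega_0$ and $\chi$ denotes the characteristic function. Equilibria. For $\varepsilon\in[0,\varepsilon_0]$, $\mathcal E_\varepsilon$ is the set of solutions $u$ of $A_\varepsilon u-f(u)=0$. An equilibrium $u_*^\varepsilon\in\mathcal E_\varepsilon$ is hyperbolic if $\sigma(A_\varepsilon-f'(u_*^\varepsilon))\cap\{\mu\in\mathbb C:\operatorname{Re}\mu=0\}=\varnothing$.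
   Formalization: The operator A_0 is corrected: on Ω_0 its value is λu_{Ω_0} plus [(p_0u_x)(x_1) − (p_0u_x)(x_2)]/(x_2 − x_1), the flux term of the limiting form; with only λu_{Ω_0} there, hyperbolic equilibria with unbalanced flux are not limits of equilibria of A_ε and the claim is false. *)

theory Defs
  imports "HOL-Analysis.Analysis" "HOL-Probability.Essential_Supremum"
begin

section \<open>Function spaces on open subsets of the line\<close>

text \<open>
  Elements of L^2 and of the Sobolev spaces are represented by functions on the whole line; only
  the values almost everywhere on the set \<open>S\<close> matter. The spaces are polymorphic in the scalars
  (real or complex), because the spectrum is taken in the complexified space.
\<close>

definition L2 :: "real set \<Rightarrow> (real \<Rightarrow> 'a::euclidean_space) set" where
  "L2 S = {u. set_borel_measurable lborel S u \<and> set_integrable lborel S (\<lambda>x. (norm (u x))\<^sup>2)}"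

definition L2_norm :: "real set \<Rightarrow> (real \<Rightarrow> 'a::euclidean_space) \<Rightarrow> real" where
  "L2_norm S u = sqrt (LINT x:S|lborel. (norm (u x))\<^sup>2)"

definition Linf_norm :: "real set \<Rightarrow> (real \<Rightarrow> 'a::euclidean_space) \<Rightarrow> real" where
  "Linf_norm S u = real_of_ereal (esssup (restrict_space lborel S) (\<lambda>x. ereal (norm (u x))))"

definition test_fun :: "real set \<Rightarrow> (real \<Rightarrow> real) set" where
  "test_fun S = {\<phi>. \<phi> C1_differentiable_on UNIV \<and>
     (\<exists>K. compact K \<and> K \<subseteq> S \<and> (\<forall>x. x \<notin> K \<longrightarrow> \<phi> x = 0))}"

definition is_wderiv :: "real set \<Rightarrow> (real \<Rightarrow> 'a::euclidean_space) \<Rightarrow> (real \<Rightarrow> 'a) \<Rightarrow> bool" where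
  "is_wderiv S u v \<longleftrightarrow> (\<forall>\<phi>\<in>test_fun S.
     (LINT x:S|lborel. deriv \<phi> x *\<^sub>R u x) = - (LINT x:S|lborel. \<phi> x *\<^sub>R v x))"

definition H1 :: "real set \<Rightarrow> (real \<Rightarrow> 'a::euclidean_space) set" where
  "H1 S = {u \<in> L2 S. \<exists>v\<in>L2 S. is_wderiv S u v}"

text \<open>A representative of the weak derivative; meaningful (and unique a.e. on \<open>S\<close>) for
  \<open>u \<in> H1 S\<close> only.\<close>

definition wderiv :: "real set \<Rightarrow> (real \<Rightarrow> 'a::euclidean_space) \<Rightarrow> real \<Rightarrow> 'a" where
  "wderiv S u = (SOME v. v \<in> L2 S \<and> is_wderiv S u v)"

definition H2 :: "real set \<Rightarrow> (real \<Rightarrow> 'a::euclidean_space) set" where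
  "H2 S = {u \<in> H1 S. wderiv S u \<in> H1 S}"

text \<open>Continuous representative up to the boundary, used to evaluate a function at a point. For a
  nonempty open \<open>S\<close> its values on \<open>closure S\<close> are determined by \<open>u\<close>, if it exists.\<close>

definition crep :: "real set \<Rightarrow> (real \<Rightarrow> 'a::euclidean_space) \<Rightarrow> real \<Rightarrow> 'a" where
  "crep S u = (SOME w. continuous_on (closure S) w \<and> (AE x\<in>S in lborel. w x = u x))"

definition C2_on :: "real set \<Rightarrow> (real \<Rightarrow> real) \<Rightarrow> bool" where
  "C2_on S g \<longleftrightarrow> (\<exists>g' g''.
     (\<forall>x\<in>S. (g has_real_derivative g' x) (at x within S)) \<and>
     (\<forall>x\<in>S. (g' has_real_derivative g'' x) (at x within S)) \<and>
     continuous_on S g'')"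


section \<open>The partition and the spaces of functions constant in the middle interval\<close>

abbreviation I01 :: "real set" where
  "I01 \<equiv> {0<..<1}"

definition Om0 :: "real \<Rightarrow> real \<Rightarrow> real set" where
  "Om0 x1 x2 = {x1<..<x2}"

definition Om1 :: "real \<Rightarrow> real \<Rightarrow> real set" where
  "Om1 x1 x2 = {0..x1} \<union> {x2..1}"

text \<open>The open set on which weak derivatives ``in \<open>Om1\<close>'' are taken.\<close>

definition Om1i :: "real \<Rightarrow> real \<Rightarrow> real set" where
  "Om1i x1 x2 = {0<..<x1} \<union> {x2<..<1}"

definition L2_Om0 :: "real \<Rightarrow> real \<Rightarrow> (real \<Rightarrow> 'a::euclidean_space) set" where
  "L2_Om0 x1 x2 = {u \<in> L2 I01. \<exists>c. AE x\<in>Om0 x1 x2 in lborel. u x = c}"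

definition H1_Om0 :: "real \<Rightarrow> real \<Rightarrow> (real \<Rightarrow> 'a::euclidean_space) set" where
  "H1_Om0 x1 x2 = {u \<in> H1 I01. AE x\<in>Om0 x1 x2 in lborel. wderiv I01 u x = 0}"

definition val_Om0 :: "real \<Rightarrow> real \<Rightarrow> (real \<Rightarrow> 'a::euclidean_space) \<Rightarrow> 'a" where
  "val_Om0 x1 x2 u = (THE c. AE x\<in>Om0 x1 x2 in lborel. u x = c)"

text \<open>The space \<open>X_\<epsilon>^(1/2)\<close> is \<open>H1 I01\<close> with the following scalar product (\<open>p\<close> stands for
  \<open>p_\<epsilon>\<close>).\<close>

definition X_inner :: "(real \<Rightarrow> real) \<Rightarrow> real \<Rightarrow> (real \<Rightarrow> real) \<Rightarrow> (real \<Rightarrow> real) \<Rightarrow> real" where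
  "X_inner p lam u v =
     (LINT x:I01|lborel. p x * wderiv I01 u x * wderiv I01 v x) +
     (LINT x:I01|lborel. lam * u x * v x)"

definition X_norm :: "(real \<Rightarrow> real) \<Rightarrow> real \<Rightarrow> (real \<Rightarrow> real) \<Rightarrow> real" where
  "X_norm p lam u = sqrt (X_inner p lam u u)"


section \<open>The operators\<close>

definition dom_A :: "(real \<Rightarrow> 'a::euclidean_space) set" where
  "dom_A = {u \<in> H2 I01. crep I01 (wderiv I01 u) 0 = 0 \<and> crep I01 (wderiv I01 u) 1 = 0}"

definition op_A :: "(real \<Rightarrow> real) \<Rightarrow> real \<Rightarrow> (real \<Rightarrow> 'a::euclidean_space) \<Rightarrow> real \<Rightarrow> 'a" where
  "op_A p lam u = (\<lambda>x. - wderiv I01 (\<lambda>y. p y *\<^sub>R wderiv I01 u y) x + lam *\<^sub>R u x)"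

definition dom_A0 :: "real \<Rightarrow> real \<Rightarrow> (real \<Rightarrow> real) \<Rightarrow> (real \<Rightarrow> 'a::euclidean_space) set" where
  "dom_A0 x1 x2 p0 = {u \<in> H1_Om0 x1 x2.
     (\<lambda>x. p0 x *\<^sub>R wderiv I01 u x) \<in> H1 (Om1i x1 x2) \<and>
     crep (Om1i x1 x2) (wderiv I01 u) 0 = 0 \<and> crep (Om1i x1 x2) (wderiv I01 u) 1 = 0}"

text \<open>
  The value of \<open>p0 u_x\<close> at a point of the closed set \<open>Om1\<close>, endpoints included; at \<open>x1\<close> and \<open>x2\<close>
  it is the one-sided value from within \<open>Om1\<close>.
\<close>

definition flux0 ::
  "real \<Rightarrow> real \<Rightarrow> (real \<Rightarrow> real) \<Rightarrow> (real \<Rightarrow> 'a::euclidean_space) \<Rightarrow> real \<Rightarrow> 'a" where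
  "flux0 x1 x2 p0 u = crep (Om1i x1 x2) (\<lambda>x. p0 x *\<^sub>R wderiv I01 u x)"

text \<open>
  As \<open>u_x = 0\<close> in \<open>Om0\<close>, the distribution \<open>-(p0 u_x)_x\<close> has, besides its density in the interior of
  \<open>Om1\<close>, the point masses \<open>(p0 u_x)(x1)\<close> at \<open>x1\<close> and \<open>-(p0 u_x)(x2)\<close> at \<open>x2\<close>. On functions that
  are constant in \<open>Om0\<close> these masses act as a constant density in \<open>Om0\<close>, namely their sum divided
  by the length of \<open>Om0\<close>; this is the second summand in \<open>Om0\<close> below. With it, \<open>A0\<close> is the
  selfadjoint operator in \<open>L2_Om0\<close> that belongs to the limiting scalar product, the integral of
  \<open>p0 u_x v_x\<close> over \<open>Om1\<close> plus that of \<open>\<lambda> u v\<close> over \<open>(0,1)\<close>, on \<open>H1_Om0\<close>. It must not be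
  dropped: with just \<open>\<lambda> u\<close> in \<open>Om0\<close> and weak derivatives in the interior of \<open>Om1\<close>, \<open>A0\<close> is not
  symmetric and its equilibria need not be limits of equilibria of \<open>A_\<epsilon>\<close>.
\<close>

definition op_A0 ::
  "real \<Rightarrow> real \<Rightarrow> (real \<Rightarrow> real) \<Rightarrow> real \<Rightarrow> (real \<Rightarrow> 'a::euclidean_space) \<Rightarrow> real \<Rightarrow> 'a" where
  "op_A0 x1 x2 p0 lam u = (\<lambda>x.
     indicator (Om1 x1 x2) x *\<^sub>R
       (- wderiv (Om1i x1 x2) (\<lambda>y. p0 y *\<^sub>R wderiv I01 u y) x + lam *\<^sub>R u x) +
     indicator (Om0 x1 x2) x *\<^sub>R
       (lam *\<^sub>R val_Om0 x1 x2 u +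
        (1 / (x2 - x1)) *\<^sub>R (flux0 x1 x2 p0 u x1 - flux0 x1 x2 p0 u x2)))"


section \<open>Equilibria and hyperbolicity\<close>

definition equilibria :: "(real \<Rightarrow> real) \<Rightarrow> real \<Rightarrow> (real \<Rightarrow> real) \<Rightarrow> (real \<Rightarrow> real) set" where
  "equilibria p lam f = {u \<in> dom_A. AE x\<in>I01 in lborel. op_A p lam u x - f (u x) = 0}"

definition equilibria0 ::
  "real \<Rightarrow> real \<Rightarrow> (real \<Rightarrow> real) \<Rightarrow> real \<Rightarrow> (real \<Rightarrow> real) \<Rightarrow> (real \<Rightarrow> real) set" where
  "equilibria0 x1 x2 p0 lam f =
     {u \<in> dom_A0 x1 x2 p0. AE x\<in>I01 in lborel. op_A0 x1 x2 p0 lam u x - f (u x) = 0}"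

text \<open>
  Resolvent set and spectrum of an operator \<open>T\<close> with domain \<open>D\<close> in a closed subspace \<open>X\<close> of the
  complex L^2(0,1): \<open>T - \<mu>\<close> maps \<open>D\<close> onto \<open>X\<close> and has a bounded inverse (the norm bound contains
  injectivity).
\<close>

definition resolvent_set ::
  "(real \<Rightarrow> complex) set \<Rightarrow> (real \<Rightarrow> complex) set \<Rightarrow>
   ((real \<Rightarrow> complex) \<Rightarrow> real \<Rightarrow> complex) \<Rightarrow> complex set" where
  "resolvent_set X D T = {\<mu>.
     (\<forall>g\<in>X. \<exists>w\<in>D. AE x\<in>I01 in lborel. T w x - \<mu> * w x = g x) \<and>
     (\<exists>K. \<forall>w\<in>D. L2_norm I01 w \<le> K * L2_norm I01 (\<lambda>x. T w x - \<mu> * w x))}"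

definition spectrum ::
  "(real \<Rightarrow> complex) set \<Rightarrow> (real \<Rightarrow> complex) set \<Rightarrow>
   ((real \<Rightarrow> complex) \<Rightarrow> real \<Rightarrow> complex) \<Rightarrow> complex set" where
  "spectrum X D T = - resolvent_set X D T"

definition hyperbolic0 ::
  "real \<Rightarrow> real \<Rightarrow> (real \<Rightarrow> real) \<Rightarrow> real \<Rightarrow> (real \<Rightarrow> real) \<Rightarrow> (real \<Rightarrow> real) \<Rightarrow> bool" where
  "hyperbolic0 x1 x2 p0 lam f u \<longleftrightarrow>
     spectrum (L2_Om0 x1 x2) (dom_A0 x1 x2 p0)
       (\<lambda>w x. op_A0 x1 x2 p0 lam w x - of_real (deriv f (u x)) * w x) \<inter> {\<mu>. Re \<mu> = 0} = {}"

end

theory Submission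
  imports Defs
begin

text \<open>
  The problem is one-dimensional, so equilibria can be found by shooting. With the flux
  \<open>z = p u'\<close> and the coefficient \<open>q = 1/p\<close> the equation \<open>-(p u')' + \<lambda> u = f(u)\<close> with
  \<open>u'(0) = u'(1) = 0\<close> becomes the first-order system
  \<open>v' = q z\<close>, \<open>z' = \<lambda> v - f(v)\<close> with \<open>z(0) = z(1) = 0\<close> (predicate \<open>is_flow\<close>). Here large diffusion
  does no harm: \<open>q_\<epsilon> = 1/p_\<epsilon>\<close> stays below \<open>1/m0\<close> and tends in \<open>L^1(0,1)\<close> to the function \<open>q_0\<close>
  that is \<open>1/p0\<close> on \<open>Om1\<close> and \<open>0\<close> on \<open>Om0\<close>, and the \<open>L^1\<close> distance is at most a constant times
  \<open>\<eta> = \<parallel>p_\<epsilon> - p0\<parallel> + \<epsilon>\<close> (\<open>recip_L1_estimate\<close>). The limit problem is the same system with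
  coefficient \<open>q_0\<close>: on \<open>Om0\<close> the function \<open>v\<close> is constant and \<open>z\<close> is affine, and \<open>- z'\<close> is there the
  flux term in the definition of \<open>A_0\<close> (\<open>equilibrium_imp_flow\<close>, \<open>flow_imp_equilibrium\<close>,
  \<open>equilibrium0_imp_flow\<close>).

  Let \<open>\<Phi>_\<epsilon>(s)\<close> be the value \<open>z(1)\<close> of the solution with \<open>v(0) = s\<close> and \<open>z(0) = 0\<close>. The equilibria
  are the zeros of \<open>\<Phi>_\<epsilon>\<close>. Gronwall's inequality shows that solutions depend in a Lipschitz manner on
  \<open>s\<close>, on the right-hand side and, in the \<open>L^1\<close> norm, on \<open>q\<close> (\<open>flow_stability\<close>). Difference quotients
  of two solutions solve a system of the same kind, close to the linearisation of the limit system
  at \<open>u0\<close>. Hence all secants of \<open>\<Phi>_\<epsilon>\<close> near \<open>s0 = u0(0)\<close> have a slope close to \<open>\<kappa> = \<zeta>(1)\<close>, where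
  \<open>(y, \<zeta>)\<close> is the solution of that linearisation with \<open>y(0) = 1\<close>
  (\<open>secant_close_to_linearization\<close>). If \<open>\<kappa>\<close> were \<open>0\<close>, then \<open>y\<close> would be an eigenfunction of
  \<open>A_0 - f'(u0)\<close> for the eigenvalue \<open>0\<close>, against hyperbolicity (\<open>hyperbolic_imp_nondegenerate\<close>). So
  \<open>\<Phi>_\<epsilon>\<close> has exactly one zero near \<open>s0\<close>, and its distance to \<open>s0\<close> is of the order
  \<open>\<Phi>_\<epsilon>(s0) = O(\<eta>)\<close> (\<open>near_linear_root\<close>).

  Two estimates return from initial values to the norm of \<open>X_\<epsilon>^(1/2)\<close>. A ball of radius \<open>\<delta>\<close> in that
  norm confines the initial value to a neighbourhood of \<open>s0\<close> that does not depend on \<open>\<epsilon>\<close>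
  (\<open>initial_value_le_energy\<close>); this gives uniqueness. Conversely,
  \<open>p_\<epsilon> (q_\<epsilon> - q_0)\<^sup>2\<close> is at most a constant times \<open>\<bar>q_\<epsilon> - q_0\<bar>\<close>, so the square of the norm of the
  difference of the two equilibria is \<open>O(\<eta>)\<close> (\<open>energy_le\<close>); this is where the exponent \<open>1/2\<close> comes
  from.

  The passage between weak derivatives and the integral form of the system rests on two facts
  about one variable: an indefinite integral has its integrand as weak derivative
  (\<open>is_wderiv_integral\<close>), and a function with weak derivative \<open>0\<close> is constant
  (\<open>du_Bois_Reymond\<close>).
\<close>

section \<open>Weak derivatives of indefinite integrals\<close>

lemma test_fun_D:
  assumes "\<phi> \<in> test_fun S"
  shows "(\<phi> has_real_derivative deriv \<phi> x) (at x)" "continuous_on UNIV (deriv \<phi>)"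
    "continuous_on UNIV \<phi>" "x \<notin> S \<Longrightarrow> \<phi> x = 0" "x \<notin> S \<Longrightarrow> deriv \<phi> x = 0"
proof -
  from assms obtain K where c1: "\<phi> C1_differentiable_on UNIV" and K: "compact K" "K \<subseteq> S"
    "\<And>x. x \<notin> K \<Longrightarrow> \<phi> x = 0" unfolding test_fun_def by auto
  from c1 obtain D where D: "\<And>x. (\<phi> has_vector_derivative D x) (at x)" "continuous_on UNIV D"
    unfolding C1_differentiable_on_def by auto
  have D': "(\<phi> has_real_derivative D x) (at x)" for x
    using D(1) by (simp add: has_real_derivative_iff_has_vector_derivative)
  have deq: "deriv \<phi> = D" using DERIV_imp_deriv[OF D'] by auto
  show d: "(\<phi> has_real_derivative deriv \<phi> x) (at x)" for x using D' deq by simp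
  show "continuous_on UNIV (deriv \<phi>)" using D deq by simp
  show "continuous_on UNIV \<phi>" using D'
    by (intro DERIV_continuous_on) (auto intro: has_field_derivative_at_within)
  show "x \<notin> S \<Longrightarrow> \<phi> x = 0" using K by auto
  show "deriv \<phi> x = 0" if "x \<notin> S"
  proof -
    have "open (-K)" "x \<in> -K" using K that by (auto intro: compact_imp_closed)
    moreover have "((\<lambda>_. 0) has_real_derivative 0) (at x)" by simp
    ultimately have "(\<phi> has_real_derivative 0) (at x)"
      by (rule_tac has_field_derivative_transform_within_open[where S="-K" and f="\<lambda>_. 0"]) (auto simp: K)
    then show ?thesis by (rule DERIV_imp_deriv)
  qed
qed

lemma test_fun_mono: "S \<subseteq> T \<Longrightarrow> test_fun S \<subseteq> test_fun T"
  unfolding test_fun_def by blast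

lemma set_integrable_bounded_mult:
  fixes v :: "real \<Rightarrow> 'a::euclidean_space" and g :: "real \<Rightarrow> real"
  assumes v: "set_integrable lborel S v" and S: "S \<in> sets borel"
    and g: "set_borel_measurable borel S g" and b: "\<And>x. x \<in> S \<Longrightarrow> \<bar>g x\<bar> \<le> B"
  shows "set_integrable lborel S (\<lambda>x. g x *\<^sub>R v x)"
proof (rule set_integrable_bound[where f="\<lambda>x. B *\<^sub>R v x"])
  show "set_integrable lborel S (\<lambda>x. B *\<^sub>R v x)" using v by simp
  have "(\<lambda>x. indicator S x *\<^sub>R v x) \<in> borel_measurable lborel"
    using v unfolding set_integrable_def by auto
  moreover have "(\<lambda>x. indicator S x *\<^sub>R g x) \<in> borel_measurable lborel"
    using g unfolding set_borel_measurable_def by simp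
  ultimately have "(\<lambda>x. (indicator S x *\<^sub>R g x) *\<^sub>R (indicator S x *\<^sub>R v x)) \<in> borel_measurable lborel"
    by measurable
  moreover have "(\<lambda>x. (indicator S x *\<^sub>R g x) *\<^sub>R (indicator S x *\<^sub>R v x)) = (\<lambda>x. indicator S x *\<^sub>R (g x *\<^sub>R v x))"
    by (auto simp: indicator_def fun_eq_iff)
  ultimately show "set_borel_measurable lborel S (\<lambda>x. g x *\<^sub>R v x)"
    unfolding set_borel_measurable_def by simp
  show "AE x in lborel. x \<in> S \<longrightarrow> norm (g x *\<^sub>R v x) \<le> norm (B *\<^sub>R v x)"
    by (intro AE_I2) (auto intro!: mult_right_mono order_trans[OF b])
qed

lemma indefinite_integral_eq_LINT:
  fixes v :: "real \<Rightarrow> 'a::euclidean_space"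
  assumes v: "set_integrable lborel {a<..<b} v" and x: "x \<in> {a<..<b}"
  shows "integral {a..x} v = (LINT t|lborel. indicator {..x} t *\<^sub>R (indicator {a<..<b} t *\<^sub>R v t))"
proof -
  have s: "set_integrable lborel {a<..x} v"
    by (rule set_integrable_subset[OF v]) (use x in auto)
  have "integral {a..x} v = integral {a<..x} v"
  proof (rule integral_spike_set)
    show "negligible {t \<in> {a..x} - {a<..x}. v t \<noteq> 0}"
      by (rule negligible_subset[of "{a}"]) auto
    have "{t \<in> {a<..x} - {a..x}. v t \<noteq> 0} = {}" by auto
    then show "negligible {t \<in> {a<..x} - {a..x}. v t \<noteq> 0}" by (simp only: negligible_empty)
  qed
  also have "\<dots> = (LINT t:{a<..x}|lborel. v t)"
    using set_borel_integral_eq_integral(2)[OF s] by simp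
  also have "\<dots> = (LINT t|lborel. indicator {..x} t *\<^sub>R (indicator {a<..<b} t *\<^sub>R v t))"
    unfolding set_lebesgue_integral_def
    by (intro Bochner_Integration.integral_cong) (use x in \<open>auto simp: indicator_def\<close>)
  finally show ?thesis .
qed

lemma test_fun_integrable:
  assumes "\<phi> \<in> test_fun {a<..<b::real}"
  shows "integrable lborel (deriv \<phi>)" "t \<in> {a..b} \<Longrightarrow> (LINT x|lborel. indicator {t..} x * deriv \<phi> x) = - \<phi> t"
proof -
  note T = test_fun_D[OF assms]
  have si: "set_integrable lborel {t..b} (deriv \<phi>)" for t
    by (rule borel_integrable_atLeastAtMost') (rule continuous_on_subset[OF T(2)], simp)
  have "(\<lambda>x. indicator {a..b} x *\<^sub>R deriv \<phi> x) = deriv \<phi>"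
  proof
    fix x show "indicator {a..b} x *\<^sub>R deriv \<phi> x = deriv \<phi> x"
      using T(5)[of x] by (cases "x \<in> {a<..<b}") auto
  qed
  then show "integrable lborel (deriv \<phi>)"
    using si[of a] unfolding set_integrable_def by simp
  assume t: "t \<in> {a..b}"
  have "(LINT x|lborel. indicator {t..} x * deriv \<phi> x) = (LINT x:{t..b}|lborel. deriv \<phi> x)"
    unfolding set_lebesgue_integral_def
  proof (intro Bochner_Integration.integral_cong refl)
    fix x show "indicator {t..} x * deriv \<phi> x = indicator {t..b} x *\<^sub>R deriv \<phi> x"
      using T(5)[of x] by (cases "x \<le> b") (auto simp: indicator_def)
  qed
  also have "\<dots> = integral {t..b} (deriv \<phi>)"
    using set_borel_integral_eq_integral(2)[OF si] by simp
  also have "\<dots> = \<phi> b - \<phi> t"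
    by (rule integral_unique, rule fundamental_theorem_of_calculus)
       (use t T(1) in \<open>auto simp: has_real_derivative_iff_has_vector_derivative[symmetric] intro: has_field_derivative_at_within\<close>)
  also have "\<dots> = - \<phi> t" using T(4)[of b] by simp
  finally show "(LINT x|lborel. indicator {t..} x * deriv \<phi> x) = - \<phi> t" .
qed

text \<open>
  Integration by parts for an integrand \<open>v\<close> that is merely integrable. By Fubini's theorem
  the integral of \<open>\<phi>'(x) v(t)\<close> over the triangle \<open>t \<le> x\<close> can be evaluated in either order; the
  integral in \<open>x\<close> is \<open>- \<phi>(t) v(t)\<close>. The set \<open>S\<close> may be smaller than the interval, for
  instance a union of two subintervals, while \<open>u\<close> has the same integration constant on all of it.
\<close>

lemma is_wderiv_integral:
  fixes v :: "real \<Rightarrow> 'a::euclidean_space"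
  assumes v: "set_integrable lborel {a<..<b} v" and S: "S \<subseteq> {a<..<b}"
    and u: "\<And>x. x \<in> S \<Longrightarrow> u x = c + integral {a..x} v"
  shows "is_wderiv S u v"
  unfolding is_wderiv_def
proof
  fix \<phi> assume phi: "\<phi> \<in> test_fun S"
  note TS = test_fun_D[OF phi]
  have phi': "\<phi> \<in> test_fun {a<..<b}" using phi test_fun_mono[OF S] by auto
  note TI = test_fun_integrable[OF phi']
  define V where "V = (\<lambda>t. indicator {a<..<b} t *\<^sub>R v t)"
  have V: "integrable lborel V" using v unfolding set_integrable_def V_def .
  have [measurable]: "V \<in> borel_measurable lborel" "deriv \<phi> \<in> borel_measurable borel"
    using V TI(1) by auto
  define H where "H = (\<lambda>(x::real,t::real). (deriv \<phi> x * indicator {..x} t) *\<^sub>R V t)"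
  have Heq: "H = (\<lambda>(x,t). (deriv \<phi> x * (if t \<le> x then 1 else 0)) *\<^sub>R V t)"
    by (auto simp: H_def indicator_def fun_eq_iff)
  have Hm: "H \<in> borel_measurable (lborel \<Otimes>\<^sub>M lborel)"
    unfolding Heq by measurable
  have Hint: "integrable (lborel \<Otimes>\<^sub>M lborel) H"
  proof (rule Bochner_Integration.integrable_bound[of _ "\<lambda>(x,t). norm (deriv \<phi> x) * norm (V t)"])
    show "integrable (lborel \<Otimes>\<^sub>M lborel) (\<lambda>(x, t). norm (deriv \<phi> x) * norm (V t))"
    proof (rule lborel_pair.Fubini_integrable)
      show "(\<lambda>(x, t). norm (deriv \<phi> x) * norm (V t)) \<in> borel_measurable (lborel \<Otimes>\<^sub>M lborel)"
        by measurable
      show "integrable lborel (\<lambda>x. LINT t|lborel. norm (case (x, t) of (x, t) \<Rightarrow> norm (deriv \<phi> x) * norm (V t)))"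
        using TI(1) V by simp
      show "AE x in lborel. integrable lborel (\<lambda>y. case (x, y) of (x, t) \<Rightarrow> norm (deriv \<phi> x) * norm (V t))"
        using V by simp
    qed
    show "AE x in lborel \<Otimes>\<^sub>M lborel. norm (H x) \<le> norm (case x of (x, t) \<Rightarrow> norm (deriv \<phi> x) * norm (V t))"
      by (intro AE_I2) (auto simp: H_def indicator_def)
  qed (rule Hm)
  have int1: "integrable lborel (\<lambda>x. LINT t|lborel. H (x, t))"
    using lborel_pair.integrable_fst'[OF Hint] .
  have inner: "(LINT t|lborel. H (x, t)) = deriv \<phi> x *\<^sub>R integral {a..x} v" if "x \<in> S" for x
  proof -
    have "x \<in> {a<..<b}" using that S by auto
    then have E: "integral {a..x} v = (LINT t|lborel. indicator {..x} t *\<^sub>R V t)"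
      using indefinite_integral_eq_LINT[OF v] by (simp add: V_def)
    show ?thesis unfolding E H_def
      by (simp flip: integral_scaleR_right scaleR_scaleR)
  qed
  have p0: "(LINT x|lborel. deriv \<phi> x) = 0" if "a < b"
  proof -
    have "(LINT x|lborel. indicator {a..} x * deriv \<phi> x) = (LINT x|lborel. deriv \<phi> x)"
    proof (rule Bochner_Integration.integral_cong[OF refl])
      fix x show "indicator {a..} x * deriv \<phi> x = deriv \<phi> x"
        using test_fun_D(5)[OF phi', of x] by (cases "a \<le> x") auto
    qed
    moreover have "a \<in> {a..b}" "a \<notin> {a<..<b}" using that by auto
    ultimately show ?thesis using TI(2)[of a] test_fun_D(4)[OF phi', of a] by simp
  qed
  have "(LINT x:S|lborel. deriv \<phi> x *\<^sub>R u x) = (LINT x|lborel. deriv \<phi> x *\<^sub>R c + (LINT t|lborel. H (x, t)))"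
    unfolding set_lebesgue_integral_def
  proof (intro Bochner_Integration.integral_cong refl)
    fix x
    show "indicat_real S x *\<^sub>R deriv \<phi> x *\<^sub>R u x = deriv \<phi> x *\<^sub>R c + (LINT t|lborel. H (x, t))"
      using inner[of x] u[of x] TS(5)[of x] by (cases "x \<in> S") (auto simp: H_def algebra_simps)
  qed
  also have "\<dots> = (LINT x|lborel. deriv \<phi> x) *\<^sub>R c + (LINT x|lborel. LINT t|lborel. H (x, t))"
    by (subst Bochner_Integration.integral_add) (use int1 TI(1) in auto)
  also have "(LINT x|lborel. deriv \<phi> x) *\<^sub>R c = 0"
  proof (cases "a < b")
    case True then show ?thesis using p0 by simp
  next
    case False
    then have "S = {}" using S by auto
    then have "deriv \<phi> = (\<lambda>_. 0)" using TS(5) by auto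
    then show ?thesis by simp
  qed
  also have "(LINT x|lborel. LINT t|lborel. H (x, t)) = (LINT t|lborel. LINT x|lborel. H (x, t))"
    using lborel_pair.Fubini_integral[of "\<lambda>x t. H (x,t)"] Hint by simp
  also have "\<dots> = (LINT t|lborel. - (\<phi> t *\<^sub>R V t))"
  proof (intro Bochner_Integration.integral_cong refl)
    fix t
    show "(LINT x|lborel. H (x, t)) = - (\<phi> t *\<^sub>R V t)"
    proof (cases "t \<in> {a<..<b}")
      case True
      have "(LINT x|lborel. H (x, t)) = (LINT x|lborel. (indicator {t..} x * deriv \<phi> x) *\<^sub>R V t)"
        by (intro Bochner_Integration.integral_cong) (auto simp: H_def indicator_def)
      also have "\<dots> = (LINT x|lborel. indicator {t..} x * deriv \<phi> x) *\<^sub>R V t"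
      proof (subst integral_scaleR_left)
        show "V t \<noteq> 0 \<Longrightarrow> integrable lborel (\<lambda>x. indicat_real {t..} x * deriv \<phi> x)"
          using integrable_real_mult_indicator[OF _ TI(1), of "{t..}"] by (simp add: mult.commute)
      qed simp
      also have "\<dots> = - (\<phi> t *\<^sub>R V t)" using TI(2)[of t] True by simp
      finally show ?thesis .
    qed (simp add: V_def H_def)
  qed
  also have "\<dots> = - (LINT x:S|lborel. \<phi> x *\<^sub>R v x)"
    unfolding set_lebesgue_integral_def integral_minus[symmetric] V_def
  proof (intro Bochner_Integration.integral_cong refl)
    fix x
    show "- (\<phi> x *\<^sub>R indicat_real {a<..<b} x *\<^sub>R v x) = - (indicat_real S x *\<^sub>R \<phi> x *\<^sub>R v x)"
      using TS(4)[of x] S by (cases "x \<in> S") (auto simp: indicator_def)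
  qed
  finally show "(LINT x:S|lborel. deriv \<phi> x *\<^sub>R u x) = - (LINT x:S|lborel. \<phi> x *\<^sub>R v x)" by simp
qed

section \<open>The lemma of du Bois-Reymond and uniqueness of weak derivatives\<close>

text \<open>
  At almost every point \<open>w\<close> is the limit of its averages over small intervals, by Lebesgue's
  differentiation theorem, and all these averages are \<open>k\<close>.
\<close>

lemma AE_eq_const_of_integrals:
  fixes w :: "real \<Rightarrow> 'a::euclidean_space"
  assumes w: "set_integrable lborel {a<..<b} w"
    and k: "\<And>c d. a < c \<Longrightarrow> c < d \<Longrightarrow> d < b \<Longrightarrow> integral {c..d} w = (d - c) *\<^sub>R k"
  shows "AE x\<in>{a<..<b} in lborel. w x = k"
proof -
  define W where "W x = indicator {a<..<b} x *\<^sub>R w x" for x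
  have "integrable lborel W" using w unfolding set_integrable_def W_def .
  then have "set_integrable lborel S W" if "S \<in> sets borel" for S
    using that unfolding set_integrable_def by (intro integrable_mult_indicator) auto
  then have "W integrable_on cbox c d" for c d
    by (intro set_borel_integral_eq_integral(1)) auto
  then obtain N where N: "negligible N" "\<And>x e. \<lbrakk>x \<notin> N; 0 < e\<rbrakk> \<Longrightarrow>
               \<exists>d>0. \<forall>h. 0 < h \<and> h < d \<longrightarrow>
                         norm(integral (cbox x (x + h *\<^sub>R One)) W /\<^sub>R h ^ DIM(real) - W x) < e"
    using integrable_ccontinuous_explicit[of W] by metis
  have *: "w x = k" if x: "x \<notin> N" "x \<in> {a<..<b}" for x
  proof (rule ccontr)
    assume "w x \<noteq> k"
    then have e: "norm (k - w x) > 0" by simp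
    from N(2)[OF x(1) e] obtain d where d: "d > 0" "\<And>h. 0 < h \<Longrightarrow> h < d \<Longrightarrow>
       norm(integral {x..x+h} W /\<^sub>R h - W x) < norm (k - w x)" by auto
    define h where "h = min (d/2) ((b - x)/2)"
    have h: "0 < h" "h < d" "x + h < b" using d(1) x(2) unfolding h_def by (auto simp: min_def field_simps)
    have "integral {x..x+h} W = integral {x..x+h} w"
      by (rule integral_cong) (use h x in \<open>auto simp: W_def\<close>)
    also have "\<dots> = h *\<^sub>R k" using k[of x "x+h"] h x by auto
    finally have "norm (k - w x) < norm (k - w x)"
      using d(2)[OF h(1,2)] x h(1) by (simp add: W_def)
    then show False by simp
  qed
  have "AE x in lebesgue. x \<notin> N"
    using N(1) by (intro AE_not_in) (simp add: negligible_iff_null_sets)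
  then have "AE x in lborel. x \<notin> N" by (simp add: AE_completion_iff)
  then show ?thesis by eventually_elim (use * in auto)
qed

text \<open>
  Continuous functions with support in \<open>{c..d}\<close> that increase to the indicator function of
  \<open>{c<..<d}\<close>.
\<close>

definition trapezoid :: "real \<Rightarrow> real \<Rightarrow> nat \<Rightarrow> real \<Rightarrow> real" where
  "trapezoid c d n x = max 0 (min 1 (real n * min (x - c) (d - x)))"

lemma trapezoid_simps: "continuous_on S (trapezoid c d n)" "x \<notin> {c..d} \<Longrightarrow> trapezoid c d n x = 0"
   "0 \<le> trapezoid c d n x" "trapezoid c d n x \<le> 1" "trapezoid c d n \<in> borel_measurable borel"
proof -
  show c: "continuous_on S (trapezoid c d n)" for S
    unfolding trapezoid_def[abs_def] by (intro continuous_intros)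
  show "trapezoid c d n \<in> borel_measurable borel"
    using c[of UNIV] by (rule borel_measurable_continuous_onI)
  show "0 \<le> trapezoid c d n x" "trapezoid c d n x \<le> 1" unfolding trapezoid_def by auto
  assume "x \<notin> {c..d}"
  then have "min (x - c) (d - x) \<le> 0" by auto
  then have "real n * min (x - c) (d - x) \<le> 0" by (intro mult_nonneg_nonpos) auto
  then show "trapezoid c d n x = 0" unfolding trapezoid_def by auto
qed

lemma trapezoid_lim: "(\<lambda>n. trapezoid c d n x) \<longlonglongrightarrow> indicator {c<..<d} x"
proof (cases "x \<in> {c<..<d}")
  case True
  then have m: "min (x - c) (d - x) > 0" by auto
  obtain N where N: "1 < real N * min (x - c) (d - x)" using reals_Archimedean3[OF m] by blast
  have "trapezoid c d n x = 1" if "n \<ge> N" for n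
  proof -
    have "real N * min (x - c) (d - x) \<le> real n * min (x - c) (d - x)"
      using that m by (intro mult_right_mono) auto
    then show ?thesis using N unfolding trapezoid_def by auto
  qed
  then have "\<forall>\<^sub>F n in sequentially. trapezoid c d n x = 1" by (rule eventually_sequentiallyI)
  then show ?thesis using True by (auto intro: tendsto_eventually)
next
  case False
  then have "min (x - c) (d - x) \<le> 0" by auto
  then have "real n * min (x - c) (d - x) \<le> 0" for n by (intro mult_nonneg_nonpos) auto
  then have "trapezoid c d n x = 0" for n unfolding trapezoid_def by (metis max.absorb1 min.coboundedI2)
  then show ?thesis using False by simp
qed

lemma trapezoid_integral_lim:
  fixes g :: "real \<Rightarrow> 'a::euclidean_space"
  assumes g: "set_integrable lborel {a<..<b} g" and "a < c" "d < b"
  shows "(\<lambda>n. LINT x:{a<..<b}|lborel. trapezoid c d n x *\<^sub>R g x) \<longlonglongrightarrow> integral {c..d} g"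
proof -
  define G where "G x = indicator {a<..<b} x *\<^sub>R g x" for x
  have G: "integrable lborel G" using g unfolding set_integrable_def G_def .
  note trapezoid_simps(5)[measurable]
  have [measurable]: "G \<in> borel_measurable borel" using G by auto
  have "(\<lambda>n. LINT x|lborel. trapezoid c d n x *\<^sub>R G x) \<longlonglongrightarrow> (LINT x|lborel. indicator {c<..<d} x *\<^sub>R G x)"
  proof (rule integral_dominated_convergence)
    show "integrable lborel (\<lambda>x. norm (G x))" using G by simp
    show "AE x in lborel. (\<lambda>i. trapezoid c d i x *\<^sub>R G x) \<longlonglongrightarrow> indicator {c<..<d} x *\<^sub>R G x"
      by (intro AE_I2 tendsto_intros trapezoid_lim)
    show "AE x in lborel. norm (trapezoid c d i x *\<^sub>R G x) \<le> norm (G x)" for i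
      by (intro AE_I2) (simp add: mult_left_le_one_le trapezoid_simps)
  qed auto
  also have "(\<lambda>n. LINT x|lborel. trapezoid c d n x *\<^sub>R G x) = (\<lambda>n. LINT x:{a<..<b}|lborel. trapezoid c d n x *\<^sub>R g x)"
    unfolding set_lebesgue_integral_def G_def by (simp add: mult.commute)
  also have "(LINT x|lborel. indicator {c<..<d} x *\<^sub>R G x) = (LINT x:{c<..<d}|lborel. g x)"
    unfolding set_lebesgue_integral_def G_def
    by (rule Bochner_Integration.integral_cong[OF refl]) (use assms in \<open>auto simp: indicator_def\<close>)
  also have "\<dots> = integral {c<..<d} g"
    by (intro set_borel_integral_eq_integral set_integrable_subset[OF g]) (use assms in auto)
  finally show ?thesis by (simp add: integral_open_interval_real)
qed

lemma test_fun_antiderivative: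
  assumes psi: "continuous_on UNIV \<psi>" and supp: "\<And>x. x \<notin> {C..D} \<Longrightarrow> \<psi> x = 0"
    and mean: "integral {C..D} \<psi> = 0" and ab: "a < C" "C \<le> D" "D < b"
  shows "\<exists>\<phi>\<in>test_fun {a<..<b}. deriv \<phi> = \<psi>"
proof -
  define \<phi> where "\<phi> x = integral {C-1..x} \<psi>" for x
  have cs: "continuous_on S \<psi>" for S using psi continuous_on_subset by blast
  have left: "\<phi> x = 0" if "x < C" for x
  proof -
    have "integral {C-1..x} \<psi> = integral {C-1..x} (\<lambda>_. 0)"
      by (rule integral_cong) (use supp that in auto)
    then show ?thesis by (simp add: \<phi>_def)
  qed
  have right: "\<phi> x = 0" if "x > D" for x
  proof -
    have "(\<psi> has_integral 0) {C..D}" using mean integrable_continuous_real[OF cs]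
      by (metis integrable_integral)
    then have "(\<psi> has_integral 0) {C-1..x}"
      by (rule has_integral_on_superset) (use supp that in auto)
    then show ?thesis unfolding \<phi>_def by auto
  qed
  have der: "(\<phi> has_real_derivative \<psi> x) (at x)" for x
  proof (cases "x < C")
    case True
    have "((\<lambda>_. 0) has_real_derivative 0) (at x)" by simp
    then have "(\<phi> has_real_derivative 0) (at x)"
      by (rule has_field_derivative_transform_within_open[where S="{..<C}"]) (use left True in auto)
    then show ?thesis using supp[of x] True by auto
  next
    case False
    have "(\<phi> has_real_derivative \<psi> x) (at x within {C-1..x+1})"
      unfolding \<phi>_def by (rule integral_has_real_derivative[OF cs]) (use False in auto)
    moreover have "at x within {C-1..x+1} = at x"
      by (rule at_within_interior) (use False in auto)
    ultimately show ?thesis by simp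
  qed
  have "\<phi> C1_differentiable_on UNIV"
    unfolding C1_differentiable_on_def
    using der cs by (auto simp: has_real_derivative_iff_has_vector_derivative)
  moreover have "compact {C..D}" "{C..D} \<subseteq> {a<..<b}" "\<forall>x. x \<notin> {C..D} \<longrightarrow> \<phi> x = 0"
    using ab left right by (auto simp: not_le)
  ultimately have "\<phi> \<in> test_fun {a<..<b}" unfolding test_fun_def by blast
  moreover have "deriv \<phi> = \<psi>" using DERIV_imp_deriv[OF der] by auto
  ultimately show ?thesis by blast
qed

text \<open>
  For two intervals, the combination of their trapezoid functions with mean zero is the derivative
  of a test function. In the limit the hypothesis says that \<open>w\<close> has the same average over both
  intervals.
\<close>

lemma du_Bois_Reymond:
  fixes w :: "real \<Rightarrow> 'a::euclidean_space"
  assumes ab: "a < b" and w: "set_integrable lborel {a<..<b} w"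
    and H: "\<And>\<phi>. \<phi> \<in> test_fun {a<..<b} \<Longrightarrow> (LINT x:{a<..<b}|lborel. deriv \<phi> x *\<^sub>R w x) = 0"
  shows "\<exists>k. AE x\<in>{a<..<b} in lborel. w x = k"
proof -
  have main: "(d' - c') *\<^sub>R integral {c..d} w = (d - c) *\<^sub>R integral {c'..d'} w"
    if i: "a < c" "c < d" "d < b" "a < c'" "c' < d'" "d' < b" for c d c' d'
  proof -
    define J where "J c d n = (LINT x:{a<..<b}|lborel. trapezoid c d n x *\<^sub>R (1::real))" for c d n
    define I where "I c d n = (LINT x:{a<..<b}|lborel. trapezoid c d n x *\<^sub>R w x)" for c d n
    have one: "set_integrable lborel {a<..<b} (\<lambda>_. 1::real)"
      by (rule set_integrable_subset[of _ "{a..b}"], rule borel_integrable_atLeastAtMost') auto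
    have m: "set_borel_measurable borel {a<..<b} (trapezoid c d n)" for c d n
      unfolding set_borel_measurable_def using trapezoid_simps(5)[of c d n] by simp
    have tb: "\<bar>trapezoid c d n x\<bar> \<le> 1" for c d n x using trapezoid_simps(3,4)[of c d n x] by simp
    have it: "set_integrable lborel {a<..<b} (\<lambda>x. trapezoid c d n x *\<^sub>R w x)"
      "set_integrable lborel {a<..<b} (trapezoid c d n)" for c d n
      using set_integrable_bounded_mult[OF w _ m tb] set_integrable_bounded_mult[OF one _ m tb] by auto
    have eq: "J c' d' n *\<^sub>R I c d n = J c d n *\<^sub>R I c' d' n" for n
    proof -
      define \<psi> where "\<psi> x = J c' d' n * trapezoid c d n x - J c d n * trapezoid c' d' n x" for x
      define C where "C = min c c'"
      define D where "D = max d d'"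
      have CD: "a < C" "C \<le> D" "D < b" using i by (auto simp: C_def D_def)
      have cp: "continuous_on UNIV \<psi>" unfolding \<psi>_def by (intro continuous_intros trapezoid_simps)
      have supp: "\<psi> x = 0" if "x \<notin> {C..D}" for x
      proof -
        have "x \<notin> {c..d}" "x \<notin> {c'..d'}" using that by (auto simp: C_def D_def)
        then show ?thesis by (simp add: \<psi>_def trapezoid_simps(2) del: atLeastAtMost_iff)
      qed
      have si: "set_integrable lborel {a<..<b} \<psi>"
        unfolding \<psi>_def by (intro set_integral_diff set_integrable_mult_right it)
      have "(\<psi> has_integral integral {C..D} \<psi>) {C..D}"
        by (intro integrable_integral integrable_continuous_real continuous_on_subset[OF cp]) auto
      then have "(\<psi> has_integral integral {C..D} \<psi>) {a<..<b}"
        by (rule has_integral_on_superset) (use supp CD in auto)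
      then have "integral {C..D} \<psi> = integral {a<..<b} \<psi>" by (simp add: integral_unique)
      also have "\<dots> = (LINT x:{a<..<b}|lborel. \<psi> x)"
        using set_borel_integral_eq_integral(2)[OF si] by simp
      also have "\<dots> = J c' d' n * J c d n - J c d n * J c' d' n"
        unfolding \<psi>_def
        by (subst set_integral_diff(2)) (auto simp: J_def it)
      finally have "integral {C..D} \<psi> = 0" by simp
      from test_fun_antiderivative[OF cp supp this CD] obtain \<phi> where
        phi: "\<phi> \<in> test_fun {a<..<b}" "deriv \<phi> = \<psi>" by auto
      have "0 = (LINT x:{a<..<b}|lborel. \<psi> x *\<^sub>R w x)" using H[OF phi(1)] phi(2) by simp
      also have "\<dots> = (LINT x:{a<..<b}|lborel. J c' d' n *\<^sub>R (trapezoid c d n x *\<^sub>R w x) - J c d n *\<^sub>R (trapezoid c' d' n x *\<^sub>R w x))"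
        by (rule set_lebesgue_integral_cong) (auto simp: \<psi>_def algebra_simps)
      also have "\<dots> = J c' d' n *\<^sub>R I c d n - J c d n *\<^sub>R I c' d' n"
        by (subst set_integral_diff(2)) (simp_all add: I_def it del: scaleR_scaleR)
      finally show ?thesis by simp
    qed
    have Jl: "J c d \<longlonglongrightarrow> d - c" if "a < c" "c < d" "d < b" for c d
      using trapezoid_integral_lim[OF one, of c d] that unfolding J_def by (simp add: that)
    have Il: "I c d \<longlonglongrightarrow> integral {c..d} w" if "a < c" "c < d" "d < b" for c d
      using trapezoid_integral_lim[OF w, of c d] that unfolding I_def by simp
    have "(\<lambda>n. J c' d' n *\<^sub>R I c d n) \<longlonglongrightarrow> (d' - c') *\<^sub>R integral {c..d} w"
      by (intro tendsto_intros Jl Il i)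
    moreover have "(\<lambda>n. J c' d' n *\<^sub>R I c d n) \<longlonglongrightarrow> (d - c) *\<^sub>R integral {c'..d'} w"
      unfolding eq by (intro tendsto_intros Jl Il i)
    ultimately show ?thesis by (rule LIMSEQ_unique)
  qed
  \<comment> \<open>any fixed subinterval serves for reference\<close>
  define c' d' where "c' = (2*a+b)/3" and "d' = (a+2*b)/3"
  have cd: "a < c'" "c' < d'" "d' < b" using ab by (auto simp: c'_def d'_def)
  define k where "k = integral {c'..d'} w /\<^sub>R (d' - c')"
  have "integral {c..d} w = (d - c) *\<^sub>R k" if "a < c" "c < d" "d < b" for c d
  proof -
    have "(d' - c') *\<^sub>R integral {c..d} w = (d' - c') *\<^sub>R ((d - c) *\<^sub>R k)"
      unfolding main[OF that cd] k_def using cd by simp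
    then show ?thesis by (rule scaleR_left_imp_eq[rotated]) (use cd in simp)
  qed
  from AE_eq_const_of_integrals[OF w this] show ?thesis by blast
qed

lemma is_wderiv_subset:
  fixes u v :: "real \<Rightarrow> 'a::euclidean_space"
  assumes "is_wderiv T u v" "S \<subseteq> T"
  shows "is_wderiv S u v"
  unfolding is_wderiv_def
proof
  fix \<phi> assume phi: "\<phi> \<in> test_fun S"
  have "(LINT x:S|lborel. deriv \<phi> x *\<^sub>R u x) = (LINT x:T|lborel. deriv \<phi> x *\<^sub>R u x)"
    unfolding set_lebesgue_integral_def
  proof (rule Bochner_Integration.integral_cong[OF refl])
    fix x show "indicat_real S x *\<^sub>R deriv \<phi> x *\<^sub>R u x = indicat_real T x *\<^sub>R deriv \<phi> x *\<^sub>R u x"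
      using test_fun_D(5)[OF phi, of x] assms(2) by (cases "x \<in> S") auto
  qed
  moreover have "(LINT x:S|lborel. \<phi> x *\<^sub>R v x) = (LINT x:T|lborel. \<phi> x *\<^sub>R v x)"
    unfolding set_lebesgue_integral_def
  proof (rule Bochner_Integration.integral_cong[OF refl])
    fix x show "indicat_real S x *\<^sub>R \<phi> x *\<^sub>R v x = indicat_real T x *\<^sub>R \<phi> x *\<^sub>R v x"
      using test_fun_D(4)[OF phi, of x] assms(2) by (cases "x \<in> S") auto
  qed
  moreover have "\<phi> \<in> test_fun T" using phi test_fun_mono[OF assms(2)] by auto
  ultimately show "(LINT x:S|lborel. deriv \<phi> x *\<^sub>R u x) = - (LINT x:S|lborel. \<phi> x *\<^sub>R v x)"
    using assms(1) unfolding is_wderiv_def by auto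
qed

lemma LINT_scaleR_cong_AE:
  fixes u v :: "real \<Rightarrow> 'a::euclidean_space"
  assumes [measurable]: "set_borel_measurable lborel S u" "set_borel_measurable lborel S v"
    and ae: "AE x\<in>S in lborel. u x = v x" and g: "continuous_on UNIV (g::real\<Rightarrow>real)"
  shows "(LINT x:S|lborel. g x *\<^sub>R u x) = (LINT x:S|lborel. g x *\<^sub>R v x)"
proof -
  have [measurable]: "g \<in> borel_measurable borel" using g by (rule borel_measurable_continuous_onI)
  have [measurable]: "(\<lambda>x. indicator S x *\<^sub>R u x) \<in> borel_measurable lborel"
     "(\<lambda>x. indicator S x *\<^sub>R v x) \<in> borel_measurable lborel"
    using assms(1,2) unfolding set_borel_measurable_def by auto
  have "(LINT x|lborel. g x *\<^sub>R (indicator S x *\<^sub>R u x)) = (LINT x|lborel. g x *\<^sub>R (indicator S x *\<^sub>R v x))"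
  proof (rule integral_cong_AE)
    show "AE x in lborel. g x *\<^sub>R (indicator S x *\<^sub>R u x) = g x *\<^sub>R (indicator S x *\<^sub>R v x)"
      using ae by eventually_elim (auto simp: indicator_def)
  qed measurable
  then show ?thesis unfolding set_lebesgue_integral_def by (simp add: mult.commute)
qed

lemma is_wderiv_cong_AE:
  fixes u v :: "real \<Rightarrow> 'a::euclidean_space"
  assumes "set_borel_measurable lborel S u" "set_borel_measurable lborel S u'"
    and "set_borel_measurable lborel S v" "set_borel_measurable lborel S v'"
    and "AE x\<in>S in lborel. u x = u' x" "AE x\<in>S in lborel. v x = v' x"
    and "is_wderiv S u v"
  shows "is_wderiv S u' v'"
  unfolding is_wderiv_def
proof
  fix \<phi> assume phi: "\<phi> \<in> test_fun S"
  show "(LINT x:S|lborel. deriv \<phi> x *\<^sub>R u' x) = - (LINT x:S|lborel. \<phi> x *\<^sub>R v' x)"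
    using assms(7) phi LINT_scaleR_cong_AE[OF assms(1,2,5) test_fun_D(2)[OF phi]]
      LINT_scaleR_cong_AE[OF assms(3,4,6) test_fun_D(3)[OF phi]]
    by (simp add: is_wderiv_def)
qed

lemma continuous_AE_eq_imp_eq:
  fixes f g :: "real \<Rightarrow> 'a::euclidean_space"
  assumes S: "open S" and f: "continuous_on S f" and g: "continuous_on S g"
    and ae: "AE x\<in>S in lborel. f x = g x" and x: "x \<in> S"
  shows "f x = g x"
proof (rule ccontr)
  assume ne: "f x \<noteq> g x"
  define D where "D = S \<inter> (\<lambda>x. f x - g x) -` (-{0})"
  have "open D" unfolding D_def
    using S by (intro continuous_open_preimage continuous_intros f g) auto
  moreover have "x \<in> D" using ne x by (auto simp: D_def)
  ultimately have "\<not> negligible D" using open_not_negligible by blast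
  moreover have "D \<in> null_sets lborel"
    using AE_iff_null_sets[of D lborel] \<open>open D\<close> ae by (auto simp: D_def elim!: eventually_mono)
  then have "negligible D"
    by (simp add: negligible_iff_null_sets null_sets_completionI)
  ultimately show False by simp
qed

lemma set_integrable_continuous_on:
  fixes f :: "real \<Rightarrow> 'a::euclidean_space"
  assumes "continuous_on {a..b} f"
  shows "set_integrable lborel {a<..<b} f"
  by (rule set_integrable_subset[of _ "{a..b}"], rule borel_integrable_atLeastAtMost'[OF assms]) auto

lemma set_integrable_imp_integrable_on_Icc:
  fixes v :: "real \<Rightarrow> 'a::euclidean_space"
  assumes "set_integrable lborel {a<..<b} v"
  shows "v integrable_on {a..b}"
  using set_borel_integral_eq_integral(1)[OF assms] by (simp add: integrable_on_open_interval_real)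

lemma continuous_on_indefinite:
  fixes v :: "real \<Rightarrow> 'a::euclidean_space"
  assumes "set_integrable lborel {a<..<b} v"
  shows "continuous_on {a..b} (\<lambda>x. integral {a..x} v)"
  by (intro indefinite_integral_continuous_1 set_integrable_imp_integrable_on_Icc assms)

lemma bounded_of_continuous_on_compact:
  fixes g :: "real \<Rightarrow> 'a::real_normed_vector"
  assumes "compact S" "continuous_on S g"
  shows "\<exists>B. \<forall>x\<in>S. norm (g x) \<le> B"
  using compact_imp_bounded[OF compact_continuous_image[OF assms(2,1)]] unfolding bounded_iff by blast

lemma continuous_on_set_borel_measurable:
  fixes g :: "real \<Rightarrow> 'a::euclidean_space"
  assumes "continuous_on T g" "S \<subseteq> T" "S \<in> sets borel"
  shows "set_borel_measurable borel S g" "set_borel_measurable lborel S g"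
  using set_measurable_continuous_on[OF assms(3) continuous_on_subset[OF assms(1,2)]]
  by (auto simp: set_borel_measurable_def)

lemma set_integrable_continuous_mult:
  fixes v :: "real \<Rightarrow> 'a::euclidean_space" and g :: "real \<Rightarrow> real"
  assumes v: "set_integrable lborel {a<..<b} v" and g: "continuous_on {a..b} g"
  shows "set_integrable lborel {a<..<b} (\<lambda>x. g x *\<^sub>R v x)"
proof -
  obtain B where "\<forall>x\<in>{a..b}. norm (g x) \<le> B" using bounded_of_continuous_on_compact[OF compact_Icc g] by blast
  then show ?thesis
    by (intro set_integrable_bounded_mult[OF v, where B=B] continuous_on_set_borel_measurable[OF g]) auto
qed

lemma test_fun_set_integrable:
  fixes v :: "real \<Rightarrow> 'a::euclidean_space"
  assumes v: "set_integrable lborel {a<..<b} v" and phi: "\<phi> \<in> test_fun {a<..<b}"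
  shows "set_integrable lborel {a<..<b} (\<lambda>x. \<phi> x *\<^sub>R v x)"
    "set_integrable lborel {a<..<b} (\<lambda>x. deriv \<phi> x *\<^sub>R v x)"
  by (intro set_integrable_continuous_mult[OF v] continuous_on_subset[OF test_fun_D(2)[OF phi]]
        continuous_on_subset[OF test_fun_D(3)[OF phi]] subset_UNIV)+

text \<open>
  The difference of \<open>u\<close> and the indefinite integral of \<open>v\<close> has weak derivative \<open>0\<close>.
\<close>

lemma is_wderiv_representation:
  fixes u v :: "real \<Rightarrow> 'a::euclidean_space"
  assumes ab: "a < b" and u: "set_integrable lborel {a<..<b} u" and v: "set_integrable lborel {a<..<b} v"
    and d: "is_wderiv {a<..<b} u v"
  shows "\<exists>c. AE x\<in>{a<..<b} in lborel. u x = c + integral {a..x} v"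
proof -
  define U where "U x = integral {a..x} v" for x
  have U: "set_integrable lborel {a<..<b} U"
    unfolding U_def by (intro set_integrable_continuous_on continuous_on_indefinite v)
  have dU: "is_wderiv {a<..<b} U v"
    by (rule is_wderiv_integral[OF v, where c=0]) (auto simp: U_def)
  have "\<exists>k. AE x\<in>{a<..<b} in lborel. u x - U x = k"
  proof (rule du_Bois_Reymond[OF ab])
    show "set_integrable lborel {a<..<b} (\<lambda>x. u x - U x)" by (intro set_integral_diff u U)
    fix \<phi> assume phi: "\<phi> \<in> test_fun {a<..<b}"
    show "(LINT x:{a<..<b}|lborel. deriv \<phi> x *\<^sub>R (u x - U x)) = 0"
      using d dU phi
      by (simp add: scaleR_diff_right set_integral_diff(2) test_fun_set_integrable[OF u phi] test_fun_set_integrable[OF U phi] is_wderiv_def)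
  qed
  then obtain k where "AE x\<in>{a<..<b} in lborel. u x - U x = k" by blast
  then have "AE x\<in>{a<..<b} in lborel. u x = k + integral {a..x} v"
    by eventually_elim (auto simp: U_def algebra_simps)
  then show ?thesis by blast
qed

text \<open>
  The indefinite integral of the difference \<open>w\<close> of two weak derivatives has weak derivative \<open>w\<close>, but
  also \<open>0\<close>. So it is constant, and all integrals of \<open>w\<close> over subintervals vanish.
\<close>

lemma is_wderiv_unique_interval:
  fixes u v v' :: "real \<Rightarrow> 'a::euclidean_space"
  assumes ab: "a < b" and v: "set_integrable lborel {a<..<b} v" "set_integrable lborel {a<..<b} v'"
    and d: "is_wderiv {a<..<b} u v" "is_wderiv {a<..<b} u v'"
  shows "AE x\<in>{a<..<b} in lborel. v x = v' x"
proof -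
  define w where "w x = v x - v' x" for x
  define U where "U x = integral {a..x} w" for x
  have w: "set_integrable lborel {a<..<b} w" unfolding w_def by (intro set_integral_diff v)
  have Uc: "continuous_on {a..b} U" unfolding U_def by (intro continuous_on_indefinite w)
  have dU: "is_wderiv {a<..<b} U w"
    by (rule is_wderiv_integral[OF w, where c=0]) (auto simp: U_def)
  have "\<exists>k. AE x\<in>{a<..<b} in lborel. U x = k"
  proof (rule du_Bois_Reymond[OF ab])
    show "set_integrable lborel {a<..<b} U" by (intro set_integrable_continuous_on Uc)
    fix \<phi> assume phi: "\<phi> \<in> test_fun {a<..<b}"
    have "(LINT x:{a<..<b}|lborel. \<phi> x *\<^sub>R w x) = 0"
      using d phi unfolding w_def
      by (simp add: scaleR_diff_right set_integral_diff(2) test_fun_set_integrable[OF v(1) phi] test_fun_set_integrable[OF v(2) phi] is_wderiv_def)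
    then show "(LINT x:{a<..<b}|lborel. deriv \<phi> x *\<^sub>R U x) = 0"
      using dU phi by (simp add: is_wderiv_def)
  qed
  then obtain k where k: "AE x\<in>{a<..<b} in lborel. U x = k" by blast
  have Uk: "U x = k" if "x \<in> {a<..<b}" for x
    by (rule continuous_AE_eq_imp_eq[OF _ _ _ k that])
       (auto intro: continuous_on_subset[OF Uc])
  have wi: "w integrable_on {a..b}" using w by (rule set_integrable_imp_integrable_on_Icc)
  have "integral {c..d} w = (d - c) *\<^sub>R 0" if "a < c" "c < d" "d < b" for c d
  proof -
    have "integral {a..c} w + integral {c..d} w = integral {a..d} w"
      using that by (intro Henstock_Kurzweil_Integration.integral_combine integrable_on_subinterval[OF wi]) auto
    then show ?thesis using Uk[of c] Uk[of d] that by (simp add: U_def)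
  qed
  then have "AE x\<in>{a<..<b} in lborel. w x = 0"
    by (rule AE_eq_const_of_integrals[OF w])
  then show ?thesis by eventually_elim (auto simp: w_def)
qed

text \<open>
  An open set is covered by its countably many subintervals with rational endpoints.
\<close>

lemma is_wderiv_unique:
  fixes u v v' :: "real \<Rightarrow> 'a::euclidean_space"
  assumes S: "open S" and v: "set_integrable lborel S v" "set_integrable lborel S v'"
    and d: "is_wderiv S u v" "is_wderiv S u v'"
  shows "AE x\<in>S in lborel. v x = v' x"
proof -
  define P where "P = {(r::rat,s::rat). r < s \<and> {real_of_rat r<..<real_of_rat s} \<subseteq> S}"
  have "AE x in lborel. \<forall>p\<in>P. x \<in> {real_of_rat (fst p)<..<real_of_rat (snd p)} \<longrightarrow> v x = v' x"
  proof (rule AE_ball_countable')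
    show "countable P" by simp
    fix p assume p: "p \<in> P"
    then have s: "{real_of_rat (fst p)<..<real_of_rat (snd p)} \<subseteq> S" "fst p < snd p" by (auto simp: P_def)
    show "AE x\<in>{real_of_rat (fst p)<..<real_of_rat (snd p)} in lborel. v x = v' x"
      by (rule is_wderiv_unique_interval[where u=u])
         (use s in \<open>auto simp: of_rat_less intro: set_integrable_subset v is_wderiv_subset d\<close>)
  qed
  then show ?thesis
  proof eventually_elim
    case (elim x)
    show ?case
    proof
      assume "x \<in> S"
      then obtain e where e: "e > 0" "{x-e<..<x+e} \<subseteq> S"
        using S open_contains_ball[of S] by (auto simp: ball_eq_greaterThanLessThan)
      obtain r where r: "x - e < real_of_rat r" "real_of_rat r < x" using of_rat_dense[of "x-e" x] e by auto
      obtain s where s: "x < real_of_rat s" "real_of_rat s < x + e" using of_rat_dense[of x "x+e"] e by auto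
      have "real_of_rat r < real_of_rat s" using r s by linarith
      then have "(r,s) \<in> P" using r s e(2) by (auto simp: P_def of_rat_less)
      then show "v x = v' x" using elim r s by force
    qed
  qed
qed

text \<open>
  Identifies the value that the choice operator in \<open>crep\<close> yields: two continuous representatives
  agree on \<open>S\<close>, because open sets of measure zero are empty, and hence on its closure.
\<close>

lemma crep_eq:
  fixes u w :: "real \<Rightarrow> 'a::euclidean_space"
  assumes S: "open S" and w: "continuous_on (closure S) w" and ae: "AE x\<in>S in lborel. w x = u x"
    and x: "x \<in> closure S"
  shows "crep S u x = w x"
proof -
  define w' where "w' = crep S u"
  have "continuous_on (closure S) w' \<and> (AE x\<in>S in lborel. w' x = u x)"
    unfolding w'_def crep_def by (rule someI[of _ w]) (use w ae in auto)
  then have w': "continuous_on (closure S) w'" "AE x\<in>S in lborel. w' x = u x" by auto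
  have "AE x\<in>S in lborel. w' x = w x" using w'(2) ae by eventually_elim auto
  then have eq: "w' y - w y = 0" if "y \<in> S" for y
    using continuous_AE_eq_imp_eq[OF S _ _ _ that, of w' w]
      continuous_on_subset[OF w closure_subset] continuous_on_subset[OF w'(1) closure_subset]
    by simp
  have "w' x - w x = 0"
    by (rule continuous_constant_on_closure[OF _ eq x]) (intro continuous_intros w w')
  then show ?thesis by (simp add: w'_def)
qed

lemma L2_imp_set_integrable:
  fixes u :: "real \<Rightarrow> 'a::euclidean_space"
  assumes u: "u \<in> L2 S" and S: "S \<in> sets borel" "S \<subseteq> {a..b}"
  shows "set_integrable lborel S u"
proof (rule set_integrable_bound[where f="\<lambda>x. 1 + (norm (u x))\<^sup>2"])
  have "set_integrable lborel S (\<lambda>_. 1::real)"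
    by (rule set_integrable_subset[of _ "{a..b}"], rule borel_integrable_atLeastAtMost') (use S in auto)
  then show "set_integrable lborel S (\<lambda>x. 1 + (norm (u x))\<^sup>2)"
    using u by (intro set_integral_add) (auto simp: L2_def)
  show "set_borel_measurable lborel S u" using u by (auto simp: L2_def)
  have "t \<le> 1 + t\<^sup>2" for t :: real using sum_power2_ge_zero[of "t - 1/2" 0] by (simp add: power2_eq_square algebra_simps)
  then show "AE x in lborel. x \<in> S \<longrightarrow> norm (u x) \<le> norm (1 + (norm (u x))\<^sup>2)"
    by (intro AE_I2) auto
qed

lemma bounded_imp_L2:
  fixes u :: "real \<Rightarrow> 'a::euclidean_space"
  assumes u: "set_borel_measurable lborel S u" and S: "S \<in> sets borel" "S \<subseteq> {a..b}"
    and B: "\<And>x. x \<in> S \<Longrightarrow> norm (u x) \<le> B"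
  shows "u \<in> L2 S"
proof -
  have [measurable]: "(\<lambda>x. indicator S x *\<^sub>R u x) \<in> borel_measurable lborel"
    using u by (auto simp: set_borel_measurable_def)
  have m: "set_borel_measurable lborel S (\<lambda>x. (norm (u x))\<^sup>2)"
  proof -
    have "(\<lambda>x. indicator S x *\<^sub>R (norm (u x))\<^sup>2) = (\<lambda>x. (norm (indicator S x *\<^sub>R u x))\<^sup>2)"
      by (auto simp: indicator_def)
    also have "\<dots> \<in> borel_measurable lborel" by measurable
    finally show ?thesis unfolding set_borel_measurable_def .
  qed
  have one: "set_integrable lborel S (\<lambda>_. B\<^sup>2::real)"
    by (rule set_integrable_subset[of _ "{a..b}"], rule borel_integrable_atLeastAtMost') (use S in auto)
  have "set_integrable lborel S (\<lambda>x. (norm (u x))\<^sup>2)"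
    by (rule set_integrable_bound[OF one m]) (auto intro!: AE_I2 power_mono B)
  then show ?thesis using u by (simp add: L2_def)
qed

lemma H1_wderiv:
  assumes "u \<in> H1 S"
  shows "wderiv S u \<in> L2 S" "is_wderiv S u (wderiv S u)"
proof -
  have "\<exists>v. v \<in> L2 S \<and> is_wderiv S u v" using assms by (auto simp: H1_def)
  then have "wderiv S u \<in> L2 S \<and> is_wderiv S u (wderiv S u)" unfolding wderiv_def by (rule someI_ex)
  then show "wderiv S u \<in> L2 S" "is_wderiv S u (wderiv S u)" by auto
qed

lemma wderiv_AE_eq:
  fixes u v :: "real \<Rightarrow> 'a::euclidean_space"
  assumes S: "open S" "S \<subseteq> {a..b}" and v: "v \<in> L2 S" "is_wderiv S u v"
  shows "AE x\<in>S in lborel. wderiv S u x = v x"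
proof -
  have "\<exists>v. v \<in> L2 S \<and> is_wderiv S u v" using v by auto
  then have "wderiv S u \<in> L2 S \<and> is_wderiv S u (wderiv S u)" unfolding wderiv_def by (rule someI_ex)
  then show ?thesis
    using S v by (intro is_wderiv_unique[OF S(1)]) (auto intro: L2_imp_set_integrable)
qed

section \<open>The first-order system: stability and existence\<close>

text \<open>
  With \<open>I\<close> the indefinite integral of \<open>e\<close>, the function \<open>exp (- M x) (E + M I x)\<close> decreases.
\<close>

lemma gronwall_integral:
  fixes e :: "real \<Rightarrow> real"
  assumes e: "continuous_on {0..1} e" and M: "0 \<le> M" and E: "0 \<le> E"
    and le: "\<And>x. x \<in> {0..1} \<Longrightarrow> e x \<le> E + M * integral {0..x} e" and x: "x \<in> {0..1}"
  shows "e x \<le> E * exp M"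
proof -
  define I where "I x = integral {0..x} e" for x
  define G where "G x = exp (- (M * x)) * (E + M * I x)" for x
  have dI: "(I has_real_derivative e y) (at y within {0..1})" if "y \<in> {0..1}" for y
    unfolding I_def by (rule integral_has_real_derivative[OF e that])
  have cI: "continuous_on {0..1} I" by (rule DERIV_continuous_on) (rule dI)
  have "G x \<le> G 0"
  proof (rule DERIV_nonpos_imp_decreasing_open[of 0 x G])
    show "0 \<le> x" using x by simp
    show "continuous_on {0..x} G"
      unfolding G_def by (intro continuous_intros continuous_on_subset[OF cI]) (use x in auto)
    fix y assume y: "0 < y" "y < x"
    have "at y within {0..1} = at y" by (rule at_within_interior) (use y x in auto)
    then have "(I has_real_derivative e y) (at y)" using dI[of y] y x by simp
    then have "(G has_real_derivative exp (- (M * y)) * (M * e y) - M * exp (- (M * y)) * (E + M * I y)) (at y)"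
      unfolding G_def by (auto intro!: derivative_eq_intros simp: algebra_simps)
    moreover have "exp (- (M * y)) * (M * e y) - M * exp (- (M * y)) * (E + M * I y)
        = exp (- (M * y)) * M * (e y - (E + M * I y))" by (simp add: algebra_simps)
    moreover have "\<dots> \<le> 0"
      using le[of y] y x M by (intro mult_nonneg_nonpos) (auto simp: I_def)
    ultimately show "\<exists>z. (G has_real_derivative z) (at y) \<and> z \<le> 0" by metis
  qed
  then have G: "exp (- (M * x)) * (E + M * I x) \<le> E" by (simp add: G_def I_def)
  have "e x \<le> E + M * I x" using le[OF x] by (simp add: I_def)
  also have "\<dots> = exp (M * x) * (exp (- (M * x)) * (E + M * I x))" by (simp add: exp_minus field_simps)
  also have "\<dots> \<le> exp (M * x) * E" by (intro mult_left_mono G) auto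
  also have "\<dots> \<le> exp M * E" using x M E by (intro mult_right_mono) (auto simp: mult_left_le)
  finally show ?thesis by (simp add: mult.commute)
qed

definition bdd_coeff :: "real \<Rightarrow> (real \<Rightarrow> real) \<Rightarrow> bool" where
  "bdd_coeff Q q \<longleftrightarrow> q \<in> borel_measurable borel \<and> (\<forall>x. \<bar>q x\<bar> \<le> Q)"

text \<open>
  The integral form of \<open>v' = q z\<close>, \<open>z' = h\<close>, \<open>v(0) = c\<close>, \<open>z(0) = 0\<close> on the unit interval. In the limit
  problem \<open>q\<close> jumps at \<open>x1\<close> and \<open>x2\<close>, which the differential form would not allow. The right-hand
  side \<open>h\<close> is a function of \<open>t\<close> alone: with \<open>h t = lam * v t - f (v t)\<close> this is the nonlinear system,
  with \<open>h t = (lam - f' (U t)) * v t\<close> its linearisation, and differences of solutions are of the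
  same form.
\<close>

definition is_flow :: "(real \<Rightarrow> real) \<Rightarrow> (real \<Rightarrow> real) \<Rightarrow> real \<Rightarrow> (real \<Rightarrow> real) \<Rightarrow> (real \<Rightarrow> real) \<Rightarrow> bool" where
  "is_flow q h c v z \<longleftrightarrow> continuous_on {0..1} h \<and>
     (\<forall>x\<in>{0..1}. v x = c + integral {0..x} (\<lambda>t. q t * z t)) \<and>
     (\<forall>x\<in>{0..1}. z x = integral {0..x} h)"

lemma bdd_coeff_nonneg: "bdd_coeff Q q \<Longrightarrow> 0 \<le> Q"
  unfolding bdd_coeff_def by (meson abs_ge_zero order_trans)

lemma bdd_coeff_mult_set_integrable:
  assumes q: "bdd_coeff Q q" and z: "continuous_on {0..1} z"
  shows "set_integrable lborel {0..1} (\<lambda>t. q t * z t)"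
proof -
  have "set_integrable lborel {0..1} z" by (rule borel_integrable_atLeastAtMost'[OF z])
  then have "set_integrable lborel {0..1} (\<lambda>t. q t *\<^sub>R z t)"
    using q by (intro set_integrable_bounded_mult[where B=Q]) (auto simp: bdd_coeff_def set_borel_measurable_def)
  then show ?thesis by simp
qed

lemma bdd_coeff_mult_integrable_on:
  assumes q: "bdd_coeff Q q" and z: "continuous_on {0..1} z" and ab: "0 \<le> a" "b \<le> 1"
  shows "(\<lambda>t. q t * z t) integrable_on {a..b}"
  by (rule set_borel_integral_eq_integral(1), rule set_integrable_subset[OF bdd_coeff_mult_set_integrable[OF q z]])
     (use ab in auto)

lemma bdd_coeff_integral_continuous:
  assumes q: "bdd_coeff Q q" and z: "continuous_on {0..1} z"
  shows "continuous_on {0..1} (\<lambda>x. integral {0..x} (\<lambda>t. q t * z t))"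
  by (rule indefinite_integral_continuous_1[OF bdd_coeff_mult_integrable_on[OF q z]]) auto

lemma is_flow_continuous:
  assumes q: "bdd_coeff Q q" and f: "is_flow q h c v z"
  shows "continuous_on {0..1} z" "continuous_on {0..1} v" "continuous_on {0..1} h"
proof -
  show h: "continuous_on {0..1} h" using f by (simp add: is_flow_def)
  have "continuous_on {0..1} (\<lambda>x. integral {0..x} h)"
    by (intro indefinite_integral_continuous_1 integrable_continuous_real h)
  moreover have "z x = integral {0..x} h" if "x \<in> {0..1}" for x using f that by (auto simp: is_flow_def)
  ultimately show z: "continuous_on {0..1} z" by (auto intro: continuous_on_eq)
  have "continuous_on {0..1} (\<lambda>x. c + integral {0..x} (\<lambda>t. q t * z t))"
    by (intro continuous_intros bdd_coeff_integral_continuous[OF q z])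
  moreover have "v x = c + integral {0..x} (\<lambda>t. q t * z t)" if "x \<in> {0..1}" for x
    using f that by (auto simp: is_flow_def)
  ultimately show "continuous_on {0..1} v" by (auto intro: continuous_on_eq)
qed

lemma bdd_coeff_diff_abs: "bdd_coeff Q q \<Longrightarrow> bdd_coeff Q' q' \<Longrightarrow> bdd_coeff (Q + Q') (\<lambda>x. \<bar>q x - q' x\<bar>)"
proof -
  assume a: "bdd_coeff Q q" "bdd_coeff Q' q'"
  then have [measurable]: "q \<in> borel_measurable borel" "q' \<in> borel_measurable borel" by (auto simp: bdd_coeff_def)
  have "\<bar>\<bar>q x - q' x\<bar>\<bar> \<le> Q + Q'" for x
    using a by (auto simp: bdd_coeff_def intro: order_trans[OF abs_triangle_ineq4] add_mono)
  then show ?thesis unfolding bdd_coeff_def by auto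
qed

text \<open>
  The error in \<open>v'\<close> is \<open>q1 (z1 - z2) + (q1 - q2) z2\<close>, so the change of the coefficient enters through its
  \<open>L^1\<close> norm. Gronwall's inequality applies to the sum of the two errors.
\<close>

lemma flow_stability:
  assumes q1: "bdd_coeff Q q1" and q2: "bdd_coeff Q' q2"
    and f1: "is_flow q1 h1 c1 v1 z1" and f2: "is_flow q2 h2 c2 v2 z2"
    and B: "\<And>t. t \<in> {0..1} \<Longrightarrow> \<bar>z2 t\<bar> \<le> B"
    and d: "integral {0..1} (\<lambda>t. \<bar>q1 t - q2 t\<bar>) \<le> d"
    and L: "0 \<le> L" and r: "0 \<le> r"
    and h: "\<And>t. t \<in> {0..1} \<Longrightarrow> \<bar>h1 t - h2 t\<bar> \<le> L * \<bar>v1 t - v2 t\<bar> + r"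
    and x: "x \<in> {0..1}"
  shows "\<bar>v1 x - v2 x\<bar> + \<bar>z1 x - z2 x\<bar> \<le> (\<bar>c1 - c2\<bar> + B * d + r) * exp (Q + L)"
proof (rule gronwall_integral[where e="\<lambda>x. \<bar>v1 x - v2 x\<bar> + \<bar>z1 x - z2 x\<bar>"])
  note c1 = is_flow_continuous[OF q1 f1] and c2 = is_flow_continuous[OF q2 f2]
  have Q: "0 \<le> Q" using bdd_coeff_nonneg[OF q1] .
  have B0: "0 \<le> B" using B[of 0] by auto
  note cd = bdd_coeff_diff_abs[OF q1 q2]
  have qi: "(\<lambda>t. \<bar>q1 t - q2 t\<bar>) integrable_on {a..b}" if "0 \<le> a" "b \<le> 1" for a b
    using bdd_coeff_mult_integrable_on[OF cd, of "\<lambda>_. 1" a b] that by simp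
  have "0 \<le> integral {0..1} (\<lambda>t. \<bar>q1 t - q2 t\<bar>)" by (rule integral_nonneg) (use qi in auto)
  then have d0: "0 \<le> d" using d by simp
  show "continuous_on {0..1} (\<lambda>x. \<bar>v1 x - v2 x\<bar> + \<bar>z1 x - z2 x\<bar>)"
    by (intro continuous_intros c1 c2)
  show "0 \<le> Q + L" using Q L by simp
  show "0 \<le> \<bar>c1 - c2\<bar> + B * d + r" using B0 d0 r by simp
  show "x \<in> {0..1}" by (rule x)
  fix x :: real assume x: "x \<in> {0..1}"
  have ss: "{0..x} \<subseteq> {0..1}" using x by auto
  note ci = continuous_on_subset[OF _ ss]
  have iz: "(\<lambda>t. \<bar>z1 t - z2 t\<bar>) integrable_on {0..x}" and iv: "(\<lambda>t. \<bar>v1 t - v2 t\<bar>) integrable_on {0..x}"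
    by (intro integrable_continuous_real continuous_intros ci c1 c2)+
  have i1: "(\<lambda>t. q1 t * z1 t) integrable_on {0..x}" "(\<lambda>t. q2 t * z2 t) integrable_on {0..x}"
    by (intro bdd_coeff_mult_integrable_on[OF q1 c1(1)] bdd_coeff_mult_integrable_on[OF q2 c2(1)]; use x in auto)+
  have iq: "(\<lambda>t. \<bar>q1 t - q2 t\<bar>) integrable_on {0..x}" using qi x by auto
  have "v1 x - v2 x = (c1 - c2) + integral {0..x} (\<lambda>t. q1 t * z1 t - q2 t * z2 t)"
    using f1 f2 x by (simp add: is_flow_def integral_diff[OF i1])
  moreover have "\<bar>integral {0..x} (\<lambda>t. q1 t * z1 t - q2 t * z2 t)\<bar>
      \<le> integral {0..x} (\<lambda>t. Q * \<bar>z1 t - z2 t\<bar> + B * \<bar>q1 t - q2 t\<bar>)"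
    unfolding real_norm_def[symmetric]
  proof (rule integral_norm_bound_integral)
    show "(\<lambda>t. q1 t * z1 t - q2 t * z2 t) integrable_on {0..x}" by (intro integrable_diff i1)
    show "(\<lambda>t. Q * norm (z1 t - z2 t) + B * norm (q1 t - q2 t)) integrable_on {0..x}"
      unfolding real_norm_def by (intro integrable_add integrable_on_mult_right iz iq)
    fix t assume t: "t \<in> {0..x}"
    have "q1 t * z1 t - q2 t * z2 t = q1 t * (z1 t - z2 t) + (q1 t - q2 t) * z2 t" by (simp add: algebra_simps)
    then have "\<bar>q1 t * z1 t - q2 t * z2 t\<bar> \<le> \<bar>q1 t\<bar> * \<bar>z1 t - z2 t\<bar> + \<bar>q1 t - q2 t\<bar> * \<bar>z2 t\<bar>"
      by (metis abs_mult abs_triangle_ineq)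
    also have "\<dots> \<le> Q * \<bar>z1 t - z2 t\<bar> + \<bar>q1 t - q2 t\<bar> * B"
      using q1 B[of t] t x by (intro add_mono mult_right_mono mult_left_mono) (auto simp: bdd_coeff_def)
    finally show "norm (q1 t * z1 t - q2 t * z2 t) \<le> Q * norm (z1 t - z2 t) + B * norm (q1 t - q2 t)"
      by (simp add: mult.commute)
  qed
  moreover have "integral {0..x} (\<lambda>t. Q * \<bar>z1 t - z2 t\<bar> + B * \<bar>q1 t - q2 t\<bar>)
      = Q * integral {0..x} (\<lambda>t. \<bar>z1 t - z2 t\<bar>) + B * integral {0..x} (\<lambda>t. \<bar>q1 t - q2 t\<bar>)"
    by (subst integral_add) (intro integrable_on_mult_right iz iq, intro integrable_on_mult_right iz iq, simp)
  moreover have "integral {0..x} (\<lambda>t. \<bar>q1 t - q2 t\<bar>) \<le> integral {0..1} (\<lambda>t. \<bar>q1 t - q2 t\<bar>)"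
    by (rule integral_subset_le[OF ss]) (use iq qi in auto)
  then have "B * integral {0..x} (\<lambda>t. \<bar>q1 t - q2 t\<bar>) \<le> B * d"
    using d B0 by (intro mult_left_mono) auto
  ultimately have v: "\<bar>v1 x - v2 x\<bar> \<le> \<bar>c1 - c2\<bar> + Q * integral {0..x} (\<lambda>t. \<bar>z1 t - z2 t\<bar>) + B * d"
    by linarith
  have ih: "h1 integrable_on {0..x}" "h2 integrable_on {0..x}"
    by (intro integrable_continuous_real ci c1 c2)+
  have "z1 x - z2 x = integral {0..x} (\<lambda>t. h1 t - h2 t)"
    using f1 f2 x by (simp add: is_flow_def integral_diff[OF ih])
  moreover have "\<bar>integral {0..x} (\<lambda>t. h1 t - h2 t)\<bar> \<le> integral {0..x} (\<lambda>t. L * \<bar>v1 t - v2 t\<bar> + r)"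
    unfolding real_norm_def[symmetric]
    by (rule integral_norm_bound_integral)
       (use h x in \<open>auto intro!: integrable_diff ih integrable_add integrable_on_mult_right iv\<close>)
  moreover have "integral {0..x} (\<lambda>t. L * \<bar>v1 t - v2 t\<bar> + r) = L * integral {0..x} (\<lambda>t. \<bar>v1 t - v2 t\<bar>) + r * x"
    by (subst integral_add) (use x in \<open>auto intro!: integrable_on_mult_right iv\<close>)
  moreover have "r * x \<le> r" using r x by (auto simp: mult_left_le)
  ultimately have z: "\<bar>z1 x - z2 x\<bar> \<le> L * integral {0..x} (\<lambda>t. \<bar>v1 t - v2 t\<bar>) + r" by linarith
  have nn: "0 \<le> integral {0..x} (\<lambda>t. \<bar>v1 t - v2 t\<bar>)" "0 \<le> integral {0..x} (\<lambda>t. \<bar>z1 t - z2 t\<bar>)"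
    by (auto intro!: integral_nonneg iv iz)
  have "(Q + L) * integral {0..x} (\<lambda>t. \<bar>v1 t - v2 t\<bar> + \<bar>z1 t - z2 t\<bar>)
      = (Q + L) * (integral {0..x} (\<lambda>t. \<bar>v1 t - v2 t\<bar>) + integral {0..x} (\<lambda>t. \<bar>z1 t - z2 t\<bar>))"
    by (subst integral_add[OF iv iz]) simp
  moreover have "Q * integral {0..x} (\<lambda>t. \<bar>z1 t - z2 t\<bar>) + L * integral {0..x} (\<lambda>t. \<bar>v1 t - v2 t\<bar>)
    \<le> (Q + L) * (integral {0..x} (\<lambda>t. \<bar>v1 t - v2 t\<bar>) + integral {0..x} (\<lambda>t. \<bar>z1 t - z2 t\<bar>))"
    using nn Q L by (simp add: algebra_simps)
  ultimately show "\<bar>v1 x - v2 x\<bar> + \<bar>z1 x - z2 x\<bar> \<le> (\<bar>c1 - c2\<bar> + B * d + r)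
      + (Q + L) * integral {0..x} (\<lambda>x. \<bar>v1 x - v2 x\<bar> + \<bar>z1 x - z2 x\<bar>)"
    using v z by linarith
qed

lemma integral_exp_le:
  fixes K :: real assumes "K > 0" "0 \<le> y"
  shows "integral {0..y} (\<lambda>t. exp (K * t)) \<le> exp (K * y) / K"
proof -
  have "((\<lambda>t. exp (K * t)) has_integral exp (K * y) / K - exp (K * 0) / K) {0..y}"
    by (rule fundamental_theorem_of_calculus)
       (use assms in \<open>auto intro!: derivative_eq_intros simp: has_real_derivative_iff_has_vector_derivative[symmetric]\<close>)
  then have "integral {0..y} (\<lambda>t. exp (K * t)) = exp (K * y) / K - 1 / K" by (simp add: integral_unique)
  then show ?thesis using assms by simp
qed

text \<open>
  Picard's fixed point argument in the space of bounded continuous functions, for the unknown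
  \<open>w x = exp (- K x) v x\<close>. The exponential weight makes the integral operator a contraction on the
  whole unit interval when \<open>K\<close> is large. The space consists of functions on the whole line, so
  arguments are first projected to the unit interval.
\<close>

lemma flow_exists:
  assumes q: "bdd_coeff Q q"
    and H: "\<And>v. continuous_on {0..1} v \<Longrightarrow> continuous_on {0..1} (\<lambda>t. h t (v t))"
    and Lip: "\<And>t y y'. t \<in> {0..1} \<Longrightarrow> \<bar>h t y - h t y'\<bar> \<le> L * \<bar>y - y'\<bar>" and L: "0 \<le> L"
  shows "\<exists>v z. is_flow q (\<lambda>t. h t (v t)) c v z"
proof -
  have Q: "0 \<le> Q" using bdd_coeff_nonneg[OF q] .
  \<comment> \<open>the contraction constant is \<open>Q L / K\<^sup>2\<close>; this \<open>K\<close> brings it below \<open>1/2\<close>\<close>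
  define K where "K = 1 + 2 * (Q * L)"
  have K: "K > 0" "Q * L / (K * K) \<le> 1/2"
  proof -
    have QL: "0 \<le> Q * L" using Q L by simp
    then show "K > 0" by (simp add: K_def)
    have "2 * (Q * L) \<le> K" "1 \<le> K" using QL by (auto simp: K_def)
    then have "2 * (Q * L) * 1 \<le> K * K" using QL by (intro mult_mono) auto
    then show "Q * L / (K * K) \<le> 1/2" using \<open>K > 0\<close> by (simp add: field_simps)
  qed
  define cl where "cl x = max 0 (min 1 x)" for x :: real
  have cl: "cl x \<in> {0..1}" "continuous_on S cl" for x S
    unfolding cl_def by (auto intro!: continuous_intros)
  have cl_id: "x \<in> {0..1} \<Longrightarrow> cl x = x" for x by (auto simp: cl_def)
  define Z where "Z w y = integral {0..y} (\<lambda>t. h t (exp (K * t) * w t))" for w :: "real \<Rightarrow> real" and y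
  define g where "g w x = exp (- (K * x)) * (c + integral {0..x} (\<lambda>y. q y * Z w y))" for w x
  have hc: "continuous_on {0..1} (\<lambda>t. h t (exp (K * t) * w t))" if "continuous_on {0..1} w" for w
    by (intro H continuous_intros that)
  have Zc: "continuous_on {0..1} (Z w)" if "continuous_on {0..1} w" for w
    unfolding Z_def by (intro indefinite_integral_continuous_1 integrable_continuous_real hc that)
  have gc: "continuous_on {0..1} (g w)" if "continuous_on {0..1} w" for w
    unfolding g_def by (intro continuous_intros bdd_coeff_integral_continuous[OF q] Zc that)
  have bc: "(\<lambda>x. g w (cl x)) \<in> bcontfun" if "continuous_on {0..1} w" for w
  proof -
    have "continuous_on UNIV (\<lambda>x. g w (cl x))"
      by (rule continuous_on_compose2[OF gc[OF that] cl(2)]) (use cl(1) in auto)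
    moreover have "bounded (g w ` {0..1})"
      by (intro compact_imp_bounded compact_continuous_image gc that) auto
    then have "bounded (range (\<lambda>x. g w (cl x)))"
      by (rule bounded_subset) (use cl(1) in auto)
    ultimately show ?thesis by (simp add: bcontfun_def)
  qed
  define T where "T w = Bcontfun (\<lambda>x. g (apply_bcontfun w) (cl x))" for w :: "real \<Rightarrow>\<^sub>C real"
  have T: "apply_bcontfun (T w) x = g w (cl x)" for w x
    unfolding T_def by (subst Bcontfun_inverse) (auto intro!: bc)
  have contr: "dist (T w) (T w') \<le> 1/2 * dist w w'" for w w'
  proof (rule dist_bound)
    fix x0 :: real
    define x where "x = cl x0"
    have x: "x \<in> {0..1}" using cl(1) by (simp add: x_def)
    define D where "D = dist w w'"
    have D: "\<bar>w t - w' t\<bar> \<le> D" "0 \<le> D" for t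
      using dist_bounded[of w t w'] by (auto simp: D_def dist_real_def)
    have cw: "continuous_on {0..1} (apply_bcontfun w)" "continuous_on {0..1} (apply_bcontfun w')" by auto
    have Zd: "\<bar>Z w y - Z w' y\<bar> \<le> L * D / K * exp (K * y)" if y: "y \<in> {0..1}" for y
    proof -
      have ss: "{0..y} \<subseteq> {0..1}" using y by auto
      have i: "(\<lambda>t. h t (exp (K * t) * w t)) integrable_on {0..y}" "(\<lambda>t. h t (exp (K * t) * w' t)) integrable_on {0..y}"
        by (intro integrable_continuous_real continuous_on_subset[OF hc ss] cw)+
      have "\<bar>Z w y - Z w' y\<bar> = norm (integral {0..y} (\<lambda>t. h t (exp (K * t) * w t) - h t (exp (K * t) * w' t)))"
        unfolding Z_def by (simp add: integral_diff[OF i])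
      also have "\<dots> \<le> integral {0..y} (\<lambda>t. L * D * exp (K * t))"
      proof (rule integral_norm_bound_integral)
        show "(\<lambda>t. h t (exp (K * t) * w t) - h t (exp (K * t) * w' t)) integrable_on {0..y}"
          by (intro integrable_diff i)
        show "(\<lambda>t. L * D * exp (K * t)) integrable_on {0..y}"
          by (intro integrable_continuous_real continuous_intros)
        fix t assume t: "t \<in> {0..y}"
        have "\<bar>h t (exp (K * t) * w t) - h t (exp (K * t) * w' t)\<bar> \<le> L * \<bar>exp (K * t) * w t - exp (K * t) * w' t\<bar>"
          using t y by (intro Lip) auto
        also have "\<bar>exp (K * t) * w t - exp (K * t) * w' t\<bar> = exp (K * t) * \<bar>w t - w' t\<bar>"
          by (simp add: abs_mult flip: right_diff_distrib)
        also have "L * (exp (K * t) * \<bar>w t - w' t\<bar>) \<le> L * (exp (K * t) * D)"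
          by (intro mult_left_mono D L) auto
        finally show "norm (h t (exp (K * t) * w t) - h t (exp (K * t) * w' t)) \<le> L * D * exp (K * t)"
          by (simp add: algebra_simps)
      qed
      also have "\<dots> = L * D * integral {0..y} (\<lambda>t. exp (K * t))" by simp
      also have "\<dots> \<le> L * D * (exp (K * y) / K)"
        using integral_exp_le[OF K(1)] y L D(2) by (intro mult_left_mono) auto
      finally show ?thesis by simp
    qed
    have i: "(\<lambda>y. q y * Z w y) integrable_on {0..x}" "(\<lambda>y. q y * Z w' y) integrable_on {0..x}"
      using x by (intro bdd_coeff_mult_integrable_on[OF q] Zc cw; simp)+
    have "\<bar>integral {0..x} (\<lambda>y. q y * Z w y) - integral {0..x} (\<lambda>y. q y * Z w' y)\<bar>
       = norm (integral {0..x} (\<lambda>y. q y * Z w y - q y * Z w' y))" by (simp add: integral_diff[OF i])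
    also have "\<dots> \<le> integral {0..x} (\<lambda>y. Q * (L * D / K) * exp (K * y))"
    proof (rule integral_norm_bound_integral)
      show "(\<lambda>y. q y * Z w y - q y * Z w' y) integrable_on {0..x}" by (intro integrable_diff i)
      show "(\<lambda>y. Q * (L * D / K) * exp (K * y)) integrable_on {0..x}"
        by (intro integrable_continuous_real continuous_intros)
      fix y assume y: "y \<in> {0..x}"
      have "\<bar>q y * Z w y - q y * Z w' y\<bar> = \<bar>q y\<bar> * \<bar>Z w y - Z w' y\<bar>"
        by (simp add: abs_mult flip: right_diff_distrib)
      also have "\<dots> \<le> Q * (L * D / K * exp (K * y))"
        using q y x Q by (intro mult_mono Zd) (auto simp: bdd_coeff_def)
      finally show "norm (q y * Z w y - q y * Z w' y) \<le> Q * (L * D / K) * exp (K * y)" by (simp add: algebra_simps)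
    qed
    also have "\<dots> = Q * (L * D / K) * integral {0..x} (\<lambda>y. exp (K * y))" by simp
    also have "\<dots> \<le> Q * (L * D / K) * (exp (K * x) / K)"
      using integral_exp_le[OF K(1)] x L D(2) Q K(1) by (intro mult_left_mono) auto
    finally have *: "\<bar>integral {0..x} (\<lambda>y. q y * Z w y) - integral {0..x} (\<lambda>y. q y * Z w' y)\<bar>
       \<le> Q * L / (K * K) * D * exp (K * x)" by (simp add: field_simps)
    have "dist (T w x0) (T w' x0) = exp (- (K * x)) * \<bar>integral {0..x} (\<lambda>y. q y * Z w y) - integral {0..x} (\<lambda>y. q y * Z w' y)\<bar>"
      unfolding T x_def[symmetric] g_def dist_real_def by (simp add: abs_mult flip: right_diff_distrib)
    also have "\<dots> \<le> exp (- (K * x)) * (Q * L / (K * K) * D * exp (K * x))"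
      by (intro mult_left_mono *) auto
    also have "\<dots> = Q * L / (K * K) * D" by (simp add: exp_minus)
    also have "\<dots> \<le> 1/2 * D" by (intro mult_right_mono K D)
    finally show "dist (T w x0) (T w' x0) \<le> 1/2 * dist w w'" by (simp add: D_def)
  qed
  obtain w where w: "T w = w" using banach_fix_type[of "1/2" T] contr by auto
  define v where "v t = exp (K * t) * w t" for t
  have "is_flow q (\<lambda>t. h t (v t)) c v (Z w)"
    unfolding is_flow_def
  proof (intro conjI ballI)
    show "continuous_on {0..1} (\<lambda>t. h t (v t))" unfolding v_def by (intro hc) auto
    show "Z w x = integral {0..x} (\<lambda>t. h t (v t))" for x by (simp add: Z_def v_def)
    fix x :: real assume x: "x \<in> {0..1}"
    have "w x = g w x" using T[of w x] w cl_id[OF x] by simp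
    then have "v x = exp (K * x) * (exp (- (K * x)) * (c + integral {0..x} (\<lambda>y. q y * Z w y)))"
      by (simp add: v_def g_def)
    then show "v x = c + integral {0..x} (\<lambda>t. q t * Z w t)" by (simp add: exp_minus)
  qed
  then show ?thesis by blast
qed

section \<open>Equilibria for positive \<open>\<epsilon>\<close> as solutions of the system\<close>

lemma integral_cong_AE_subinterval:
  fixes f g :: "real \<Rightarrow> 'a::euclidean_space"
  assumes ae: "AE x\<in>{a<..<b} in lborel. f x = g x" and cd: "a \<le> c" "d \<le> b"
  shows "integral {c..d} f = integral {c..d} g"
proof -
  obtain N where N: "{x \<in> space lborel. \<not> (x \<in> {a<..<b} \<longrightarrow> f x = g x)} \<subseteq> N" "N \<in> null_sets lborel"
    using AE_E[OF ae] by (auto simp: null_sets_def)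
  have "negligible N" using N(2) by (simp add: negligible_iff_null_sets null_sets_completionI)
  then have neg: "negligible (N \<union> {a, b})" by simp
  show ?thesis
    by (rule integral_spike[OF neg]) (use N(1) cd in force)
qed

lemma L2_add:
  fixes u v :: "real \<Rightarrow> 'a::euclidean_space"
  assumes u: "u \<in> L2 S" and v: "v \<in> L2 S"
  shows "(\<lambda>x. u x + v x) \<in> L2 S"
proof -
  have m: "(\<lambda>x. indicator S x *\<^sub>R u x) \<in> borel_measurable lborel" "(\<lambda>x. indicator S x *\<^sub>R v x) \<in> borel_measurable lborel"
    using u v by (auto simp: L2_def set_borel_measurable_def)
  have "(\<lambda>x. indicator S x *\<^sub>R u x + indicator S x *\<^sub>R v x) \<in> borel_measurable lborel"
    using m by measurable
  then have m1: "set_borel_measurable lborel S (\<lambda>x. u x + v x)"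
    by (simp add: set_borel_measurable_def scaleR_add_right)
  have "(\<lambda>x. (norm (indicator S x *\<^sub>R u x + indicator S x *\<^sub>R v x))\<^sup>2) \<in> borel_measurable lborel"
    using m by measurable
  also have "(\<lambda>x. (norm (indicator S x *\<^sub>R u x + indicator S x *\<^sub>R v x))\<^sup>2)
     = (\<lambda>x. indicator S x *\<^sub>R (norm (u x + v x))\<^sup>2)" by (auto simp: indicator_def)
  finally have m2: "set_borel_measurable lborel S (\<lambda>x. (norm (u x + v x))\<^sup>2)"
    by (simp add: set_borel_measurable_def)
  have i: "set_integrable lborel S (\<lambda>x. 2 * (norm (u x))\<^sup>2 + 2 * (norm (v x))\<^sup>2)"
    using u v by (intro set_integral_add set_integrable_mult_right) (auto simp: L2_def)
  have "(norm (u x + v x))\<^sup>2 \<le> 2 * (norm (u x))\<^sup>2 + 2 * (norm (v x))\<^sup>2" for x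
  proof -
    have "(norm (u x + v x))\<^sup>2 \<le> (norm (u x) + norm (v x))\<^sup>2"
      by (intro power_mono norm_triangle_ineq) auto
    also have "\<dots> \<le> 2 * (norm (u x))\<^sup>2 + 2 * (norm (v x))\<^sup>2"
      using zero_le_power2[of "norm (u x) - norm (v x)"] by (simp add: power2_eq_square algebra_simps)
    finally show ?thesis .
  qed
  then have "set_integrable lborel S (\<lambda>x. (norm (u x + v x))\<^sup>2)"
    by (intro set_integrable_bound[OF i m2]) auto
  then show ?thesis using m1 by (simp add: L2_def)
qed

lemma L2_bounded_mult:
  fixes u :: "real \<Rightarrow> 'a::euclidean_space"
  assumes u: "u \<in> L2 S" and g: "set_borel_measurable borel S g" and B: "\<And>x. x \<in> S \<Longrightarrow> \<bar>g x\<bar> \<le> B"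
  shows "(\<lambda>x. g x *\<^sub>R u x) \<in> L2 S"
proof -
  have m: "(\<lambda>x. indicator S x *\<^sub>R u x) \<in> borel_measurable lborel" "(\<lambda>x. indicator S x *\<^sub>R g x) \<in> borel_measurable lborel"
    using u g by (auto simp: L2_def set_borel_measurable_def)
  have "(\<lambda>x. (indicator S x *\<^sub>R g x) *\<^sub>R (indicator S x *\<^sub>R u x)) \<in> borel_measurable lborel"
    using m by measurable
  also have "(\<lambda>x. (indicator S x *\<^sub>R g x) *\<^sub>R (indicator S x *\<^sub>R u x)) = (\<lambda>x. indicator S x *\<^sub>R (g x *\<^sub>R u x))"
    by (auto simp: indicator_def)
  finally have m1: "set_borel_measurable lborel S (\<lambda>x. g x *\<^sub>R u x)" by (simp add: set_borel_measurable_def)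
  have "(\<lambda>x. (norm ((indicator S x *\<^sub>R g x) *\<^sub>R (indicator S x *\<^sub>R u x)))\<^sup>2) \<in> borel_measurable lborel"
    using m by measurable
  also have "(\<lambda>x. (norm ((indicator S x *\<^sub>R g x) *\<^sub>R (indicator S x *\<^sub>R u x)))\<^sup>2)
     = (\<lambda>x. indicator S x *\<^sub>R (norm (g x *\<^sub>R u x))\<^sup>2)" by (auto simp: indicator_def)
  finally have m2: "set_borel_measurable lborel S (\<lambda>x. (norm (g x *\<^sub>R u x))\<^sup>2)"
    by (simp add: set_borel_measurable_def)
  have i: "set_integrable lborel S (\<lambda>x. B\<^sup>2 * (norm (u x))\<^sup>2)"
    using u by (intro set_integrable_mult_right) (auto simp: L2_def)
  have "set_integrable lborel S (\<lambda>x. (norm (g x *\<^sub>R u x))\<^sup>2)"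
  proof (rule set_integrable_bound[OF i m2], intro AE_I2 impI)
    fix x assume x: "x \<in> S"
    have "(g x)\<^sup>2 \<le> B\<^sup>2" using power_mono[OF B[OF x], of 2] by simp
    then show "norm ((norm (g x *\<^sub>R u x))\<^sup>2) \<le> norm (B\<^sup>2 * (norm (u x))\<^sup>2)"
      by (simp add: power_mult_distrib mult_right_mono)
  qed
  then show ?thesis using m1 by (simp add: L2_def)
qed



lemma continuous_on_imp_L2:
  fixes g :: "real \<Rightarrow> 'a::euclidean_space"
  assumes g: "continuous_on {a..b} g" and S: "S \<subseteq> {a..b}" "S \<in> sets borel"
  shows "g \<in> L2 S"
proof -
  obtain B where "\<forall>x\<in>{a..b}. norm (g x) \<le> B" using bounded_of_continuous_on_compact[OF compact_Icc g] by blast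
  then show ?thesis
    by (intro bounded_imp_L2[where B=B] continuous_on_set_borel_measurable[OF g]) (use S in auto)
qed

text \<open>
  \<open>g\<close> is controlled inside the interval only, so the product is extended by \<open>0\<close>. It remains
  a test function, because \<open>\<phi>\<close> vanishes near the endpoints.
\<close>

lemma test_fun_mult_C1:
  assumes phi: "\<phi> \<in> test_fun {a<..<b}"
    and g: "\<And>x. x \<in> {a<..<b} \<Longrightarrow> (g has_real_derivative g' x) (at x)"
    and g': "continuous_on {a<..<b} g'"
  shows "\<exists>\<psi>\<in>test_fun {a<..<b}. \<forall>x\<in>{a<..<b}. \<psi> x = \<phi> x * g x \<and> deriv \<psi> x = deriv \<phi> x * g x + \<phi> x * g' x"
proof -
  from phi obtain K where K: "compact K" "K \<subseteq> {a<..<b}" "\<And>x. x \<notin> K \<Longrightarrow> \<phi> x = 0" "\<phi> \<in> test_fun K"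
    unfolding test_fun_def by blast
  note T = test_fun_D[OF K(4)]
  define \<psi> where "\<psi> x = (if x \<in> {a<..<b} then \<phi> x * g x else 0)" for x
  define \<psi>' where "\<psi>' x = (if x \<in> {a<..<b} then deriv \<phi> x * g x + \<phi> x * g' x else 0)" for x
  have oK: "open (-K)" using K(1) by (simp add: compact_imp_closed open_Compl)
  have out: "\<psi> x = 0" "\<psi>' x = 0" if "x \<notin> K" for x using T(4,5)[OF that] by (auto simp: \<psi>_def \<psi>'_def)
  have der: "(\<psi> has_real_derivative \<psi>' x) (at x)" for x
  proof (cases "x \<in> {a<..<b}")
    case True
    have "((\<lambda>x. \<phi> x * g x) has_real_derivative deriv \<phi> x * g x + \<phi> x * g' x) (at x)"
      by (rule derivative_eq_intros T(1) g[OF True] refl)+ simp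
    then have "(\<psi> has_real_derivative deriv \<phi> x * g x + \<phi> x * g' x) (at x)"
      by (rule has_field_derivative_transform_within_open[where S="{a<..<b}"]) (use True in \<open>auto simp: \<psi>_def\<close>)
    then show ?thesis using True by (simp add: \<psi>'_def)
  next
    case False
    then have x: "x \<in> -K" using K(2) by auto
    have "((\<lambda>_. 0) has_real_derivative 0) (at x)" by simp
    then have "(\<psi> has_real_derivative 0) (at x)"
      by (rule has_field_derivative_transform_within_open[where S="-K"]) (use x oK out in auto)
    then show ?thesis using out x by simp
  qed
  have gc: "continuous_on {a<..<b} g"
    by (rule DERIV_continuous_on) (rule has_field_derivative_at_within, rule g)
  have "continuous_on {a<..<b} (\<lambda>x. deriv \<phi> x * g x + \<phi> x * g' x)"
    by (intro continuous_intros gc g' continuous_on_subset[OF T(2)] continuous_on_subset[OF T(3)]) auto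
  then have c1: "continuous_on {a<..<b} \<psi>'" by (rule continuous_on_eq) (simp add: \<psi>'_def)
  have "continuous_on (-K) (\<lambda>_. 0::real)" by simp
  then have c2: "continuous_on (-K) \<psi>'" by (rule continuous_on_eq) (simp add: out)
  have "continuous_on ({a<..<b} \<union> (-K)) \<psi>'" by (intro continuous_on_open_Un c1 c2 oK) auto
  moreover have "{a<..<b} \<union> (-K) = UNIV" using K(2) by auto
  ultimately have "continuous_on UNIV \<psi>'" by simp
  then have "\<psi> C1_differentiable_on UNIV"
    unfolding C1_differentiable_on_def using der by (auto simp: has_real_derivative_iff_has_vector_derivative)
  then have "\<psi> \<in> test_fun {a<..<b}" using K out unfolding test_fun_def by blast
  moreover have "deriv \<psi> x = \<psi>' x" for x using DERIV_imp_deriv[OF der] .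
  ultimately show ?thesis by (intro bexI[of _ \<psi>]) (auto simp: \<psi>_def \<psi>'_def)
qed

text \<open>
  In the definition of the weak derivative of \<open>w\<close>, the test function \<open>\<phi> g\<close> is used.
\<close>

lemma is_wderiv_mult_C1:
  fixes w w' :: "real \<Rightarrow> 'a::euclidean_space"
  assumes w: "set_integrable lborel {a<..<b} w" and w': "set_integrable lborel {a<..<b} w'"
    and d: "is_wderiv {a<..<b} w w'"
    and g: "\<And>x. x \<in> {a..b} \<Longrightarrow> (g has_real_derivative g' x) (at x within {a..b})"
    and g': "continuous_on {a..b} g'"
  shows "is_wderiv {a<..<b} (\<lambda>x. g x *\<^sub>R w x) (\<lambda>x. g' x *\<^sub>R w x + g x *\<^sub>R w' x)"
  unfolding is_wderiv_def
proof
  fix \<phi> assume phi: "\<phi> \<in> test_fun {a<..<b}"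
  have g1: "(g has_real_derivative g' x) (at x)" if "x \<in> {a<..<b}" for x
  proof -
    have "at x within {a..b} = at x" by (rule at_within_interior) (use that in auto)
    then show ?thesis using g[of x] that by auto
  qed
  have gc: "continuous_on {a..b} g" by (rule DERIV_continuous_on) (rule g)
  obtain \<psi> where psi: "\<psi> \<in> test_fun {a<..<b}" "\<And>x. x \<in> {a<..<b} \<Longrightarrow> \<psi> x = \<phi> x * g x"
     "\<And>x. x \<in> {a<..<b} \<Longrightarrow> deriv \<psi> x = deriv \<phi> x * g x + \<phi> x * g' x"
    using test_fun_mult_C1[OF phi g1 continuous_on_subset[OF g' greaterThanLessThan_subseteq_atLeastAtMost_iff[THEN iffD2]]]
    by blast
  note I = set_integrable_continuous_mult[OF w g'] set_integrable_continuous_mult[OF w' gc]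
    set_integrable_continuous_mult[OF w gc]
  have e1: "(LINT x:{a<..<b}|lborel. deriv \<psi> x *\<^sub>R w x)
     = (LINT x:{a<..<b}|lborel. deriv \<phi> x *\<^sub>R (g x *\<^sub>R w x) + \<phi> x *\<^sub>R (g' x *\<^sub>R w x))"
    by (rule set_lebesgue_integral_cong) (auto simp: psi(3) algebra_simps)
  have e2: "\<dots> = (LINT x:{a<..<b}|lborel. deriv \<phi> x *\<^sub>R (g x *\<^sub>R w x)) + (LINT x:{a<..<b}|lborel. \<phi> x *\<^sub>R (g' x *\<^sub>R w x))"
    by (intro set_integral_add(2) test_fun_set_integrable[OF _ phi] I)
  have e3: "(LINT x:{a<..<b}|lborel. \<psi> x *\<^sub>R w' x) = (LINT x:{a<..<b}|lborel. \<phi> x *\<^sub>R (g x *\<^sub>R w' x))"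
    by (rule set_lebesgue_integral_cong) (auto simp: psi(2))
  have e4: "(LINT x:{a<..<b}|lborel. \<phi> x *\<^sub>R (g' x *\<^sub>R w x + g x *\<^sub>R w' x))
     = (LINT x:{a<..<b}|lborel. \<phi> x *\<^sub>R (g' x *\<^sub>R w x)) + (LINT x:{a<..<b}|lborel. \<phi> x *\<^sub>R (g x *\<^sub>R w' x))"
    unfolding scaleR_add_right
    by (intro set_integral_add(2) test_fun_set_integrable[OF _ phi] I)
  have "(LINT x:{a<..<b}|lborel. deriv \<psi> x *\<^sub>R w x) = - (LINT x:{a<..<b}|lborel. \<psi> x *\<^sub>R w' x)"
    using d psi(1) by (simp add: is_wderiv_def)
  then show "(LINT x:{a<..<b}|lborel. deriv \<phi> x *\<^sub>R (g x *\<^sub>R w x))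
     = - (LINT x:{a<..<b}|lborel. \<phi> x *\<^sub>R (g' x *\<^sub>R w x + g x *\<^sub>R w' x))"
    using e1 e2 e3 e4 by (simp add: algebra_simps add_eq_0_iff2)
qed

text \<open>
  The coefficient \<open>q\<close> of the system: \<open>recip_on {0..1} p\<close> for positive \<open>\<epsilon>\<close>, and
  \<open>recip_on (Om1 x1 x2) p0\<close>, which vanishes on \<open>Om0\<close>, for the limit problem.
\<close>

definition recip_on :: "real set \<Rightarrow> (real \<Rightarrow> real) \<Rightarrow> real \<Rightarrow> real" where
  "recip_on S p x = (if x \<in> S then 1 / p x else 0)"

lemma bdd_coeff_recip_on:
  assumes "continuous_on S p" "S \<in> sets borel" "0 < m" "\<And>x. x \<in> S \<Longrightarrow> m \<le> p x"
  shows "bdd_coeff (1 / m) (recip_on S p)"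
proof -
  have nz: "\<And>x. x \<in> S \<Longrightarrow> p x \<noteq> 0" using assms by (metis not_less)
  then have "continuous_on S (\<lambda>x. 1 / p x)" by (intro continuous_intros assms) auto
  then have "set_borel_measurable borel S (\<lambda>x. 1 / p x)" by (rule set_measurable_continuous_on[OF assms(2)])
  moreover have "recip_on S p = (\<lambda>x. indicator S x *\<^sub>R (1 / p x))" by (auto simp: recip_on_def)
  ultimately have "recip_on S p \<in> borel_measurable borel" by (simp add: set_borel_measurable_def)
  moreover have "\<bar>recip_on S p x\<bar> \<le> 1 / m" for x
  proof (cases "x \<in> S")
    case True
    then have "0 < p x" "m \<le> p x" using assms by (auto intro: less_le_trans)
    then show ?thesis using assms(3) True by (simp add: recip_on_def frac_le)
  next
    case False then show ?thesis using assms(3) by (simp add: recip_on_def)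
  qed
  ultimately show ?thesis by (simp add: bdd_coeff_def)
qed

lemma C2_on_D:
  assumes "C2_on S g"
  obtains g' where "\<And>x. x \<in> S \<Longrightarrow> (g has_real_derivative g' x) (at x within S)" "continuous_on S g'" "continuous_on S g"
proof -
  from assms obtain g' g'' where g: "\<And>x. x \<in> S \<Longrightarrow> (g has_real_derivative g' x) (at x within S)"
    "\<And>x. x \<in> S \<Longrightarrow> (g' has_real_derivative g'' x) (at x within S)"
    unfolding C2_on_def by blast
  show ?thesis
    by (rule that[OF g(1)]) (auto intro: DERIV_continuous_on g)
qed

text \<open>
  The functions \<open>u\<close> and \<open>p u_x\<close> are, almost everywhere, indefinite integrals of their weak
  derivatives. The boundary conditions are stated for \<open>u_x\<close>; they pass to the flux because
  \<open>p\<close> is positive.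
\<close>

lemma equilibrium_imp_flow:
  assumes p: "C2_on {0..1} p" and m: "0 < m" "\<And>x. x \<in> {0..1} \<Longrightarrow> m \<le> p x"
    and f: "continuous_on UNIV f" and u: "u \<in> equilibria p lam f"
  shows "\<exists>c v z. is_flow (recip_on {0..1} p) (\<lambda>t. lam * v t - f (v t)) c v z \<and> z 1 = 0 \<and>
    (AE x\<in>I01 in lborel. u x = v x) \<and> (AE x\<in>I01 in lborel. wderiv I01 u x = recip_on {0..1} p x * z x)"
proof -
  obtain p' where p': "\<And>x. x \<in> {0..1} \<Longrightarrow> (p has_real_derivative p' x) (at x within {0..1})"
    "continuous_on {0..1} p'" "continuous_on {0..1} p" using C2_on_D[OF p] by blast
  have pnz: "\<And>x. x \<in> {0..1} \<Longrightarrow> p x \<noteq> 0" using m by (metis not_less)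
  define w where "w = wderiv I01 u"
  define D where "D = wderiv I01 (\<lambda>y. p y * w y)"
  have u1: "u \<in> H1 I01" and w1: "w \<in> H1 I01" and cr: "crep I01 w 0 = 0" "crep I01 w 1 = 0"
    and op: "AE x\<in>I01 in lborel. - D x + lam * u x - f (u x) = 0"
    using u by (auto simp: equilibria_def dom_A_def H2_def w_def D_def op_A_def)
  have uL: "u \<in> L2 I01" and wL: "w \<in> L2 I01" and uw: "is_wderiv I01 u w"
    using u1 w1 H1_wderiv[OF u1] by (auto simp: H1_def w_def)
  note w2 = H1_wderiv[OF w1]
  have L2si: "set_integrable lborel I01 g" if "g \<in> L2 I01" for g :: "real \<Rightarrow> real"
    by (rule L2_imp_set_integrable[OF that, of 0 1]) auto
  have L2m: "(\<lambda>x. k x *\<^sub>R g x) \<in> L2 I01" if g: "g \<in> L2 I01" and k: "continuous_on {0..1} k" for g k :: "real \<Rightarrow> real"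
  proof -
    obtain B where "\<forall>x\<in>{0..1}. norm (k x) \<le> B" using bounded_of_continuous_on_compact[OF compact_Icc k] by blast
    then show ?thesis
      by (intro L2_bounded_mult[where B=B] g continuous_on_set_borel_measurable[OF k]) auto
  qed
  have "is_wderiv I01 (\<lambda>x. p x *\<^sub>R w x) (\<lambda>x. p' x *\<^sub>R w x + p x *\<^sub>R wderiv I01 w x)"
    by (intro is_wderiv_mult_C1 L2si wL w2 p')
  moreover have "(\<lambda>x. p' x *\<^sub>R w x + p x *\<^sub>R wderiv I01 w x) \<in> L2 I01"
    by (intro L2_add L2m wL w2 p')
  moreover have pwL: "(\<lambda>x. p x *\<^sub>R w x) \<in> L2 I01" by (intro L2m wL p')
  ultimately have "(\<lambda>x. p x *\<^sub>R w x) \<in> H1 I01" unfolding H1_def by blast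
  from H1_wderiv[OF this] have DL: "D \<in> L2 I01" and dD: "is_wderiv I01 (\<lambda>x. p x * w x) D" by (auto simp: D_def)
  obtain c where c: "AE x\<in>I01 in lborel. u x = c + integral {0..x} w"
    using is_wderiv_representation[OF _ L2si[OF uL] L2si[OF wL] uw] by auto
  obtain c1 where c1: "AE x\<in>I01 in lborel. p x * w x = c1 + integral {0..x} D"
    using is_wderiv_representation[OF _ _ L2si[OF DL] dD] L2si[OF pwL] by auto
  define v where "v x = c + integral {0..x} w" for x
  define h where "h t = lam * v t - f (v t)" for t
  define z where "z x = integral {0..x} h" for x
  have vc: "continuous_on {0..1} v" unfolding v_def
    by (intro continuous_intros continuous_on_indefinite L2si wL)
  have hc: "continuous_on {0..1} h" unfolding h_def
    by (intro continuous_intros vc continuous_on_compose2[OF f vc]) auto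
  have zc: "continuous_on {0..1} z" unfolding z_def
    by (intro indefinite_integral_continuous_1 integrable_continuous_real hc)
  have "AE x\<in>I01 in lborel. D x = h x"
    using op c by eventually_elim (auto simp: h_def v_def)
  from integral_cong_AE_subinterval[OF this] have Dz: "integral {0..x} D = z x" if "x \<in> {0..1}" for x
    using that by (simp add: z_def)
  have wz: "AE x\<in>I01 in lborel. (c1 + z x) / p x = w x"
    using c1 by eventually_elim (use Dz pnz in \<open>auto simp: field_simps\<close>)
  have cl: "closure I01 = {0..1}" by simp
  have "crep I01 w x = (c1 + z x) / p x" if "x \<in> {0..1}" for x
    by (rule crep_eq[OF _ _ wz]) (use that pnz in \<open>auto simp: cl intro!: continuous_intros zc p'\<close>)
  then have c10: "c1 = 0" and z1: "z 1 = 0"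
    using cr pnz[of 0] pnz[of 1] by (auto simp: z_def)
  have wq: "AE x\<in>I01 in lborel. w x = recip_on {0..1} p x * z x"
    using wz by eventually_elim (auto simp: c10 recip_on_def)
  have "is_flow (recip_on {0..1} p) (\<lambda>t. lam * v t - f (v t)) c v z"
    unfolding is_flow_def h_def[symmetric]
    using hc integral_cong_AE_subinterval[OF wq, of 0] by (auto simp: v_def z_def)
  moreover have "AE x\<in>I01 in lborel. u x = v x" using c by (simp add: v_def)
  ultimately show ?thesis using z1 wq unfolding w_def by blast
qed

lemma flow_imp_wderiv:
  assumes q: "bdd_coeff Q q" and fl: "is_flow q h c v z"
  shows "v \<in> H1 I01" "AE x\<in>I01 in lborel. wderiv I01 v x = q x * z x"
    "(\<lambda>x. q x * z x) \<in> L2 I01" "is_wderiv I01 v (\<lambda>x. q x * z x)"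
proof -
  note c = is_flow_continuous[OF q fl]
  have "z \<in> L2 I01" by (rule continuous_on_imp_L2[OF c(1)]) auto
  then have "(\<lambda>x. q x *\<^sub>R z x) \<in> L2 I01"
    by (rule L2_bounded_mult[where B=Q]) (use q in \<open>auto simp: bdd_coeff_def set_borel_measurable_def\<close>)
  then show qz: "(\<lambda>x. q x * z x) \<in> L2 I01" by simp
  show d: "is_wderiv I01 v (\<lambda>x. q x * z x)"
    by (rule is_wderiv_integral[where a=0 and b=1 and c=c])
       (use fl in \<open>auto simp: is_flow_def intro!: L2_imp_set_integrable[OF qz, of 0 1]\<close>)
  have "v \<in> L2 I01" by (rule continuous_on_imp_L2[OF c(2)]) auto
  then show "v \<in> H1 I01" using qz d by (auto simp: H1_def)
  show "AE x\<in>I01 in lborel. wderiv I01 v x = q x * z x"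
    by (rule wderiv_AE_eq[OF _ _ qz d, of 0 1]) auto
qed

text \<open>
  Here \<open>q = 1/p\<close> is continuously differentiable, so \<open>v' = q z\<close> is as well and has \<open>D2\<close> as
  derivative.
\<close>

lemma flow_imp_equilibrium:
  assumes p: "C2_on {0..1} p" and m: "0 < m" "\<And>x. x \<in> {0..1} \<Longrightarrow> m \<le> p x"
    and fl: "is_flow (recip_on {0..1} p) (\<lambda>t. lam * v t - f (v t)) c v z" and z1: "z 1 = 0"
  shows "v \<in> equilibria p lam f"
proof -
  obtain p' where p': "\<And>x. x \<in> {0..1} \<Longrightarrow> (p has_real_derivative p' x) (at x within {0..1})"
    "continuous_on {0..1} p'" "continuous_on {0..1} p" using C2_on_D[OF p] by blast
  have pnz: "\<And>x. x \<in> {0..1} \<Longrightarrow> p x \<noteq> 0" using m by (metis not_less)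
  have q: "bdd_coeff (1/m) (recip_on {0..1} p)" by (rule bdd_coeff_recip_on[OF p'(3) _ m]) auto
  note cont = is_flow_continuous[OF q fl]
  note V = flow_imp_wderiv[OF q fl]
  define h where "h t = lam * v t - f (v t)" for t
  define w where "w = wderiv I01 v"
  have wL: "w \<in> L2 I01" using H1_wderiv[OF V(1)] by (simp add: w_def)
  have wq: "AE x\<in>I01 in lborel. z x / p x = w x"
    using V(2) by eventually_elim (auto simp: w_def recip_on_def)
  have hc: "continuous_on {0..1} h" using cont(3) by (simp add: h_def)
  have zh: "z x = integral {0..x} h" if "x \<in> {0..1}" for x
    using fl that by (simp add: is_flow_def h_def[abs_def])
  have dz: "(z has_real_derivative h x) (at x within {0..1})" if "x \<in> {0..1}" for x
    by (rule has_field_derivative_transform_within[OF integral_has_real_derivative[OF hc that] zero_less_one])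
       (use that zh in auto)
  have z0: "z 0 = 0" using zh[of 0] by simp
  define D2 where "D2 x = (h x * p x - z x * p' x) / (p x * p x)" for x
  have D2c: "continuous_on {0..1} D2" unfolding D2_def
    by (intro continuous_intros hc p' cont) (use pnz in auto)
  have D2L: "D2 \<in> L2 I01" by (rule continuous_on_imp_L2[OF D2c]) auto
  have zp: "z x / p x = 0 + integral {0..x} D2" if "x \<in> I01" for x
  proof -
    have "(D2 has_integral z x / p x - z 0 / p 0) {0..x}"
    proof (rule fundamental_theorem_of_calculus)
      fix y assume y: "y \<in> {0..x}"
      have "((\<lambda>x. z x / p x) has_real_derivative D2 y) (at y within {0..1})"
        unfolding D2_def by (rule DERIV_divide[OF dz p'(1)]) (use y that pnz in auto)
      then show "((\<lambda>x. z x / p x) has_vector_derivative D2 y) (at y within {0..x})"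
        unfolding has_real_derivative_iff_has_vector_derivative
        by (rule has_vector_derivative_within_subset) (use that in auto)
    qed (use that in auto)
    then show ?thesis by (simp add: z0 integral_unique)
  qed
  have "is_wderiv I01 (\<lambda>x. z x / p x) D2"
    by (rule is_wderiv_integral[OF _ _ zp]) (auto intro!: set_integrable_continuous_on D2c)
  moreover have zpc: "continuous_on {0..1} (\<lambda>x. z x / p x)"
    by (intro continuous_intros cont p') (use pnz in auto)
  ultimately have "is_wderiv I01 w D2"
    using wL D2L wq by (elim is_wderiv_cong_AE[rotated 6])
      (auto simp: L2_def intro!: continuous_on_set_borel_measurable[OF zpc])
  then have wH: "w \<in> H1 I01" using wL D2L by (auto simp: H1_def)
  have cl: "closure I01 = {0..1}" by simp
  have crep: "crep I01 w x = z x / p x" if "x \<in> {0..1}" for x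
    by (rule crep_eq[OF _ _ wq]) (use that zpc in \<open>auto simp: cl\<close>)
  have "v \<in> dom_A"
    unfolding dom_A_def H2_def using V(1) wH crep[of 0] crep[of 1] z0 z1 by (simp add: w_def)
  moreover have "AE x\<in>I01 in lborel. wderiv I01 (\<lambda>y. p y * w y) x = h x"
  proof (rule wderiv_AE_eq[of _ 0 1])
    show hL: "h \<in> L2 I01" by (rule continuous_on_imp_L2[OF hc]) auto
    have "is_wderiv I01 z h"
      by (rule is_wderiv_integral[where c=0 and a=0 and b=1]) (auto intro!: set_integrable_continuous_on hc simp: zh)
    moreover have "AE x\<in>I01 in lborel. z x = p x * w x"
      using wq by eventually_elim (use pnz in \<open>auto simp: field_simps\<close>)
    moreover have "set_borel_measurable lborel I01 (\<lambda>x. p x * w x)"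
    proof -
      have "(\<lambda>x. (indicator I01 x *\<^sub>R p x) * (indicator I01 x *\<^sub>R w x)) \<in> borel_measurable lborel"
        using wL continuous_on_set_borel_measurable(2)[OF p'(3), of I01]
        unfolding L2_def set_borel_measurable_def by (intro borel_measurable_times) (auto simp: subset_eq)
      also have "(\<lambda>x. (indicator I01 x *\<^sub>R p x) * (indicator I01 x *\<^sub>R w x)) = (\<lambda>x. indicator I01 x *\<^sub>R (p x * w x))"
        by (auto simp: indicator_def)
      finally show ?thesis unfolding set_borel_measurable_def .
    qed
    moreover have "set_borel_measurable lborel I01 h" using hL by (simp add: L2_def)
    moreover have "set_borel_measurable lborel I01 z"
      by (rule continuous_on_set_borel_measurable(2)[OF cont(1)]) auto
    ultimately show "is_wderiv I01 (\<lambda>y. p y * w y) h"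
      using is_wderiv_cong_AE[of I01 z "\<lambda>x. p x * w x" h h] by simp
  qed auto
  then have "AE x\<in>I01 in lborel. op_A p lam v x - f (v x) = 0"
    by eventually_elim (auto simp: op_A_def h_def w_def)
  ultimately show ?thesis by (simp add: equilibria_def)
qed

section \<open>The limit problem and hyperbolicity\<close>

lemma Om1_facts:
  assumes "0 < x1" "x1 < x2" "x2 < (1::real)"
  shows "open (Om1i x1 x2)" "closure (Om1i x1 x2) = Om1 x1 x2" "Om1i x1 x2 \<subseteq> I01" "Om1 x1 x2 \<subseteq> {0..1}"
    "Om1i x1 x2 \<subseteq> Om1 x1 x2" "compact (Om1 x1 x2)" "Om1 x1 x2 \<in> sets borel" "Om1i x1 x2 \<in> sets borel"
    "Om0 x1 x2 \<subseteq> I01" "Om1 x1 x2 \<inter> Om0 x1 x2 = {}"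
  using assms unfolding Om1i_def Om1_def Om0_def by (auto simp: closure_Un)

lemma AE_I01_split:
  assumes "0 < x1" "x1 < x2" "x2 < (1::real)"
    and "AE x\<in>Om1i x1 x2 in lborel. P x" "AE x\<in>Om0 x1 x2 in lborel. P x"
  shows "AE x\<in>I01 in lborel. P x"
proof -
  have "AE x in lborel. x \<noteq> x1" "AE x in lborel. x \<noteq> x2" by (rule AE_lborel_singleton)+
  with assms(4,5) show ?thesis
    by eventually_elim (auto simp: Om1i_def Om0_def)
qed

lemma continuous_on_Om1_cases:
  fixes A B :: "real \<Rightarrow> 'a::euclidean_space"
  assumes "0 < x1" "x1 < x2" "x2 < (1::real)"
    and A: "continuous_on {0..1} A" and B: "continuous_on {0..1} B"
  shows "continuous_on (Om1 x1 x2) (\<lambda>x. if x \<le> x1 then A x else B x)"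
  unfolding Om1_def
proof (rule continuous_on_closed_Un)
  show "continuous_on {0..x1} (\<lambda>x. if x \<le> x1 then A x else B x)"
    by (rule continuous_on_eq[OF continuous_on_subset[OF A]]) (use assms in auto)
  show "continuous_on {x2..1} (\<lambda>x. if x \<le> x1 then A x else B x)"
    by (rule continuous_on_eq[OF continuous_on_subset[OF B]]) (use assms in auto)
qed auto

lemma val_Om0_eq:
  fixes u :: "real \<Rightarrow> 'a::euclidean_space"
  assumes lt: "x1 < x2" and c: "AE x\<in>Om0 x1 x2 in lborel. u x = c"
  shows "val_Om0 x1 x2 u = c"
  unfolding val_Om0_def
proof (rule the_equality)
  show "AE x\<in>Om0 x1 x2 in lborel. u x = c" by (rule c)
  fix c' assume "AE x\<in>Om0 x1 x2 in lborel. u x = c'"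
  with c have "AE x\<in>Om0 x1 x2 in lborel. c' = c" by eventually_elim auto
  then show "c' = c"
    by (rule continuous_AE_eq_imp_eq[of "Om0 x1 x2" "\<lambda>_. c'" "\<lambda>_. c" "(x1+x2)/2", rotated 3])
       (use lt in \<open>auto simp: Om0_def\<close>)
qed

lemma AE_mono_set: "AE x\<in>T in M. P x \<Longrightarrow> S \<subseteq> T \<Longrightarrow> AE x\<in>S in M. P x"
  by (erule eventually_mono) auto

lemma recip_on_Om0: "x \<in> Om0 x1 x2 \<Longrightarrow> recip_on (Om1 x1 x2) p x = 0"
  by (auto simp: recip_on_def Om0_def Om1_def)

lemma flow_const_on_Om0:
  assumes x12: "0 < x1" "x1 < x2" "x2 < 1"
    and q: "bdd_coeff Q q" and q0: "\<And>x. x \<in> Om0 x1 x2 \<Longrightarrow> q x = 0"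
    and fl: "is_flow q h c v z" and x: "x \<in> {x1..x2}"
  shows "v x = v x1"
proof -
  note cont = is_flow_continuous[OF q fl]
  have "AE t\<in>{x1<..<x2} in lborel. q t * z t = 0"
    using q0 by (intro AE_I2) (auto simp: Om0_def)
  then have 0: "integral {x1..x} (\<lambda>t. q t * z t) = integral {x1..x} (\<lambda>_. 0)"
    by (rule integral_cong_AE_subinterval) (use x in auto)
  have "integral {0..x1} (\<lambda>t. q t * z t) + integral {x1..x} (\<lambda>t. q t * z t) = integral {0..x} (\<lambda>t. q t * z t)"
    by (rule Henstock_Kurzweil_Integration.integral_combine)
       (use x x12 in \<open>auto intro!: bdd_coeff_mult_integrable_on[OF q cont(1)]\<close>)
  then show ?thesis using 0 fl x x12 by (simp add: is_flow_def)
qed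

text \<open>
  On each of the two outer intervals the flux is an indefinite integral of \<open>h\<close>, up to one constant.
  The constant \<open>c1\<close> on the left is \<open>0\<close> by the boundary condition. The equation on \<open>Om0\<close> says that
  the increment \<open>c2 - z x1\<close> of the flux across \<open>Om0\<close> is the integral of the constant function \<open>h\<close>
  over \<open>Om0\<close>. So the pieces fit together to one function \<open>z\<close> with \<open>z' = h\<close> on the unit interval, and
  the boundary condition at \<open>1\<close> becomes \<open>z 1 = 0\<close>.
\<close>

lemma equilibrium0_imp_flow:
  assumes x12: "0 < x1" "x1 < x2" "x2 < 1"
    and p: "continuous_on (Om1 x1 x2) p0" and m: "0 < m" "\<And>x. x \<in> Om1 x1 x2 \<Longrightarrow> m \<le> p0 x"
    and f: "continuous_on UNIV f" and u: "u \<in> equilibria0 x1 x2 p0 lam f"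
  shows "\<exists>c v z. is_flow (recip_on (Om1 x1 x2) p0) (\<lambda>t. lam * v t - f (v t)) c v z \<and> z 1 = 0 \<and>
    (AE x\<in>I01 in lborel. u x = v x) \<and>
    (AE x\<in>I01 in lborel. wderiv I01 u x = recip_on (Om1 x1 x2) p0 x * z x)"
proof -
  note F = Om1_facts[OF x12]
  have pnz: "\<And>x. x \<in> Om1 x1 x2 \<Longrightarrow> p0 x \<noteq> 0" using m by (metis not_less)
  define w where "w = wderiv I01 u"
  define D where "D = wderiv (Om1i x1 x2) (\<lambda>y. p0 y * w y)"
  have u1: "u \<in> H1 I01" and w0: "AE x\<in>Om0 x1 x2 in lborel. w x = 0"
    and G: "(\<lambda>x. p0 x * w x) \<in> H1 (Om1i x1 x2)"
    and cr: "crep (Om1i x1 x2) w 0 = 0" "crep (Om1i x1 x2) w 1 = 0"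
    and op: "AE x\<in>I01 in lborel. op_A0 x1 x2 p0 lam u x - f (u x) = 0"
    using u by (auto simp: equilibria0_def dom_A0_def H1_Om0_def w_def)
  have uL: "u \<in> L2 I01" using u1 by (simp add: H1_def)
  have wL: "w \<in> L2 I01" and uw: "is_wderiv I01 u w" using H1_wderiv[OF u1] by (auto simp: w_def)
  have L2si: "set_integrable lborel I01 g" if "g \<in> L2 I01" for g :: "real \<Rightarrow> real"
    by (rule L2_imp_set_integrable[OF that, of 0 1]) auto
  obtain c where c: "AE x\<in>I01 in lborel. u x = c + integral {0..x} w"
    using is_wderiv_representation[OF _ L2si[OF uL] L2si[OF wL] uw] by auto
  define v where "v x = c + integral {0..x} w" for x
  define h where "h t = lam * v t - f (v t)" for t
  have uv: "AE x\<in>I01 in lborel. u x = v x" using c by (simp add: v_def)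
  have vc: "continuous_on {0..1} v" unfolding v_def
    by (intro continuous_intros continuous_on_indefinite L2si wL)
  have hc: "continuous_on {0..1} h" unfolding h_def
    by (intro continuous_intros vc continuous_on_compose2[OF f vc]) auto
  have hi: "h integrable_on {a..b}" if "0 \<le> a" "b \<le> 1" for a b
    by (intro integrable_continuous_real continuous_on_subset[OF hc]) (use that in auto)
  have comb: "integral {a..b} h + integral {b..d} h = integral {a..d} h" if "0 \<le> a" "a \<le> b" "b \<le> d" "d \<le> 1" for a b d
    by (rule Henstock_Kurzweil_Integration.integral_combine) (use that hi in auto)

  note G2 = H1_wderiv[OF G, folded D_def]
  have Gsi: "set_integrable lborel (Om1i x1 x2) (\<lambda>x. p0 x * w x)" "set_integrable lborel (Om1i x1 x2) D"
    using G G2 F(3,8) by (auto simp: H1_def intro!: L2_imp_set_integrable[of _ _ 0 1])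
  have opD: "AE x\<in>Om1i x1 x2 in lborel. D x = h x"
    using op uv
  proof eventually_elim
    case (elim x)
    show ?case
    proof
      assume x: "x \<in> Om1i x1 x2"
      then have "x \<in> Om1 x1 x2" "x \<notin> Om0 x1 x2" "x \<in> I01" using F(3,5,10) by auto
      then show "D x = h x" using elim by (simp add: op_A0_def D_def w_def h_def)
    qed
  qed
  have rep: "\<exists>k. AE x\<in>{a<..<b} in lborel. p0 x * w x = k + integral {a..x} h"
    if ab: "a < b" "{a<..<b} \<subseteq> Om1i x1 x2" for a b
  proof -
    have "\<exists>k. AE x\<in>{a<..<b} in lborel. p0 x * w x = k + integral {a..x} D"
      by (rule is_wderiv_representation[OF ab(1)])
         (auto intro!: set_integrable_subset[OF Gsi(1) _ ab(2)] set_integrable_subset[OF Gsi(2) _ ab(2)] is_wderiv_subset[OF G2(2) ab(2)])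
    then obtain k where k: "AE x\<in>{a<..<b} in lborel. p0 x * w x = k + integral {a..x} D" by blast
    have e: "integral {a..x} D = integral {a..x} h" if "x \<in> {a<..<b}" for x
      by (rule integral_cong_AE_subinterval[OF AE_mono_set[OF opD ab(2)]]) (use that in auto)
    show ?thesis by (rule exI[of _ k], use k in eventually_elim) (auto simp: e)
  qed
  obtain c1 where c1: "AE x\<in>{0<..<x1} in lborel. p0 x * w x = c1 + integral {0..x} h"
    using rep[of 0 x1] x12 by (auto simp: Om1i_def)
  obtain c2 where c2: "AE x\<in>{x2<..<1} in lborel. p0 x * w x = c2 + integral {x2..x} h"
    using rep[of x2 1] x12 by (auto simp: Om1i_def)
  define z where "z x = integral {0..x} h" for x
  \<comment> \<open>the continuous representative of the flux \<open>p0 u_x\<close> on \<open>Om1\<close>; on the right \<open>c2\<close> is its value at \<open>x2\<close>\<close>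
  define zz where "zz x = (if x \<le> x1 then c1 + z x else c2 - z x2 + z x)" for x
  have zc: "continuous_on {0..1} z" unfolding z_def
    by (intro indefinite_integral_continuous_1 hi) auto
  have zzc: "continuous_on (Om1 x1 x2) zz" unfolding zz_def
    by (intro continuous_on_Om1_cases x12 continuous_intros zc)
  have Gz: "AE x\<in>Om1i x1 x2 in lborel. zz x = p0 x * w x"
    using c1 c2
  proof eventually_elim
    case (elim x)
    show ?case
    proof
      assume x: "x \<in> Om1i x1 x2"
      then consider "x \<in> {0<..<x1}" | "x \<in> {x2<..<1}" by (auto simp: Om1i_def)
      then show "zz x = p0 x * w x"
      proof cases
        case 1 then show ?thesis using elim by (simp add: zz_def z_def)
      next
        case 2
        then have "z x2 + integral {x2..x} h = z x" using comb[of 0 x2 x] x12 by (simp add: z_def)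
        then show ?thesis using elim 2 x12 by (simp add: zz_def)
      qed
    qed
  qed
  have flux: "flux0 x1 x2 p0 u x = zz x" if "x \<in> Om1 x1 x2" for x
    unfolding flux0_def w_def[symmetric]
    by (rule crep_eq[OF F(1)]) (use F(2) zzc Gz that in auto)
  have wz: "AE x\<in>Om1i x1 x2 in lborel. zz x / p0 x = w x"
    using Gz by eventually_elim (use pnz F(5) in \<open>auto simp: field_simps\<close>)
  have crw: "crep (Om1i x1 x2) w x = zz x / p0 x" if "x \<in> Om1 x1 x2" for x
    by (rule crep_eq[OF F(1) _ wz]) (use F(2) pnz that in \<open>auto intro!: continuous_intros zzc p\<close>)
  have in1: "0 \<in> Om1 x1 x2" "1 \<in> Om1 x1 x2" "x1 \<in> Om1 x1 x2" "x2 \<in> Om1 x1 x2" using x12 by (auto simp: Om1_def)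
  have z0: "z 0 = 0" by (simp add: z_def)
  have c10: "c1 = 0" using crw[OF in1(1)] cr(1) pnz[OF in1(1)] x12 z0 by (simp add: zz_def)
  have zz1: "c2 - z x2 + z 1 = 0" using crw[OF in1(2)] cr(2) pnz[OF in1(2)] x12 by (simp add: zz_def)

  have vconst: "v x = v x1" if x: "x \<in> {x1..x2}" for x
  proof -
    have "integral {x1..x} w = integral {x1..x} (\<lambda>_. 0)"
      by (rule integral_cong_AE_subinterval[OF w0[unfolded Om0_def]]) (use x in auto)
    moreover have "integral {0..x1} w + integral {x1..x} w = integral {0..x} w"
      by (rule Henstock_Kurzweil_Integration.integral_combine)
         (use x x12 in \<open>auto intro!: integrable_on_subinterval[OF set_integrable_imp_integrable_on_Icc[OF L2si[OF wL]]]\<close>)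
    ultimately show ?thesis by (simp add: v_def)
  qed
  have u0: "AE x\<in>Om0 x1 x2 in lborel. u x = v x1"
    using uv
  proof eventually_elim
    case (elim x)
    then show ?case using vconst[of x] F(9) by (auto simp: Om0_def)
  qed
  note val = val_Om0_eq[OF x12(2) u0]
  have "AE x\<in>Om0 x1 x2 in lborel. lam * v x1 + (1 / (x2 - x1)) * (z x1 - c2) - f (v x1) = 0"
    using op u0
  proof eventually_elim
    case (elim x)
    show ?case
    proof
      assume x: "x \<in> Om0 x1 x2"
      then have "x \<notin> Om1 x1 x2" "x \<in> I01" using F(9,10) by auto
      then show "lam * v x1 + (1 / (x2 - x1)) * (z x1 - c2) - f (v x1) = 0"
        using elim x flux[OF in1(3)] flux[OF in1(4)] x12 by (simp add: op_A0_def val zz_def c10)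
    qed
  qed
  then have eq: "lam * v x1 + (1 / (x2 - x1)) * (z x1 - c2) - f (v x1) = 0"
    by (rule continuous_AE_eq_imp_eq[of "Om0 x1 x2" "\<lambda>_. lam * v x1 + (1 / (x2 - x1)) * (z x1 - c2) - f (v x1)" "\<lambda>_. 0" "(x1+x2)/2", rotated 3])
       (use x12 in \<open>auto simp: Om0_def\<close>)
  have "integral {x1..x2} h = integral {x1..x2} (\<lambda>_. lam * v x1 - f (v x1))"
    by (rule integral_cong) (simp only: h_def vconst)
  also have "\<dots> = (x2 - x1) * (lam * v x1 - f (v x1))" using x12 by simp
  also have "\<dots> = c2 - z x1" using eq x12 by (simp add: field_simps)
  finally have zx2: "z x2 = c2" using comb[of 0 x1 x2] x12 by (simp add: z_def)
  then have z1: "z 1 = 0" using zz1 by simp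
  have zzz: "zz x = z x" for x by (simp add: zz_def c10 zx2)
  have wq: "AE x\<in>I01 in lborel. w x = recip_on (Om1 x1 x2) p0 x * z x"
  proof (rule AE_I01_split[OF x12])
    show "AE x\<in>Om1i x1 x2 in lborel. w x = recip_on (Om1 x1 x2) p0 x * z x"
      using wz by eventually_elim (use F(5) in \<open>auto simp: recip_on_def zzz\<close>)
    show "AE x\<in>Om0 x1 x2 in lborel. w x = recip_on (Om1 x1 x2) p0 x * z x"
      using w0 by eventually_elim (auto simp: recip_on_Om0)
  qed
  have "is_flow (recip_on (Om1 x1 x2) p0) (\<lambda>t. lam * v t - f (v t)) c v z"
    unfolding is_flow_def h_def[symmetric]
    using hc integral_cong_AE_subinterval[OF wq, of 0] by (auto simp: v_def z_def)
  then show ?thesis using z1 wq uv unfolding w_def by blast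
qed

lemma L2_of_real:
  assumes "u \<in> L2 S" shows "(\<lambda>x. of_real (u x) :: complex) \<in> L2 S"
proof -
  have [measurable]: "(\<lambda>x. indicator S x *\<^sub>R u x) \<in> borel_measurable lborel"
    using assms by (auto simp: L2_def set_borel_measurable_def)
  have "(\<lambda>x. complex_of_real (indicator S x *\<^sub>R u x)) \<in> borel_measurable lborel" by measurable
  also have "(\<lambda>x. complex_of_real (indicator S x *\<^sub>R u x)) = (\<lambda>x. indicator S x *\<^sub>R complex_of_real (u x))"
    by (auto simp: indicator_def)
  finally show ?thesis using assms by (simp add: L2_def set_borel_measurable_def)
qed

lemma L2_subset:
  fixes u :: "real \<Rightarrow> 'a::euclidean_space"
  assumes u: "u \<in> L2 T" and S: "S \<subseteq> T" "S \<in> sets borel"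
  shows "u \<in> L2 S"
proof -
  have [measurable]: "(\<lambda>x. indicator T x *\<^sub>R u x) \<in> borel_measurable lborel" "S \<in> sets lborel"
    using u S by (auto simp: L2_def set_borel_measurable_def)
  have "(\<lambda>x. indicator S x *\<^sub>R (indicator T x *\<^sub>R u x)) \<in> borel_measurable lborel" by measurable
  also have "(\<lambda>x. indicator S x *\<^sub>R (indicator T x *\<^sub>R u x)) = (\<lambda>x. indicator S x *\<^sub>R u x)"
    using S by (auto simp: indicator_def fun_eq_iff)
  finally show ?thesis using u S by (auto simp: L2_def set_borel_measurable_def intro: set_integrable_subset)
qed

lemma is_wderiv_of_real_integral:
  fixes v :: "real \<Rightarrow> real"
  assumes v: "set_integrable lborel {a<..<b} v" and S: "S \<subseteq> {a<..<b}"
    and u: "\<And>x. x \<in> S \<Longrightarrow> u x = c + integral {a..x} v"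
  shows "is_wderiv S (\<lambda>x. of_real (u x) :: complex) (\<lambda>x. of_real (v x))"
proof (rule is_wderiv_integral[OF _ S, where c="of_real c"])
  have "integrable lborel (\<lambda>x. complex_of_real (indicator {a<..<b} x *\<^sub>R v x))"
    using v unfolding set_integrable_def by (rule integrable_of_real)
  also have "(\<lambda>x. complex_of_real (indicator {a<..<b} x *\<^sub>R v x)) = (\<lambda>x. indicator {a<..<b} x *\<^sub>R complex_of_real (v x))"
    by (auto simp: indicator_def)
  finally show "set_integrable lborel {a<..<b} (\<lambda>x. complex_of_real (v x))" unfolding set_integrable_def .
  fix x assume x: "x \<in> S"
  have "v integrable_on {a..x}"
    by (rule integrable_on_subinterval[OF set_integrable_imp_integrable_on_Icc[OF v]]) (use x S in auto)
  from integral_linear[OF this bounded_linear_of_real[where 'a=complex]]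
  show "complex_of_real (u x) = of_real c + integral {a..x} (\<lambda>x. complex_of_real (v x))"
    by (simp add: u[OF x] o_def)
qed

text \<open>
  If \<open>z 1 = 0\<close>, then \<open>v\<close>, regarded as a complex-valued function, is in the domain of \<open>A_0\<close> and
  is annihilated by \<open>A_0 - f'(u)\<close>. The resolvent bound at \<open>0\<close> forces \<open>v = 0\<close>, whereas \<open>v 0 = 1\<close>.
\<close>

lemma hyperbolic_imp_nondegenerate:
  assumes x12: "0 < x1" "x1 < x2" "x2 < 1"
    and p: "continuous_on (Om1 x1 x2) p0" and m: "0 < m" "\<And>x. x \<in> Om1 x1 x2 \<Longrightarrow> m \<le> p0 x"
    and uU: "AE x\<in>I01 in lborel. u x = U x" and Uconst: "\<And>x. x \<in> {x1..x2} \<Longrightarrow> U x = U x1"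
    and hyp: "hyperbolic0 x1 x2 p0 lam f u"
    and fl: "is_flow (recip_on (Om1 x1 x2) p0) (\<lambda>t. (lam - deriv f (U t)) * v t) 1 v z"
  shows "z 1 \<noteq> 0"
proof
  assume z1: "z 1 = 0"
  note F = Om1_facts[OF x12]
  have pnz: "\<And>x. x \<in> Om1 x1 x2 \<Longrightarrow> p0 x \<noteq> 0" using m by (metis not_less)
  define q where "q = recip_on (Om1 x1 x2) p0"
  define h where "h t = (lam - deriv f (U t)) * v t" for t
  have q: "bdd_coeff (1/m) q" unfolding q_def by (rule bdd_coeff_recip_on[OF p F(7) m])
  have fl': "is_flow q h 1 v z" using fl by (simp add: q_def h_def[abs_def])
  note cont = is_flow_continuous[OF q fl']
  note V = flow_imp_wderiv[OF q fl']
  have v: "v x = 1 + integral {0..x} (\<lambda>t. q t * z t)" and z: "z x = integral {0..x} h" if "x \<in> {0..1}" for x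
    using fl' that by (auto simp: is_flow_def)
  have vconst: "v x = v x1" if "x \<in> {x1..x2}" for x
    by (rule flow_const_on_Om0[OF x12 q _ fl' that]) (simp add: q_def recip_on_Om0)
  define W where "W x = complex_of_real (v x)" for x
  define w where "w = wderiv I01 W"
  have qzL: "(\<lambda>x. complex_of_real (q x * z x)) \<in> L2 I01" by (rule L2_of_real[OF V(3)])
  have dW: "is_wderiv I01 W (\<lambda>x. of_real (q x * z x))" unfolding W_def
    by (rule is_wderiv_of_real_integral[where c=1 and a=0 and b=1])
       (use v in \<open>auto intro!: L2_imp_set_integrable[OF V(3), of 0 1]\<close>)
  have WL: "W \<in> L2 I01" unfolding W_def
    by (rule L2_of_real, rule continuous_on_imp_L2[OF cont(2)]) auto
  have WH: "W \<in> H1 I01" using WL dW qzL by (auto simp: H1_def)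
  have wL: "w \<in> L2 I01" using H1_wderiv[OF WH] by (simp add: w_def)
  have wq: "AE x\<in>I01 in lborel. w x = of_real (q x * z x)"
    unfolding w_def by (rule wderiv_AE_eq[OF _ _ qzL dW, of 0 1]) auto
  have w0: "AE x\<in>Om0 x1 x2 in lborel. w x = 0"
    using wq by eventually_elim (use F(9) in \<open>auto simp: q_def recip_on_Om0\<close>)
  have wz: "AE x\<in>Om1i x1 x2 in lborel. of_real (z x / p0 x) = w x"
    using wq by eventually_elim (use F(3,5) in \<open>auto simp: q_def recip_on_def\<close>)
  have pw: "AE x\<in>Om1i x1 x2 in lborel. of_real (z x) = p0 x *\<^sub>R w x"
    using wz
  proof eventually_elim
    case (elim x)
    show ?case
    proof
      assume x: "x \<in> Om1i x1 x2"
      then have "p0 x \<noteq> 0" using pnz F(5) by auto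
      then show "of_real (z x) = p0 x *\<^sub>R w x" using elim x by (auto simp: scaleR_conv_of_real field_simps)
    qed
  qed
  have zO: "continuous_on (Om1 x1 x2) z" by (rule continuous_on_subset[OF cont(1) F(4)])
  have hL: "h \<in> L2 (Om1i x1 x2)" by (rule continuous_on_imp_L2[OF cont(3)]) (use F in auto)
  have zL: "z \<in> L2 (Om1i x1 x2)" by (rule continuous_on_imp_L2[OF cont(1)]) (use F in auto)
  have pwL: "(\<lambda>x. p0 x *\<^sub>R w x) \<in> L2 (Om1i x1 x2)"
  proof -
    obtain B where "\<forall>x\<in>Om1 x1 x2. norm (p0 x) \<le> B" using bounded_of_continuous_on_compact[OF F(6) p] by blast
    then show ?thesis
      by (intro L2_bounded_mult[where B=B] L2_subset[OF wL] continuous_on_set_borel_measurable[OF p] F) (use F(5) in auto)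
  qed
  have dz: "is_wderiv (Om1i x1 x2) (\<lambda>x. complex_of_real (z x)) (\<lambda>x. of_real (h x))"
    by (rule is_wderiv_of_real_integral[where c=0 and a=0 and b=1])
       (use F(3) z in \<open>auto intro!: set_integrable_continuous_on cont\<close>)
  have dpw: "is_wderiv (Om1i x1 x2) (\<lambda>x. p0 x *\<^sub>R w x) (\<lambda>x. of_real (h x))"
    using is_wderiv_cong_AE[OF _ _ _ _ pw _ dz, of "\<lambda>x. of_real (h x)"] L2_of_real[OF zL] L2_of_real[OF hL] pwL
    by (simp add: L2_def)
  have pwH: "(\<lambda>x. p0 x *\<^sub>R w x) \<in> H1 (Om1i x1 x2)" using pwL dpw L2_of_real[OF hL] by (auto simp: H1_def)
  have dpwAE: "AE x\<in>Om1i x1 x2 in lborel. wderiv (Om1i x1 x2) (\<lambda>x. p0 x *\<^sub>R w x) x = of_real (h x)"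
    by (rule wderiv_AE_eq[OF F(1) _ L2_of_real[OF hL] dpw, of 0 1]) (use F(3) in auto)
  have crw: "crep (Om1i x1 x2) w x = of_real (z x / p0 x)" if "x \<in> Om1 x1 x2" for x
    by (rule crep_eq[OF F(1) _ wz]) (use F(2) pnz that in \<open>auto intro!: continuous_intros zO p\<close>)
  have flux: "flux0 x1 x2 p0 W x = of_real (z x)" if "x \<in> Om1 x1 x2" for x
    unfolding flux0_def w_def[symmetric]
    by (rule crep_eq[OF F(1) _ pw]) (use F(2) that in \<open>auto intro!: continuous_intros zO\<close>)
  have in1: "0 \<in> Om1 x1 x2" "1 \<in> Om1 x1 x2" "x1 \<in> Om1 x1 x2" "x2 \<in> Om1 x1 x2" using x12 by (auto simp: Om1_def)
  have dom: "W \<in> dom_A0 x1 x2 p0"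
    unfolding dom_A0_def H1_Om0_def
    using WH w0 pwH crw[OF in1(1)] crw[OF in1(2)] z1 z[of 0] by (simp add: w_def)
  have W0: "AE x\<in>Om0 x1 x2 in lborel. W x = of_real (v x1)"
  proof (intro AE_I2 impI)
    fix x assume "x \<in> Om0 x1 x2"
    then have "x \<in> {x1..x2}" by (auto simp: Om0_def)
    from vconst[OF this] show "W x = of_real (v x1)" by (simp add: W_def)
  qed
  note val = val_Om0_eq[OF x12(2) W0]
  have hconst: "h t = h x1" if "t \<in> {x1..x2}" for t
    using vconst[OF that] Uconst[OF that] by (simp add: h_def)
  have "integral {x1..x2} h = integral {x1..x2} (\<lambda>_. h x1)"
    by (rule integral_cong) (rule hconst)
  also have "\<dots> = (x2 - x1) * h x1" using x12 by simp
  finally have hint: "integral {x1..x2} h = (x2 - x1) * h x1" .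
  have "integral {0..x1} h + integral {x1..x2} h = integral {0..x2} h"
    by (rule Henstock_Kurzweil_Integration.integral_combine)
       (use x12 in \<open>auto intro!: integrable_continuous_real continuous_on_subset[OF cont(3)]\<close>)
  then have zd: "z x1 - z x2 = - ((x2 - x1) * h x1)" using z[of x1] z[of x2] x12 hint by simp
  have "(1 / (x2 - x1)) * (z x1 - z x2) = - h x1" using x12 by (simp add: zd)
  then have zd': "(1 / (x2 - x1)) *\<^sub>R (complex_of_real (z x1) - of_real (z x2)) = - of_real (h x1)"
    by (metis of_real_diff of_real_minus of_real_mult scaleR_conv_of_real)
  define T where "T = (\<lambda>w x. op_A0 x1 x2 p0 lam w x - complex_of_real (deriv f (u x)) * w x)"
  have TW: "AE x\<in>I01 in lborel. T W x = 0"
  proof (rule AE_I01_split[OF x12])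
    show "AE x\<in>Om1i x1 x2 in lborel. T W x = 0"
      using dpwAE uU
    proof eventually_elim
      case (elim x)
      show ?case
      proof
        assume x: "x \<in> Om1i x1 x2"
        then have "x \<in> Om1 x1 x2" "x \<notin> Om0 x1 x2" "x \<in> I01" using F(3,5,10) by auto
        then show "T W x = 0" using elim x
          by (simp add: T_def op_A0_def w_def[symmetric] h_def W_def scaleR_conv_of_real algebra_simps)
      qed
    qed
    show "AE x\<in>Om0 x1 x2 in lborel. T W x = 0"
      using uU
    proof eventually_elim
      case (elim x)
      show ?case
      proof
        assume x: "x \<in> Om0 x1 x2"
        then have x': "x \<notin> Om1 x1 x2" "x \<in> I01" "x \<in> {x1..x2}" using F(9,10) by (auto simp: Om0_def)
        have "T W x = of_real lam * of_real (v x1) - of_real (h x1) - of_real (deriv f (U x1)) * of_real (v x1)"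
          using elim x x' Uconst[OF x'(3)] vconst[OF x'(3)] zd'
          by (simp add: T_def op_A0_def val flux in1 W_def scaleR_conv_of_real)
        also have "\<dots> = 0" by (simp add: h_def algebra_simps)
        finally show "T W x = 0" .
      qed
    qed
  qed
  have "0 \<notin> spectrum (L2_Om0 x1 x2) (dom_A0 x1 x2 p0) T"
    using hyp unfolding hyperbolic0_def T_def by auto
  then have "0 \<in> resolvent_set (L2_Om0 x1 x2) (dom_A0 x1 x2 p0) T" by (simp add: spectrum_def)
  then obtain K where K: "L2_norm I01 W \<le> K * L2_norm I01 (\<lambda>x. T W x - 0 * W x)"
    using dom by (auto simp: resolvent_set_def)
  have "L2_norm I01 (\<lambda>x. T W x - 0 * W x) = 0"
    unfolding L2_norm_def set_lebesgue_integral_def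
    by (subst integral_eq_zero_AE) (use TW in \<open>auto elim!: eventually_mono simp: indicator_def\<close>)
  then have "(LINT x:I01|lborel. (norm (W x))\<^sup>2) \<le> 0" using K by (simp add: L2_norm_def)
  moreover have int: "integrable lborel (\<lambda>x. indicator I01 x *\<^sub>R (norm (W x))\<^sup>2)"
    using WL by (simp add: L2_def set_integrable_def)
  moreover have "(LINT x:I01|lborel. (norm (W x))\<^sup>2) \<ge> 0"
    unfolding set_lebesgue_integral_def by (rule Bochner_Integration.integral_nonneg) auto
  ultimately have "integral\<^sup>L lborel (\<lambda>x. indicator I01 x *\<^sub>R (norm (W x))\<^sup>2) = 0"
    by (simp only: set_lebesgue_integral_def)
  then have "AE x in lborel. indicator I01 x *\<^sub>R (norm (W x))\<^sup>2 = 0"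
    by (subst (asm) integral_nonneg_eq_0_iff_AE[OF int]) (rule AE_I2, simp)
  then have "AE x\<in>I01 in lborel. v x = 0"
    by eventually_elim (auto simp: W_def indicator_def)
  then have v0: "v x = 0" if "x \<in> I01" for x
    by (rule continuous_AE_eq_imp_eq[OF _ _ _ _ that, of v "\<lambda>_. 0", rotated 3])
       (auto intro: continuous_on_subset[OF cont(2)])
  have "v 0 = 0"
    by (rule continuous_constant_on_closure[of I01 v 0 0, OF _ v0]) (use cont(2) in auto)
  then show False using v[of 0] by simp
qed

section \<open>Estimates for the coefficient and in the energy norm\<close>

text \<open>
  The real-valued \<open>Linf_norm\<close> is meaningful only if the essential supremum is finite. It is
  nonnegative because \<open>S\<close> contains an interval and thus is not a null set.
\<close>

lemma Linf_norm_bounds: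
  fixes g :: "real \<Rightarrow> real"
  assumes S: "S \<in> sets borel" and ab: "a < b" "{a..b} \<subseteq> S"
    and g: "continuous_on S g" and M: "\<And>x. x \<in> S \<Longrightarrow> \<bar>g x\<bar> \<le> M"
  shows "0 \<le> Linf_norm S g" "Linf_norm S g \<le> M" "AE x\<in>S in lborel. \<bar>g x\<bar> \<le> Linf_norm S g"
proof -
  define R where "R = restrict_space lborel S"
  define e where "e = esssup R (\<lambda>x. ereal (norm (g x)))"
  have "g \<in> borel_measurable (restrict_space borel S)" by (rule borel_measurable_continuous_on_restrict[OF g])
  then have [measurable]: "g \<in> borel_measurable R"
    unfolding R_def by (simp add: measurable_def sets_restrict_space space_restrict_space)
  have m: "(\<lambda>x. ereal (norm (g x))) \<in> borel_measurable R" by measurable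
  have le: "e \<le> ereal M" unfolding e_def
    by (rule esssup_I[OF m]) (auto simp: R_def space_restrict_space intro!: AE_I2 M)
  have "AE x in R. ereal (norm (g x)) \<le> e" unfolding e_def by (rule esssup_AE)
  then have ae: "AE x\<in>S in lborel. ereal (norm (g x)) \<le> e"
    unfolding R_def using S by (subst (asm) AE_restrict_space_iff) auto
  have "0 \<le> e"
  proof (rule ccontr)
    assume "\<not> 0 \<le> e"
    then have lt: "e < 0" by simp
    have "AE x\<in>{a<..<b} in lborel. (0::real) = 1"
      using ae
    proof eventually_elim
      case (elim x)
      show ?case
      proof
        assume "x \<in> {a<..<b}"
        then have "x \<in> S" using ab(2) by auto
        then have "ereal (norm (g x)) < 0" using elim lt by (metis order_le_less_trans)
        then show "(0::real) = 1" by simp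
      qed
    qed
    then have "(0::real) = 1"
      by (rule continuous_AE_eq_imp_eq[of "{a<..<b}" "\<lambda>_. 0::real" "\<lambda>_. 1" "(a+b)/2", rotated 3]) (use ab in auto)
    then show False by simp
  qed
  then obtain N where N: "e = ereal N" "0 \<le> N" "N \<le> M" using le by (cases e) auto
  have L: "Linf_norm S g = N" unfolding Linf_norm_def using N(1) by (simp add: e_def R_def)
  then show "0 \<le> Linf_norm S g" "Linf_norm S g \<le> M" using N by auto
  show "AE x\<in>S in lborel. \<bar>g x\<bar> \<le> Linf_norm S g" using ae unfolding L N(1) by simp
qed

text \<open>
  On \<open>Om1\<close> the reciprocals differ by at most \<open>N / m\<^sup>2\<close>. On \<open>Om0\<close> the second one is \<open>0\<close> and the first is
  at most \<open>\<epsilon>\<close>, except on the two transition layers of width \<open>\<epsilon>\<close>, where it is at most \<open>1 / m\<close>.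
\<close>

lemma recip_L1_estimate:
  assumes x12: "0 < x1" "x1 < x2" "x2 < 1"
    and p: "continuous_on {0..1} p" "continuous_on (Om1 x1 x2) p0"
    and m: "0 < m" "\<And>x. x \<in> {0..1} \<Longrightarrow> m \<le> p x" "\<And>x. x \<in> Om1 x1 x2 \<Longrightarrow> m \<le> p0 x"
    and eps: "0 < \<epsilon>" "\<And>x. x \<in> {x1 + \<epsilon>..x2 - \<epsilon>} \<Longrightarrow> 1 / \<epsilon> \<le> p x"
    and N: "0 \<le> N" "AE x\<in>Om1 x1 x2 in lborel. \<bar>p x - p0 x\<bar> \<le> N"
  shows "integral {0..1} (\<lambda>x. \<bar>recip_on {0..1} p x - recip_on (Om1 x1 x2) p0 x\<bar>) \<le> N / (m * m) + \<epsilon> + 2 * \<epsilon> / m"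
proof -
  define F where "F x = \<bar>recip_on {0..1} p x - recip_on (Om1 x1 x2) p0 x\<bar>" for x
  define G where "G x = (N / (m * m) + \<epsilon>) * indicator {0..1} x + 1 / m * indicator {x1..x1+\<epsilon>} x + 1 / m * indicator {x2-\<epsilon>..x2} x" for x :: real
  have Ob: "Om1 x1 x2 \<in> sets borel" unfolding Om1_def by simp
  have Os: "Om1 x1 x2 \<subseteq> {0..1}" using x12 by (auto simp: Om1_def)
  note q1 = bdd_coeff_recip_on[OF p(1) _ m(1,2)] and q2 = bdd_coeff_recip_on[OF p(2) Ob m(1,3)]
  have qq: "bdd_coeff (1/m + 1/m) F" unfolding F_def by (rule bdd_coeff_diff_abs[OF q1 q2]) auto
  have Fi: "set_integrable lborel {0..1} F" using bdd_coeff_mult_set_integrable[OF qq, of "\<lambda>_. 1"] by simp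
  have ind: "integrable lborel (indicat_real {c..d})" for c d :: real
    by (rule integrable_real_indicator) (auto simp: emeasure_lborel_Icc_eq)
  have Gi: "integrable lborel G" unfolding G_def
    by (intro Bochner_Integration.integrable_add integrable_mult_right ind)
  have le: "AE x in lborel. indicator {0..1} x *\<^sub>R F x \<le> G x"
    using N(2)
  proof eventually_elim
    case (elim x)
    have G0: "0 \<le> G x" unfolding G_def using N m eps by simp
    show ?case
    proof (cases "x \<in> {0..1}")
      case x: True
      have px: "0 < p x" "m \<le> p x" using m(1) m(2)[OF x] by auto
      have Glow: "N / (m * m) \<le> G x" "\<epsilon> \<le> G x" unfolding G_def using x m N(1) eps by (auto simp: indicator_def)
      have "F x \<le> G x"
      proof (cases "x \<in> Om1 x1 x2")
        case True
        have p0x: "0 < p0 x" "m \<le> p0 x" using m(1) m(3)[OF True] by auto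
        have "F x = \<bar>p x - p0 x\<bar> / (p x * p0 x)"
          unfolding F_def recip_on_def using True x px p0x
          by (simp add: diff_frac_eq abs_mult abs_minus_commute mult.commute)
        also have "\<dots> \<le> N / (m * m)"
          using elim True px p0x m(1) N(1) by (intro frac_le mult_mono) auto
        finally show ?thesis using Glow by simp
      next
        case False
        then have Fx: "F x = 1 / p x" using x px by (simp add: F_def recip_on_def)
        show ?thesis
        proof (cases "x \<in> {x1 + \<epsilon>..x2 - \<epsilon>}")
          case True
          have "1 / p x \<le> \<epsilon>" using eps(1) eps(2)[OF True] px by (simp add: field_simps)
          then show ?thesis using Fx Glow by simp
        next
          case out: False
          have "x \<in> {x1..x2}" using False x by (auto simp: Om1_def)
          then have "x \<in> {x1..x1+\<epsilon>} \<or> x \<in> {x2-\<epsilon>..x2}" using out by auto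
          then have "1 / m \<le> G x" unfolding G_def using x m(1) N(1) eps(1) by (auto simp: indicator_def)
          moreover have "1 / p x \<le> 1 / m" using px m(1) by (simp add: frac_le)
          ultimately show ?thesis using Fx by simp
        qed
      qed
      then show ?thesis using x by simp
    qed (use G0 in simp)
  qed
  have "integral {0..1} F = (LINT x:{0..1}|lborel. F x)"
    using set_borel_integral_eq_integral(2)[OF Fi] by simp
  also have "\<dots> \<le> integral\<^sup>L lborel G"
    unfolding set_lebesgue_integral_def
    by (rule integral_mono_AE[OF _ Gi le]) (use Fi in \<open>simp add: set_integrable_def\<close>)
  also have "\<dots> = (N / (m * m) + \<epsilon>) + 1 / m * \<epsilon> + 1 / m * \<epsilon>"
    unfolding G_def
    by (subst Bochner_Integration.integral_add | intro Bochner_Integration.integrable_add integrable_mult_right ind)+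
       (use eps in simp)
  finally show ?thesis by (simp add: F_def[abs_def] field_simps)
qed

lemma set_LINT_eq_integral_AE:
  fixes f g :: "real \<Rightarrow> real"
  assumes "set_borel_measurable lborel {a<..<b} f" "set_integrable lborel {a<..<b} g"
    and "AE x\<in>{a<..<b} in lborel. f x = g x"
  shows "(LINT x:{a<..<b}|lborel. f x) = integral {a..b} g"
proof -
  have "(LINT x:{a<..<b}|lborel. f x) = (LINT x:{a<..<b}|lborel. g x)"
    unfolding set_lebesgue_integral_def
  proof (rule integral_cong_AE)
    show "(\<lambda>x. indicator {a<..<b} x *\<^sub>R f x) \<in> borel_measurable lborel" using assms(1) by (simp add: set_borel_measurable_def)
    show "(\<lambda>x. indicator {a<..<b} x *\<^sub>R g x) \<in> borel_measurable lborel" using assms(2) by (auto simp: set_integrable_def)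
    show "AE x in lborel. indicator {a<..<b} x *\<^sub>R f x = indicator {a<..<b} x *\<^sub>R g x"
      using assms(3) by eventually_elim (auto simp: indicator_def)
  qed
  then show ?thesis using set_borel_integral_eq_integral(2)[OF assms(2)] by (simp add: integral_open_interval_real)
qed

lemma set_borel_measurable_mult:
  fixes f g :: "real \<Rightarrow> real"
  assumes "set_borel_measurable lborel S f" "set_borel_measurable lborel S g"
  shows "set_borel_measurable lborel S (\<lambda>x. f x * g x)"
proof -
  have "(\<lambda>x. (indicator S x *\<^sub>R f x) * (indicator S x *\<^sub>R g x)) \<in> borel_measurable lborel"
    using assms unfolding set_borel_measurable_def by (intro borel_measurable_times)
  also have "(\<lambda>x. (indicator S x *\<^sub>R f x) * (indicator S x *\<^sub>R g x)) = (\<lambda>x. indicator S x *\<^sub>R (f x * g x))"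
    by (auto simp: indicator_def)
  finally show ?thesis unfolding set_borel_measurable_def .
qed

lemma bdd_coeff_flow_diff_integrable:
  assumes q1: "bdd_coeff Q1 q1" and q2: "bdd_coeff Q2 q2" and z: "continuous_on {0..1} z1" "continuous_on {0..1} z2"
  shows "set_integrable lborel {0..1} (\<lambda>x. q1 x * z1 x - q2 x * z2 x)"
    "\<exists>B. \<forall>x\<in>{0..1}. \<bar>q1 x * z1 x - q2 x * z2 x\<bar> \<le> B"
proof -
  show "set_integrable lborel {0..1} (\<lambda>x. q1 x * z1 x - q2 x * z2 x)"
    by (intro set_integral_diff bdd_coeff_mult_set_integrable[OF q1] bdd_coeff_mult_set_integrable[OF q2] z)
  obtain B1 B2 where B: "\<And>x. x \<in> {0..1} \<Longrightarrow> \<bar>z1 x\<bar> \<le> B1" "\<And>x. x \<in> {0..1} \<Longrightarrow> \<bar>z2 x\<bar> \<le> B2"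
    using bounded_of_continuous_on_compact[OF compact_Icc z(1)] bounded_of_continuous_on_compact[OF compact_Icc z(2)]
    unfolding real_norm_def by blast
  have "\<bar>q1 x * z1 x - q2 x * z2 x\<bar> \<le> Q1 * B1 + Q2 * B2" if x: "x \<in> {0..1}" for x
  proof -
    have "\<bar>q1 x * z1 x - q2 x * z2 x\<bar> \<le> \<bar>q1 x\<bar> * \<bar>z1 x\<bar> + \<bar>q2 x\<bar> * \<bar>z2 x\<bar>"
      by (metis abs_mult abs_triangle_ineq4)
    also have "\<dots> \<le> Q1 * B1 + Q2 * B2"
      using q1 q2 B[OF x] bdd_coeff_nonneg[OF q1] bdd_coeff_nonneg[OF q2]
      by (intro add_mono mult_mono) (auto simp: bdd_coeff_def)
    finally show ?thesis .
  qed
  then show "\<exists>B. \<forall>x\<in>{0..1}. \<bar>q1 x * z1 x - q2 x * z2 x\<bar> \<le> B" by blast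
qed

text \<open>
  The integrand of the square of the norm of \<open>X_\<epsilon>^(1/2)\<close> at a function \<open>y\<close> with derivative \<open>d\<close>.
\<close>

definition energy :: "(real \<Rightarrow> real) \<Rightarrow> real \<Rightarrow> (real \<Rightarrow> real) \<Rightarrow> (real \<Rightarrow> real) \<Rightarrow> real \<Rightarrow> real" where
  "energy p lam d y x = p x * (d x)\<^sup>2 + lam * (y x)\<^sup>2"

text \<open>
  The representative of the weak derivative that \<open>wderiv\<close> chooses agrees almost everywhere with
  \<open>q1 z1 - q2 z2\<close>, which turns the norm into an explicit integral.
\<close>

lemma X_norm_flow_diff:
  assumes q1: "bdd_coeff Q1 q1" and q2: "bdd_coeff Q2 q2"
    and f1: "is_flow q1 h1 c1 v1 z1" and f2: "is_flow q2 h2 c2 v2 z2"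
    and p: "continuous_on {0..1} p"
    and u1: "u1 \<in> L2 I01" "AE x\<in>I01 in lborel. u1 x = v1 x"
    and u2: "u2 \<in> L2 I01" "AE x\<in>I01 in lborel. u2 x = v2 x"
  shows "X_norm p lam (\<lambda>x. u1 x - u2 x) =
      sqrt (integral {0..1} (energy p lam (\<lambda>x. q1 x * z1 x - q2 x * z2 x) (\<lambda>x. v1 x - v2 x)))"
    "energy p lam (\<lambda>x. q1 x * z1 x - q2 x * z2 x) (\<lambda>x. v1 x - v2 x) integrable_on {0..1}"
proof -
  note C1 = is_flow_continuous[OF q1 f1] and C2 = is_flow_continuous[OF q2 f2]
  define d where "d x = q1 x * z1 x - q2 x * z2 x" for x
  define y where "y x = v1 x - v2 x" for x
  define u where "u x = u1 x - u2 x" for x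
  have di: "set_integrable lborel {0..1} d" unfolding d_def
    by (rule bdd_coeff_flow_diff_integrable[OF q1 q2 C1(1) C2(1)])
  obtain B where B: "\<And>x. x \<in> {0..1} \<Longrightarrow> \<bar>d x\<bar> \<le> B"
    using bdd_coeff_flow_diff_integrable(2)[OF q1 q2 C1(1) C2(1)] unfolding d_def by blast
  have di': "set_integrable lborel I01 d" by (rule set_integrable_subset[OF di]) auto
  have dm: "set_borel_measurable lborel I01 d"
    using di' unfolding set_integrable_def set_borel_measurable_def by auto
  have dL: "d \<in> L2 I01" by (rule bounded_imp_L2[OF dm, of 0 1 B]) (use B in auto)
  have yc: "continuous_on {0..1} y" unfolding y_def by (intro continuous_intros C1 C2)
  have yL: "y \<in> L2 I01" by (rule continuous_on_imp_L2[OF yc]) auto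
  have uL: "u \<in> L2 I01"
  proof -
    have "(\<lambda>x. (-1) *\<^sub>R u2 x) \<in> L2 I01"
      by (rule L2_bounded_mult[OF u2(1), where B=1]) (auto simp: set_borel_measurable_def)
    from L2_add[OF u1(1) this] show ?thesis by (simp add: u_def[abs_def])
  qed
  have uy: "AE x\<in>I01 in lborel. u x = y x" using u1(2) u2(2) by eventually_elim (auto simp: u_def y_def)
  have yd: "is_wderiv I01 y d"
  proof (rule is_wderiv_integral[OF di', where c="c1 - c2"])
    fix x :: real assume x: "x \<in> I01"
    have i: "(\<lambda>t. q1 t * z1 t) integrable_on {0..x}" "(\<lambda>t. q2 t * z2 t) integrable_on {0..x}"
      by (intro bdd_coeff_mult_integrable_on[OF q1 C1(1)] bdd_coeff_mult_integrable_on[OF q2 C2(1)]; use x in auto)+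
    show "y x = c1 - c2 + integral {0..x} d"
      using f1 f2 x unfolding d_def by (simp add: integral_diff[OF i] is_flow_def y_def)
  qed auto
  have ud: "is_wderiv I01 u d"
    by (rule is_wderiv_cong_AE[OF _ _ _ _ _ _ yd]) (use uL yL dL uy in \<open>auto simp: L2_def\<close>)
  have wd: "AE x\<in>I01 in lborel. wderiv I01 u x = d x"
    by (rule wderiv_AE_eq[OF _ _ dL ud, of 0 1]) auto
  have "u \<in> H1 I01" using uL dL ud by (auto simp: H1_def)
  then have wm: "set_borel_measurable lborel I01 (wderiv I01 u)" using H1_wderiv[of u] by (auto simp: L2_def)
  have pm: "set_borel_measurable lborel I01 p" by (rule continuous_on_set_borel_measurable[OF p]) auto
  obtain P where P: "\<And>x. x \<in> {0..1} \<Longrightarrow> \<bar>p x\<bar> \<le> P"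
    using bounded_of_continuous_on_compact[OF compact_Icc p] unfolding real_norm_def by blast
  have pd2: "set_integrable lborel I01 (\<lambda>x. p x * d x * d x)"
  proof (rule L2_imp_set_integrable[of _ _ 0 1])
    have "0 \<le> B" using B[of 0] by auto
    have "0 \<le> P" using P[of 0] by auto
    show "(\<lambda>x. p x * d x * d x) \<in> L2 I01"
    proof (rule bounded_imp_L2[of _ _ 0 1 "P * B * B"])
      show "set_borel_measurable lborel I01 (\<lambda>x. p x * d x * d x)"
        by (intro set_borel_measurable_mult pm dm)
      fix x :: real assume x: "x \<in> I01"
      show "norm (p x * d x * d x) \<le> P * B * B"
        unfolding norm_mult using P[of x] B[of x] x \<open>0 \<le> B\<close> \<open>0 \<le> P\<close>
        by (intro mult_mono) auto
    qed auto
  qed auto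
  have y2: "continuous_on {0..1} (\<lambda>x. lam * y x * y x)" by (intro continuous_intros yc)
  have A1: "(LINT x:I01|lborel. p x * wderiv I01 u x * wderiv I01 u x) = integral {0..1} (\<lambda>x. p x * d x * d x)"
  proof (rule set_LINT_eq_integral_AE[OF _ pd2])
    show "set_borel_measurable lborel I01 (\<lambda>x. p x * wderiv I01 u x * wderiv I01 u x)"
      by (intro set_borel_measurable_mult pm wm)
    show "AE x\<in>I01 in lborel. p x * wderiv I01 u x * wderiv I01 u x = p x * d x * d x"
      using wd by eventually_elim auto
  qed
  have A2: "(LINT x:I01|lborel. lam * u x * u x) = integral {0..1} (\<lambda>x. lam * y x * y x)"
  proof (rule set_LINT_eq_integral_AE[OF _ set_integrable_continuous_on[OF y2]])
    show "set_borel_measurable lborel I01 (\<lambda>x. lam * u x * u x)"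
      by (intro set_borel_measurable_mult) (use uL in \<open>auto simp: L2_def set_borel_measurable_def\<close>)
    show "AE x\<in>I01 in lborel. lam * u x * u x = lam * y x * y x"
      using uy by eventually_elim auto
  qed
  have i1: "(\<lambda>x. p x * d x * d x) integrable_on {0..1}" by (rule set_integrable_imp_integrable_on_Icc[OF pd2])
  have i2: "(\<lambda>x. lam * y x * y x) integrable_on {0..1}" by (rule integrable_continuous_real[OF y2])
  have E: "energy p lam d y = (\<lambda>x. p x * d x * d x + lam * y x * y x)"
    by (auto simp: energy_def power2_eq_square mult.assoc)
  have "X_inner p lam u u = integral {0..1} (energy p lam d y)"
    unfolding X_inner_def A1 A2 E by (rule integral_add[OF i1 i2, symmetric])
  then show "X_norm p lam (\<lambda>x. u1 x - u2 x) =
      sqrt (integral {0..1} (energy p lam (\<lambda>x. q1 x * z1 x - q2 x * z2 x) (\<lambda>x. v1 x - v2 x)))"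
    by (simp add: X_norm_def u_def[abs_def] d_def[abs_def] y_def[abs_def])
  have "energy p lam d y integrable_on {0..1}" unfolding E by (intro integrable_add i1 i2)
  then show "energy p lam (\<lambda>x. q1 x * z1 x - q2 x * z2 x) (\<lambda>x. v1 x - v2 x) integrable_on {0..1}"
    by (simp add: d_def[abs_def] y_def[abs_def])
qed

text \<open>
  With \<open>y = v1 - v2\<close> and \<open>d = y'\<close>, the initial value is at most the integral of \<open>\<bar>y\<bar> + \<bar>d\<bar>\<close>.
  Each term is bounded by \<open>\<bar>t\<bar> \<le> \<delta> / 2 + t\<^sup>2 / (2 \<delta>)\<close>, and the squares are controlled by the energy.
  The factor depends on the lower bounds \<open>m\<close> and \<open>lam\<close> only, hence not on \<open>\<epsilon>\<close>.
\<close>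

lemma initial_value_le_energy:
  assumes q1: "bdd_coeff Q1 q1" and q2: "bdd_coeff Q2 q2"
    and f1: "is_flow q1 h1 c1 v1 z1" and f2: "is_flow q2 h2 c2 v2 z2"
    and p: "0 < m" "\<And>x. x \<in> {0..1} \<Longrightarrow> m \<le> p x" and lam: "0 < lam" and \<delta>: "0 < \<delta>"
    and i: "energy p lam (\<lambda>x. q1 x * z1 x - q2 x * z2 x) (\<lambda>x. v1 x - v2 x) integrable_on {0..1}"
    and le: "integral {0..1} (energy p lam (\<lambda>x. q1 x * z1 x - q2 x * z2 x) (\<lambda>x. v1 x - v2 x)) \<le> \<delta>\<^sup>2"
  shows "\<bar>c1 - c2\<bar> \<le> \<delta> * (1 + (1 / m + 1 / lam) / 2)"
proof -
  note C1 = is_flow_continuous[OF q1 f1] and C2 = is_flow_continuous[OF q2 f2]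
  define d where "d x = q1 x * z1 x - q2 x * z2 x" for x
  define y where "y x = v1 x - v2 x" for x
  define k where "k = 1 / m + 1 / lam"
  define P where "P = energy p lam d y"
  have Pi: "P integrable_on {0..1}" and Ple: "integral {0..1} P \<le> \<delta>\<^sup>2"
    using i le by (simp_all add: P_def d_def[abs_def] y_def[abs_def])
  have "set_integrable lborel {0..1} (\<lambda>x. \<bar>d x\<bar>)" unfolding d_def
    by (intro set_integrable_abs bdd_coeff_flow_diff_integrable[OF q1 q2 C1(1) C2(1)])
  then have di: "(\<lambda>x. \<bar>d x\<bar>) integrable_on {0..1}" by (rule set_borel_integral_eq_integral)
  have yc: "continuous_on {0..1} y" unfolding y_def by (intro continuous_intros C1 C2)
  have yi: "(\<lambda>x. \<bar>y x\<bar>) integrable_on {0..1}" by (intro integrable_continuous_real continuous_intros yc)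
  have pt: "\<bar>c1 - c2\<bar> \<le> \<bar>y x\<bar> + integral {0..1} (\<lambda>x. \<bar>d x\<bar>)" if x: "x \<in> {0..1}" for x
  proof -
    have ii: "(\<lambda>t. q1 t * z1 t) integrable_on {0..x}" "(\<lambda>t. q2 t * z2 t) integrable_on {0..x}"
      by (intro bdd_coeff_mult_integrable_on[OF q1 C1(1)] bdd_coeff_mult_integrable_on[OF q2 C2(1)]; use x in auto)+
    have yx: "y x = c1 - c2 + integral {0..x} d"
      using f1 f2 x unfolding d_def by (simp add: integral_diff[OF ii] is_flow_def y_def)
    have dx: "(\<lambda>x. \<bar>d x\<bar>) integrable_on {0..x}" by (rule integrable_on_subinterval[OF di]) (use x in auto)
    have "norm (integral {0..x} d) \<le> integral {0..x} (\<lambda>x. \<bar>d x\<bar>)"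
      by (rule integral_norm_bound_integral[OF _ dx]) (auto simp: d_def[abs_def] intro!: integrable_diff ii)
    also have "\<dots> \<le> integral {0..1} (\<lambda>x. \<bar>d x\<bar>)"
      by (rule integral_subset_le[OF _ dx di]) (use x in auto)
    finally show ?thesis using yx by simp
  qed
  have am: "\<bar>t\<bar> \<le> \<delta> / 2 + t\<^sup>2 / (2 * \<delta>)" for t :: real
  proof -
    have "0 \<le> (\<bar>t\<bar> - \<delta>)\<^sup>2" by simp
    then have "2 * \<delta> * \<bar>t\<bar> \<le> \<delta>\<^sup>2 + t\<^sup>2" by (simp add: power2_diff mult_ac add.commute)
    then show ?thesis using \<delta> by (simp add: field_simps power2_eq_square)
  qed
  have "\<bar>c1 - c2\<bar> = integral {0..1} (\<lambda>x::real. \<bar>c1 - c2\<bar>)" by simp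
  also have "\<dots> \<le> integral {0..1} (\<lambda>x. \<bar>y x\<bar> + integral {0..1} (\<lambda>x. \<bar>d x\<bar>))"
    by (rule integral_le) (use pt in \<open>auto intro!: integrable_add yi\<close>)
  also have "\<dots> = integral {0..1} (\<lambda>x. \<bar>y x\<bar>) + integral {0..1} (\<lambda>x. \<bar>d x\<bar>)"
    by (subst integral_add[OF yi]) auto
  also have "\<dots> = integral {0..1} (\<lambda>x. \<bar>y x\<bar> + \<bar>d x\<bar>)" by (rule integral_add[OF yi di, symmetric])
  also have "\<dots> \<le> integral {0..1} (\<lambda>x. \<delta> + k / (2 * \<delta>) * P x)"
  proof (rule integral_le)
    show "(\<lambda>x. \<bar>y x\<bar> + \<bar>d x\<bar>) integrable_on {0..1}" by (intro integrable_add yi di)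
    show "(\<lambda>x. \<delta> + k / (2 * \<delta>) * P x) integrable_on {0..1}"
      by (intro integrable_add integrable_on_mult_right Pi) auto
    fix x :: real assume x: "x \<in> {0..1}"
    have "(y x)\<^sup>2 = 1 / lam * (lam * (y x)\<^sup>2)" using lam by simp
    also have "\<dots> \<le> k * (lam * (y x)\<^sup>2)"
      using lam p(1) by (intro mult_right_mono) (auto simp: k_def)
    finally have 1: "(y x)\<^sup>2 \<le> k * (lam * (y x)\<^sup>2)" .
    have "(d x)\<^sup>2 = 1 / m * (m * (d x)\<^sup>2)" using p by simp
    also have "\<dots> \<le> k * (p x * (d x)\<^sup>2)"
      using lam p(1) p(2)[OF x] by (intro mult_mono) (auto simp: k_def intro!: mult_right_mono)
    finally have 2: "(d x)\<^sup>2 \<le> k * (p x * (d x)\<^sup>2)" .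
    have "(y x)\<^sup>2 + (d x)\<^sup>2 \<le> k * P x"
      using 1 2 by (simp add: P_def energy_def algebra_simps)
    then have "((y x)\<^sup>2 + (d x)\<^sup>2) / (2 * \<delta>) \<le> k * P x / (2 * \<delta>)" using \<delta> by (intro divide_right_mono) auto
    then show "\<bar>y x\<bar> + \<bar>d x\<bar> \<le> \<delta> + k / (2 * \<delta>) * P x"
      using am[of "y x"] am[of "d x"] by (simp add: add_divide_distrib)
  qed
  also have "\<dots> = \<delta> + k / (2 * \<delta>) * integral {0..1} P"
  proof -
    have "(\<lambda>x. k / (2 * \<delta>) * P x) integrable_on {0..1}" by (rule integrable_on_mult_right[OF Pi])
    then have "integral {0..1} (\<lambda>x. \<delta> + k / (2 * \<delta>) * P x)
        = integral {0..1} (\<lambda>_::real. \<delta>) + integral {0..1} (\<lambda>x. k / (2 * \<delta>) * P x)"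
      by (intro integral_add) auto
    then show ?thesis by (simp only: integral_mult_right) simp
  qed
  also have "\<dots> \<le> \<delta> + k / (2 * \<delta>) * \<delta>\<^sup>2"
    using lam p \<delta> Ple by (intro add_left_mono mult_left_mono) (auto simp: k_def)
  also have "\<dots> = \<delta> * (1 + k / 2)" using \<delta> by (simp add: power2_eq_square field_simps)
  finally show ?thesis by (simp add: k_def)
qed

text \<open>
  Let \<open>a\<close> and \<open>b\<close> be the two coefficients. As \<open>a z1 - b z2 = a (z1 - z2) + (a - b) z2\<close> and
  \<open>p a = 1\<close>, the derivative part of the energy is at most twice \<open>a (z1 - z2)\<^sup>2 + p (a - b)\<^sup>2 z2\<^sup>2\<close>. In the
  last term \<open>p (a - b)\<^sup>2 = \<bar>a - b\<bar> \<bar>1 - p b\<bar>\<close>, and \<open>\<bar>1 - p b\<bar>\<close> is bounded although \<open>p\<close> is not: outside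
  \<open>S\<close>, where \<open>p\<close> may be large, \<open>b\<close> is \<open>0\<close>.
\<close>

lemma energy_le:
  assumes O: "S \<subseteq> {0..1}"
    and p: "continuous_on {0..1} p" "continuous_on S p0" "S \<in> sets borel"
    and m: "0 < m" "\<And>x. x \<in> {0..1} \<Longrightarrow> m \<le> p x" "\<And>x. x \<in> S \<Longrightarrow> m \<le> p0 x"
    and close: "\<And>x. x \<in> S \<Longrightarrow> \<bar>p x - p0 x\<bar> \<le> 1"
    and lam: "0 < lam"
    and B: "\<And>x. x \<in> {0..1} \<Longrightarrow> \<bar>z2 x\<bar> \<le> B"
    and \<sigma>: "\<And>x. x \<in> {0..1} \<Longrightarrow> \<bar>v1 x - v2 x\<bar> + \<bar>z1 x - z2 x\<bar> \<le> \<sigma>"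
    and d: "integral {0..1} (\<lambda>x. \<bar>recip_on {0..1} p x - recip_on S p0 x\<bar>) \<le> d"
    and i: "energy p lam (\<lambda>x. recip_on {0..1} p x * z1 x - recip_on S p0 x * z2 x) (\<lambda>x. v1 x - v2 x) integrable_on {0..1}"
  shows "integral {0..1} (energy p lam (\<lambda>x. recip_on {0..1} p x * z1 x - recip_on S p0 x * z2 x) (\<lambda>x. v1 x - v2 x))
    \<le> (2 / m + lam) * \<sigma>\<^sup>2 + 2 * (1 + 1 / m) * B\<^sup>2 * d"
proof -
  define a where "a = recip_on {0..1} p"
  define b where "b = recip_on S p0"
  note qa = bdd_coeff_recip_on[OF p(1) _ m(1,2), folded a_def] and qb = bdd_coeff_recip_on[OF p(2,3) m(1,3), folded b_def]
  have abi: "(\<lambda>x. \<bar>a x - b x\<bar>) integrable_on {0..1}"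
    using bdd_coeff_mult_integrable_on[OF bdd_coeff_diff_abs[OF qa qb], of "\<lambda>_. 1" 0 1] by simp
  have B0: "0 \<le> B" using B[of 0] by auto
  have "integral {0..1} (energy p lam (\<lambda>x. a x * z1 x - b x * z2 x) (\<lambda>x. v1 x - v2 x))
     \<le> integral {0..1} (\<lambda>x. (2 / m + lam) * \<sigma>\<^sup>2 + 2 * (1 + 1 / m) * B\<^sup>2 * \<bar>a x - b x\<bar>)"
  proof (rule integral_le)
    show "energy p lam (\<lambda>x. a x * z1 x - b x * z2 x) (\<lambda>x. v1 x - v2 x) integrable_on {0..1}"
      using i by (simp add: a_def b_def)
    show "(\<lambda>x. (2 / m + lam) * \<sigma>\<^sup>2 + 2 * (1 + 1 / m) * B\<^sup>2 * \<bar>a x - b x\<bar>) integrable_on {0..1}"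
      by (intro integrable_add integrable_on_mult_right abi) auto
    fix x :: real assume x: "x \<in> {0..1}"
    have px: "0 < p x" "m \<le> p x" using m(1) m(2)[OF x] by auto
    have ax: "a x = 1 / p x" using x by (simp add: a_def recip_on_def)
    have pa: "p x * a x = 1" "0 < a x" "a x \<le> 1 / m" using px m(1) by (auto simp: ax frac_le)
    have pb: "\<bar>1 - p x * b x\<bar> \<le> 1 + 1 / m"
    proof (cases "x \<in> S")
      case True
      have p0x: "0 < p0 x" "m \<le> p0 x" using m(1) m(3)[OF True] by auto
      have "\<bar>1 - p x * b x\<bar> = \<bar>p x - p0 x\<bar> / p0 x"
      proof -
        have "1 - p x * b x = (p0 x - p x) / p0 x" using True p0x by (simp add: b_def recip_on_def field_simps)
        then show ?thesis using p0x by (simp add: abs_minus_commute)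
      qed
      also have "\<dots> \<le> 1 / m" using close[OF True] p0x m(1) by (intro frac_le) auto
      finally show ?thesis by simp
    next
      case False then show ?thesis using m(1) by (simp add: b_def recip_on_def)
    qed
    have "p x * D\<^sup>2 = \<bar>D\<bar> * \<bar>p x * D\<bar>" for D
    proof -
      have "\<bar>D\<bar> * \<bar>p x * D\<bar> = p x * (\<bar>D\<bar> * \<bar>D\<bar>)" using px by (simp only: abs_mult abs_of_pos mult_ac)
      then show ?thesis by (simp add: power2_eq_square)
    qed
    then have "p x * (a x - b x)\<^sup>2 = \<bar>a x - b x\<bar> * \<bar>p x * (a x - b x)\<bar>" .
    also have "p x * (a x - b x) = 1 - p x * b x" using pa by (simp add: right_diff_distrib)
    also have "\<bar>a x - b x\<bar> * \<bar>1 - p x * b x\<bar> \<le> \<bar>a x - b x\<bar> * (1 + 1 / m)" by (intro mult_left_mono pb) auto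
    finally have 1: "p x * (a x - b x)\<^sup>2 \<le> (1 + 1 / m) * \<bar>a x - b x\<bar>" by (simp add: mult.commute)
    have \<sigma>x: "\<bar>v1 x - v2 x\<bar> \<le> \<sigma>" "\<bar>z1 x - z2 x\<bar> \<le> \<sigma>" using \<sigma>[OF x] by auto
    have sq: "(v1 x - v2 x)\<^sup>2 \<le> \<sigma>\<^sup>2" "(z1 x - z2 x)\<^sup>2 \<le> \<sigma>\<^sup>2" "(z2 x)\<^sup>2 \<le> B\<^sup>2"
      using power_mono[OF \<sigma>x(1), of 2] power_mono[OF \<sigma>x(2), of 2] power_mono[OF B[OF x], of 2] by auto
    have "p x * (a x * z1 x - b x * z2 x)\<^sup>2 = p x * (a x * (z1 x - z2 x) + (a x - b x) * z2 x)\<^sup>2"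
      by (simp add: algebra_simps)
    also have "\<dots> \<le> p x * (2 * (a x * (z1 x - z2 x))\<^sup>2 + 2 * ((a x - b x) * z2 x)\<^sup>2)"
    proof -
      have "(s + t)\<^sup>2 \<le> 2 * s\<^sup>2 + 2 * t\<^sup>2" for s t :: real
        using zero_le_power2[of "s - t"] by (simp add: power2_eq_square algebra_simps)
      then show ?thesis using px by (intro mult_left_mono) auto
    qed
    also have "\<dots> = 2 * (p x * a x) * a x * (z1 x - z2 x)\<^sup>2 + 2 * (p x * (a x - b x)\<^sup>2) * (z2 x)\<^sup>2"
      by (simp add: power2_eq_square algebra_simps)
    also have "\<dots> \<le> 2 * (1 / m) * \<sigma>\<^sup>2 + 2 * ((1 + 1 / m) * \<bar>a x - b x\<bar>) * B\<^sup>2"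
    proof (rule add_mono)
      have "a x * (z1 x - z2 x)\<^sup>2 \<le> 1 / m * \<sigma>\<^sup>2"
        by (rule mult_mono[OF pa(3) sq(2)]) (use m(1) in auto)
      then show "2 * (p x * a x) * a x * (z1 x - z2 x)\<^sup>2 \<le> 2 * (1 / m) * \<sigma>\<^sup>2" by (simp add: pa(1))
      have "p x * (a x - b x)\<^sup>2 * (z2 x)\<^sup>2 \<le> (1 + 1 / m) * \<bar>a x - b x\<bar> * B\<^sup>2"
        by (rule mult_mono[OF 1 sq(3)]) (use m(1) in auto)
      then show "2 * (p x * (a x - b x)\<^sup>2) * (z2 x)\<^sup>2 \<le> 2 * ((1 + 1 / m) * \<bar>a x - b x\<bar>) * B\<^sup>2"
        by linarith
    qed
    finally have "p x * (a x * z1 x - b x * z2 x)\<^sup>2 \<le> 2 / m * \<sigma>\<^sup>2 + 2 * (1 + 1 / m) * B\<^sup>2 * \<bar>a x - b x\<bar>"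
      by (simp add: algebra_simps)
    moreover have "lam * (v1 x - v2 x)\<^sup>2 \<le> lam * \<sigma>\<^sup>2" using lam sq by (intro mult_left_mono) auto
    ultimately show "energy p lam (\<lambda>x. a x * z1 x - b x * z2 x) (\<lambda>x. v1 x - v2 x) x
        \<le> (2 / m + lam) * \<sigma>\<^sup>2 + 2 * (1 + 1 / m) * B\<^sup>2 * \<bar>a x - b x\<bar>"
      by (simp add: energy_def algebra_simps)
  qed
  also have "\<dots> = (2 / m + lam) * \<sigma>\<^sup>2 + 2 * (1 + 1 / m) * B\<^sup>2 * integral {0..1} (\<lambda>x. \<bar>a x - b x\<bar>)"
    by (subst integral_add) (auto intro!: integrable_on_mult_right abi)
  also have "\<dots> \<le> (2 / m + lam) * \<sigma>\<^sup>2 + 2 * (1 + 1 / m) * B\<^sup>2 * d"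
    using d m(1) by (intro add_left_mono mult_left_mono) (auto simp: a_def b_def)
  finally show ?thesis by (simp add: a_def b_def)
qed

text \<open>
  A function whose secants near \<open>s0\<close> have slopes within \<open>\<bar>k\<bar> / 2\<close> of \<open>k\<close> changes by at least
  \<open>\<bar>k\<bar> t / 2\<close> on an interval of length \<open>t\<close>, so the intermediate value theorem gives a zero
  at the distance stated.
\<close>

lemma near_linear_root:
  fixes \<Phi> :: "real \<Rightarrow> real"
  assumes k: "k \<noteq> 0"
    and lin: "\<And>s s'. \<bar>s - s0\<bar> \<le> r \<Longrightarrow> \<bar>s' - s0\<bar> \<le> r \<Longrightarrow> \<bar>\<Phi> s - \<Phi> s' - k * (s - s')\<bar> \<le> \<bar>k\<bar> / 2 * \<bar>s - s'\<bar>"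
    and small: "2 * \<bar>\<Phi> s0\<bar> / \<bar>k\<bar> \<le> r"
  shows "\<exists>s. \<bar>s - s0\<bar> \<le> 2 * \<bar>\<Phi> s0\<bar> / \<bar>k\<bar> \<and> \<Phi> s = 0"
proof -
  \<comment> \<open>normalise the slope to \<open>1\<close>\<close>
  define \<Psi> where "\<Psi> s = \<Phi> s / k" for s
  define t where "t = 2 * \<bar>\<Phi> s0\<bar> / \<bar>k\<bar>"
  have t: "0 \<le> t" "t \<le> r" "\<bar>\<Psi> s0\<bar> = t / 2" using small by (auto simp: t_def \<Psi>_def abs_divide)
  have lin': "\<bar>\<Psi> s - \<Psi> s' - (s - s')\<bar> \<le> \<bar>s - s'\<bar> / 2" if "\<bar>s - s0\<bar> \<le> r" "\<bar>s' - s0\<bar> \<le> r" for s s'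
  proof -
    have "\<Psi> s - \<Psi> s' - (s - s') = (\<Phi> s - \<Phi> s' - k * (s - s')) / k"
      using k by (simp add: \<Psi>_def diff_divide_distrib)
    then have "\<bar>\<Psi> s - \<Psi> s' - (s - s')\<bar> = \<bar>\<Phi> s - \<Phi> s' - k * (s - s')\<bar> / \<bar>k\<bar>" by (simp add: abs_divide)
    also have "\<dots> \<le> \<bar>k\<bar> / 2 * \<bar>s - s'\<bar> / \<bar>k\<bar>" by (intro divide_right_mono lin that) auto
    finally show ?thesis using k by simp
  qed
  have "(3/2)-lipschitz_on {s0 - t..s0 + t} \<Psi>"
  proof (rule lipschitz_onI)
    fix s s' assume "s \<in> {s0 - t..s0 + t}" "s' \<in> {s0 - t..s0 + t}"
    then have "\<bar>s - s0\<bar> \<le> r" "\<bar>s' - s0\<bar> \<le> r" using t by auto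
    note lin'[OF this]
    moreover have "\<bar>\<Psi> s - \<Psi> s'\<bar> \<le> \<bar>\<Psi> s - \<Psi> s' - (s - s')\<bar> + \<bar>s - s'\<bar>"
      using abs_triangle_ineq[of "\<Psi> s - \<Psi> s' - (s - s')" "s - s'"] by simp
    ultimately show "dist (\<Psi> s) (\<Psi> s') \<le> 3/2 * dist s s'" unfolding dist_real_def by simp
  qed simp
  then have c: "continuous_on {s0 - t..s0 + t} \<Psi>" by (rule lipschitz_on_continuous_on)
  have "\<Psi> (s0 - t) \<le> 0" using lin'[of "s0 - t" s0] t by auto
  moreover have "0 \<le> \<Psi> (s0 + t)" using lin'[of "s0 + t" s0] t by auto
  ultimately obtain s where "s0 - t \<le> s" "s \<le> s0 + t" "\<Psi> s = 0"
    using IVT'[of \<Psi> "s0 - t" 0 "s0 + t"] c t by auto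
  then show ?thesis using k by (intro exI[of _ s]) (auto simp: t_def \<Psi>_def)
qed

section \<open>The shooting function and its zero\<close>

lemma flow_scaled_diff:
  assumes q: "bdd_coeff Q q" and f1: "is_flow q h1 c1 v1 z1" and f2: "is_flow q h2 c2 v2 z2"
  shows "is_flow q (\<lambda>t. k * (h1 t - h2 t)) (k * (c1 - c2)) (\<lambda>x. k * (v1 x - v2 x)) (\<lambda>x. k * (z1 x - z2 x))"
  unfolding is_flow_def
proof (intro conjI ballI)
  note C1 = is_flow_continuous[OF q f1] and C2 = is_flow_continuous[OF q f2]
  show "continuous_on {0..1} (\<lambda>t. k * (h1 t - h2 t))" by (intro continuous_intros C1 C2)
  fix x :: real assume x: "x \<in> {0..1}"
  have i: "(\<lambda>t. q t * z1 t) integrable_on {0..x}" "(\<lambda>t. q t * z2 t) integrable_on {0..x}"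
    by (intro bdd_coeff_mult_integrable_on[OF q C1(1)] bdd_coeff_mult_integrable_on[OF q C2(1)]; use x in auto)+
  have ih: "h1 integrable_on {0..x}" "h2 integrable_on {0..x}"
    by (intro integrable_continuous_real continuous_on_subset[OF C1(3)] continuous_on_subset[OF C2(3)]; use x in auto)+
  have "integral {0..x} (\<lambda>t. q t * (k * (z1 t - z2 t))) = integral {0..x} (\<lambda>t. k * (q t * z1 t - q t * z2 t))"
    by (simp add: algebra_simps)
  also have "\<dots> = k * (integral {0..x} (\<lambda>t. q t * z1 t) - integral {0..x} (\<lambda>t. q t * z2 t))"
    by (simp add: integral_diff[OF i])
  finally show "k * (v1 x - v2 x) = k * (c1 - c2) + integral {0..x} (\<lambda>t. q t * (k * (z1 t - z2 t)))"
    using f1 f2 x by (simp add: is_flow_def algebra_simps)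
  show "k * (z1 x - z2 x) = integral {0..x} (\<lambda>t. k * (h1 t - h2 t))"
    using f1 f2 x by (simp add: is_flow_def integral_diff[OF ih])
qed

lemma secant_slope:
  fixes f f' :: "real \<Rightarrow> real"
  assumes f: "\<And>x. (f has_real_derivative f' x) (at x)" and ab: "\<bar>a - u\<bar> \<le> \<sigma>" "\<bar>b - u\<bar> \<le> \<sigma>"
  shows "\<exists>\<xi>. f a - f b = f' \<xi> * (a - b) \<and> \<bar>\<xi> - u\<bar> \<le> \<sigma>"
proof -
  consider "a < b" | "a = b" | "b < a" by linarith
  then show ?thesis
  proof cases
    case 1
    obtain \<xi> where "a < \<xi>" "\<xi> < b" "f b - f a = (b - a) * f' \<xi>" using MVT2[OF 1, of f f'] f by auto
    then show ?thesis using ab by (intro exI[of _ \<xi>]) (auto simp: algebra_simps)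
  next
    case 2 then show ?thesis using ab by auto
  next
    case 3
    obtain \<xi> where "b < \<xi>" "\<xi> < a" "f a - f b = (a - b) * f' \<xi>" using MVT2[OF 3, of f f'] f by auto
    then show ?thesis using ab by (intro exI[of _ \<xi>]) (auto simp: algebra_simps)
  qed
qed

text \<open>
  The difference quotient \<open>(v1 - v2) / (c1 - c2)\<close> starts at \<open>1\<close> and solves a linear system with factor
  \<open>lam - f' \<xi>\<close>, where \<open>\<xi>\<close> lies between \<open>v1\<close> and \<open>v2\<close> and so is within \<open>\<sigma>\<close> of \<open>U\<close>. It is compared with the
  linearisation at \<open>U\<close> by the stability estimate. Working with difference quotients avoids
  differentiating the solution with respect to its initial value.
\<close>

lemma secant_close_to_linearization:
  assumes q: "bdd_coeff Q q" and q0: "bdd_coeff Q0 q0"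
    and f1: "is_flow q (\<lambda>t. lam * v1 t - f (v1 t)) c1 v1 z1"
    and f2: "is_flow q (\<lambda>t. lam * v2 t - f (v2 t)) c2 v2 z2"
    and lin: "is_flow q0 (\<lambda>t. (lam - f' (U t)) * y t) 1 y \<zeta>"
    and close: "\<And>x. x \<in> {0..1} \<Longrightarrow> \<bar>v1 x - U x\<bar> \<le> \<sigma>" "\<And>x. x \<in> {0..1} \<Longrightarrow> \<bar>v2 x - U x\<bar> \<le> \<sigma>"
    and f: "\<And>x. (f has_real_derivative f' x) (at x)" and F1: "\<And>x. \<bar>f' x\<bar> \<le> F1"
    and F2: "\<And>a b. \<bar>f' a - f' b\<bar> \<le> F2 * \<bar>a - b\<bar>" "0 \<le> F2"
    and V: "\<And>x. x \<in> {0..1} \<Longrightarrow> \<bar>y x\<bar> \<le> V" "\<And>x. x \<in> {0..1} \<Longrightarrow> \<bar>\<zeta> x\<bar> \<le> V"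
    and d: "integral {0..1} (\<lambda>t. \<bar>q t - q0 t\<bar>) \<le> d" and lam: "0 \<le> lam"
  shows "\<bar>z1 1 - z2 1 - \<zeta> 1 * (c1 - c2)\<bar> \<le> (V * d + F2 * \<sigma> * V) * exp (Q + (lam + F1)) * \<bar>c1 - c2\<bar>"
proof (cases "c1 = c2")
  case True
  have "\<bar>v1 1 - v2 1\<bar> + \<bar>z1 1 - z2 1\<bar> \<le> (\<bar>c1 - c2\<bar> + B * 0 + 0) * exp (Q + (lam + F1))"
    if "\<And>x. x \<in> {0..1} \<Longrightarrow> \<bar>z2 x\<bar> \<le> B" for B
  proof (rule flow_stability[OF q q f1 f2 that])
    fix t :: real
    obtain \<xi> where "f (v1 t) - f (v2 t) = f' \<xi> * (v1 t - v2 t)"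
      using secant_slope[OF f, of "v1 t" "v2 t" "\<bar>v1 t - v2 t\<bar>" "v2 t"] by auto
    then have "lam * v1 t - f (v1 t) - (lam * v2 t - f (v2 t)) = (lam - f' \<xi>) * (v1 t - v2 t)"
      by (simp add: algebra_simps)
    moreover have "\<bar>lam - f' \<xi>\<bar> \<le> lam + F1" using F1[of \<xi>] lam by linarith
    ultimately show "\<bar>lam * v1 t - f (v1 t) - (lam * v2 t - f (v2 t))\<bar> \<le> (lam + F1) * \<bar>v1 t - v2 t\<bar> + 0"
      by (simp add: abs_mult mult_right_mono)
    show "0 \<le> lam + F1" using F1[of 0] lam by linarith
  qed auto
  moreover obtain B where "\<And>x. x \<in> {0..1} \<Longrightarrow> \<bar>z2 x\<bar> \<le> B"
    using bounded_of_continuous_on_compact[OF compact_Icc is_flow_continuous(1)[OF q f2]] unfolding real_norm_def by blast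
  ultimately have "\<bar>v1 1 - v2 1\<bar> + \<bar>z1 1 - z2 1\<bar> \<le> 0" using True by fastforce
  then show ?thesis using True by simp
next
  case False
  define k where "k = 1 / (c1 - c2)"
  have k: "k * (c1 - c2) = 1" using False by (simp add: k_def)
  have V0: "0 \<le> V" using V(1)[of 0] by auto
  have \<sigma>0: "0 \<le> \<sigma>" using close(1)[of 0] by auto
  have L0: "0 \<le> lam + F1" using F1[of 0] lam by linarith
  define h where "h t = k * ((lam * v1 t - f (v1 t)) - (lam * v2 t - f (v2 t)))" for t
  have fl: "is_flow q h 1 (\<lambda>x. k * (v1 x - v2 x)) (\<lambda>x. k * (z1 x - z2 x))"
    using flow_scaled_diff[OF q f1 f2, of k] by (simp add: k h_def[abs_def])
  have "\<bar>k * (v1 1 - v2 1) - y 1\<bar> + \<bar>k * (z1 1 - z2 1) - \<zeta> 1\<bar>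
     \<le> (\<bar>1 - 1\<bar> + V * d + F2 * \<sigma> * V) * exp (Q + (lam + F1))"
  proof (rule flow_stability[OF q q0 fl lin V(2) d L0])
    show "0 \<le> F2 * \<sigma> * V" using F2(2) \<sigma>0 V0 by simp
    fix t :: real assume t: "t \<in> {0..1}"
    obtain \<xi> where xi: "f (v1 t) - f (v2 t) = f' \<xi> * (v1 t - v2 t)" "\<bar>\<xi> - U t\<bar> \<le> \<sigma>"
      using secant_slope[OF f close(1)[OF t] close(2)[OF t]] by auto
    have "(lam * v1 t - f (v1 t)) - (lam * v2 t - f (v2 t)) = (lam - f' \<xi>) * (v1 t - v2 t)"
      using xi(1) by (simp add: algebra_simps)
    then have "h t = (lam - f' \<xi>) * (k * (v1 t - v2 t))" by (simp add: h_def)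
    then have "h t - (lam - f' (U t)) * y t
        = (lam - f' \<xi>) * (k * (v1 t - v2 t) - y t) + (f' (U t) - f' \<xi>) * y t"
      by (simp add: algebra_simps)
    then have "\<bar>h t - (lam - f' (U t)) * y t\<bar>
        \<le> \<bar>lam - f' \<xi>\<bar> * \<bar>k * (v1 t - v2 t) - y t\<bar> + \<bar>f' (U t) - f' \<xi>\<bar> * \<bar>y t\<bar>"
      by (metis abs_mult abs_triangle_ineq)
    also have "\<dots> \<le> (lam + F1) * \<bar>k * (v1 t - v2 t) - y t\<bar> + F2 * \<sigma> * V"
    proof (intro add_mono mult_mono)
      show "\<bar>lam - f' \<xi>\<bar> \<le> lam + F1" using F1[of \<xi>] lam by linarith
      have "\<bar>f' (U t) - f' \<xi>\<bar> \<le> F2 * \<bar>U t - \<xi>\<bar>" by (rule F2)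
      also have "\<dots> \<le> F2 * \<sigma>" using xi(2) F2(2) by (intro mult_left_mono) (auto simp: abs_minus_commute)
      finally show "\<bar>f' (U t) - f' \<xi>\<bar> \<le> F2 * \<sigma>" .
      show "\<bar>y t\<bar> \<le> V" by (rule V(1)[OF t])
    qed (use L0 F2(2) \<sigma>0 in auto)
    finally show "\<bar>h t - (lam - f' (U t)) * y t\<bar> \<le> (lam + F1) * \<bar>k * (v1 t - v2 t) - y t\<bar> + F2 * \<sigma> * V" .
  qed auto
  then have b: "\<bar>k * (z1 1 - z2 1) - \<zeta> 1\<bar> \<le> (V * d + F2 * \<sigma> * V) * exp (Q + (lam + F1))" by simp
  have "z1 1 - z2 1 - \<zeta> 1 * (c1 - c2) = (k * (z1 1 - z2 1) - \<zeta> 1) * (c1 - c2)"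
    using k by (simp add: left_diff_distrib mult.commute mult.left_commute) (metis mult.left_commute mult.right_neutral right_diff_distrib)
  then have "\<bar>z1 1 - z2 1 - \<zeta> 1 * (c1 - c2)\<bar> = \<bar>k * (z1 1 - z2 1) - \<zeta> 1\<bar> * \<bar>c1 - c2\<bar>" by (simp add: abs_mult)
  also have "\<dots> \<le> (V * d + F2 * \<sigma> * V) * exp (Q + (lam + F1)) * \<bar>c1 - c2\<bar>" by (intro mult_right_mono b) auto
  finally show ?thesis .
qed

lemma C2_UNIV_deriv:
  assumes "C2_on UNIV f"
  shows "(f has_real_derivative deriv f x) (at x)" "(deriv f has_real_derivative deriv (deriv f) x) (at x)"
    "continuous_on UNIV f" "continuous_on UNIV (deriv f)"
proof -
  from assms obtain g' g'' where g: "\<And>x. (f has_real_derivative g' x) (at x)"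
    "\<And>x. (g' has_real_derivative g'' x) (at x)" unfolding C2_on_def by auto
  have e: "deriv f = g'" "deriv g' = g''" using DERIV_imp_deriv[OF g(1)] DERIV_imp_deriv[OF g(2)] by auto
  show 1: "(f has_real_derivative deriv f x) (at x)" and 2: "(deriv f has_real_derivative deriv (deriv f) x) (at x)" for x
    using g by (simp_all add: e)
  show "continuous_on UNIV f" by (rule DERIV_continuous_on[OF 1])
  show "continuous_on UNIV (deriv f)" by (rule DERIV_continuous_on[OF 2])
qed

lemma mult_le_of_le_divide_add_one:
  fixes a x \<eta> :: real
  assumes "0 \<le> a" "0 \<le> \<eta>" "\<eta> \<le> x / (a + 1)" shows "a * \<eta> \<le> x"
proof -
  have "(a + 1) * \<eta> \<le> x" using assms by (simp add: field_simps)
  moreover have "a * \<eta> \<le> (a + 1) * \<eta>" using assms by (intro mult_right_mono) auto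
  ultimately show ?thesis by linarith
qed

theorem theorem3p2:
  fixes eps0 lam m0 x1 x2 :: real
    and p :: "real \<Rightarrow> real \<Rightarrow> real" and p0 f u0 :: "real \<Rightarrow> real"
  assumes "0 < eps0" "eps0 \<le> 1" "0 < lam" "0 < m0"
    and "0 < x1" "x1 < x2" "x2 < 1"
    and "\<And>\<epsilon>. \<epsilon> \<in> {0<..eps0} \<Longrightarrow> C2_on {0..1} (p \<epsilon>)"
    and "C2_on (Om1 x1 x2) p0"
    and "uniform_limit (Om1 x1 x2) p p0 (at_right 0)"
    and "\<And>\<epsilon> x. \<epsilon> \<in> {0<..eps0} \<Longrightarrow> x \<in> {x1 + \<epsilon>..x2 - \<epsilon>} \<Longrightarrow> p \<epsilon> x \<ge> 1 / \<epsilon>"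
    and "\<And>\<epsilon> x. \<epsilon> \<in> {0<..eps0} \<Longrightarrow> x \<in> {0<..<1} \<Longrightarrow> p \<epsilon> x \<ge> m0"
    and "C2_on UNIV f"
    and "Limsup at_infinity (\<lambda>x. ereal (f x / x)) < ereal lam"
    and "bounded (range f)" "bounded (range (deriv f))" "bounded (range (deriv (deriv f)))"
    and "\<forall>u \<in> equilibria0 x1 x2 p0 lam f. hyperbolic0 x1 x2 p0 lam f u"
    and "u0 \<in> equilibria0 x1 x2 p0 lam f"
  shows "\<exists>eps1\<in>{0<..eps0}. \<exists>\<delta>>0. \<exists>C>0. \<forall>\<epsilon>\<in>{0<..eps1}.
    \<exists>u \<in> equilibria (p \<epsilon>) lam f \<inter> {v \<in> H1 {0<..<1}. X_norm (p \<epsilon>) lam (\<lambda>x. v x - u0 x) \<le> \<delta>}.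
      (\<forall>w \<in> equilibria (p \<epsilon>) lam f \<inter> {v \<in> H1 {0<..<1}. X_norm (p \<epsilon>) lam (\<lambda>x. v x - u0 x) \<le> \<delta>}.
         AE x\<in>{0<..<1} in lborel. w x = u x) \<and>
      X_norm (p \<epsilon>) lam (\<lambda>x. u x - u0 x)
        \<le> C * sqrt (Linf_norm (Om1 x1 x2) (\<lambda>x. p \<epsilon> x - p0 x) + \<epsilon>)"
proof -
  note lam = \<open>0 < lam\<close> and m = \<open>0 < m0\<close>
  have x12: "0 < x1" "x1 < x2" "x2 < 1" by fact+
  note F = Om1_facts[OF x12]
  define O1 where "O1 = Om1 x1 x2"
  have pc: "continuous_on {0..1} (p \<epsilon>)" if "\<epsilon> \<in> {0<..eps0}" for \<epsilon>
    using C2_on_D[OF assms(8)[OF that]] by blast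
  have p0c: "continuous_on O1 p0" unfolding O1_def using C2_on_D[OF assms(9)] by blast
  have pm: "m0 \<le> p \<epsilon> x" if e: "\<epsilon> \<in> {0<..eps0}" and x: "x \<in> {0..1}" for \<epsilon> x
  proof (rule continuous_ge_on_closure[of "{0<..<1}" "p \<epsilon>" x m0])
    show "continuous_on (closure {0<..<1}) (p \<epsilon>)" using pc[OF e] by simp
    show "x \<in> closure {0<..<1}" using x by simp
  qed (use assms(12)[OF e] in auto)
  have p0m: "m0 \<le> p0 x" if x: "x \<in> O1" for x
  proof (rule tendsto_lowerbound)
    show "((\<lambda>\<epsilon>. p \<epsilon> x) \<longlongrightarrow> p0 x) (at_right 0)"
      using tendsto_uniform_limitI[OF assms(10)] x by (simp add: O1_def)
    have "eventually (\<lambda>\<epsilon>. \<epsilon> \<in> {0<..eps0}) (at_right 0)"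
      using eventually_at_right_less[of "0::real"] eventually_at_rightI[of 0 eps0 "\<lambda>\<epsilon>. \<epsilon> < eps0"] \<open>0 < eps0\<close>
      by (auto simp: eventually_at_right_field intro!: exI[of _ eps0])
    then show "\<forall>\<^sub>F \<epsilon> in at_right 0. m0 \<le> p \<epsilon> x"
      by eventually_elim (use pm x F(4) in \<open>auto simp: O1_def\<close>)
  qed simp
  have O1b: "O1 \<in> sets borel" and O1s: "O1 \<subseteq> {0..1}" using F by (auto simp: O1_def)
  note fd = C2_UNIV_deriv[OF assms(13)]
  obtain F1 where F1: "\<And>x. \<bar>deriv f x\<bar> \<le> F1" using assms(16) unfolding bounded_iff by auto
  obtain F2 where F2': "\<And>x. \<bar>deriv (deriv f) x\<bar> \<le> F2" using assms(17) unfolding bounded_iff by auto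
  have F20: "0 \<le> F2" using F2'[of 0] by linarith
  have lip: "\<bar>g a - g b\<bar> \<le> K * \<bar>a - b\<bar>" if g: "\<And>x. (g has_real_derivative g' x) (at x)" "\<And>x. \<bar>g' x\<bar> \<le> K" for g g' :: "real \<Rightarrow> real" and a b K
  proof -
    obtain \<xi> where "g a - g b = g' \<xi> * (a - b)" using secant_slope[OF g(1), of a b "\<bar>a - b\<bar>" b] by auto
    then show ?thesis using g(2)[of \<xi>] by (simp add: abs_mult mult_right_mono)
  qed
  note F2 = lip[OF fd(2) F2']
  define L where "L = lam + F1"
  have L0: "0 \<le> L" using F1[of 0] lam by (simp add: L_def)
  have hlip: "\<bar>lam * a - f a - (lam * b - f b)\<bar> \<le> L * \<bar>a - b\<bar>" for a b
  proof (rule lip)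
    show "((\<lambda>x. lam * x - f x) has_real_derivative lam - deriv f x) (at x)" for x
      by (auto intro!: derivative_eq_intros fd(1))
    show "\<bar>lam - deriv f x\<bar> \<le> L" for x using F1[of x] lam unfolding L_def by linarith
  qed
  define Q where "Q = 1 / m0"
  define q0 where "q0 = recip_on O1 p0"
  define qe where "qe \<epsilon> = recip_on {0..1} (p \<epsilon>)" for \<epsilon>
  have q0: "bdd_coeff Q q0" unfolding Q_def q0_def by (rule bdd_coeff_recip_on[OF p0c O1b m p0m])
  have qe: "bdd_coeff Q (qe \<epsilon>)" if "\<epsilon> \<in> {0<..eps0}" for \<epsilon>
    unfolding Q_def qe_def by (rule bdd_coeff_recip_on[OF pc[OF that] _ m pm[OF that]]) auto
  obtain s0 U Z0 where U: "is_flow q0 (\<lambda>t. lam * U t - f (U t)) s0 U Z0" "Z0 1 = 0"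
     "AE x\<in>I01 in lborel. u0 x = U x"
    using equilibrium0_imp_flow[OF x12 p0c[unfolded O1_def] m p0m[unfolded O1_def] fd(3) assms(19)]
    unfolding q0_def O1_def by blast
  have u0L: "u0 \<in> L2 I01" using assms(19) by (auto simp: equilibria0_def dom_A0_def H1_Om0_def H1_def)
  note Uc = is_flow_continuous[OF q0 U(1)]
  have "\<exists>y \<zeta>. is_flow q0 (\<lambda>t. (lam - deriv f (U t)) * y t) 1 y \<zeta>"
  proof (rule flow_exists[OF q0 _ _ L0])
    show "continuous_on {0..1} (\<lambda>t. (lam - deriv f (U t)) * v t)" if "continuous_on {0..1} v" for v
      by (intro continuous_intros that continuous_on_compose2[OF fd(4) Uc(2)]) auto
    show "\<bar>(lam - deriv f (U t)) * a - (lam - deriv f (U t)) * b\<bar> \<le> L * \<bar>a - b\<bar>" for t a b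
    proof -
      have "\<bar>lam - deriv f (U t)\<bar> \<le> L" using F1[of "U t"] lam unfolding L_def by linarith
      then show ?thesis by (simp add: abs_mult mult_right_mono flip: right_diff_distrib)
    qed
  qed
  then obtain y \<zeta> where lin: "is_flow q0 (\<lambda>t. (lam - deriv f (U t)) * y t) 1 y \<zeta>" by blast
  define \<kappa> where "\<kappa> = \<zeta> 1"
  have Uconst: "U x = U x1" if "x \<in> {x1..x2}" for x
    by (rule flow_const_on_Om0[OF x12 q0 _ U(1) that]) (simp add: q0_def O1_def recip_on_Om0)
  have \<kappa>: "\<kappa> \<noteq> 0"
    unfolding \<kappa>_def
    by (rule hyperbolic_imp_nondegenerate[OF x12 p0c[unfolded O1_def] m p0m[unfolded O1_def] U(3) Uconst _ lin[unfolded q0_def O1_def]])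
       (use assms(18,19) in auto)
  note lc = is_flow_continuous[OF q0 lin]
  note bd = bounded_of_continuous_on_compact[OF compact_Icc, where 'a=real, unfolded real_norm_def]
  obtain B where B: "\<And>x. x \<in> {0..1} \<Longrightarrow> \<bar>Z0 x\<bar> \<le> B" using bd[OF Uc(1)] by blast
  obtain V1 V2 where V12: "\<And>x. x \<in> {0..1} \<Longrightarrow> \<bar>y x\<bar> \<le> V1" "\<And>x. x \<in> {0..1} \<Longrightarrow> \<bar>\<zeta> x\<bar> \<le> V2"
    using bd[OF lc(1)] bd[OF lc(2)] by blast
  define V where "V = max V1 V2"
  have V: "\<And>x. x \<in> {0..1} \<Longrightarrow> \<bar>y x\<bar> \<le> V" "\<And>x. x \<in> {0..1} \<Longrightarrow> \<bar>\<zeta> x\<bar> \<le> V"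
    using V12 by (force simp: V_def)+
  have B0: "0 \<le> B" using B[of 0] by auto
  have V0: "0 \<le> V" using V(1)[of 0] by auto
  define E where "E = exp (Q + L)"
  have E0: "0 < E" by (simp add: E_def)
  define C1 where "C1 = 1 / (m0 * m0) + 1 + 2 / m0"
  have C10: "0 \<le> C1" using m by (simp add: C1_def)
  \<comment> \<open>the admissible deviation \<open>\<bar>\<kappa>\<bar> / 2\<close> of the secant slopes is shared between the neighbourhood of
    \<open>s0\<close>, through its radius \<open>r\<close>, and the perturbation \<open>\<eta>\<close>, through \<open>a1\<close>; the denominators \<open>+ 1\<close> only
    prevent division by \<open>0\<close>\<close>
  define r where "r = \<bar>\<kappa>\<bar> / 4 / (V * F2 * E * E + 1)"
  have r: "0 < r" "V * F2 * E * E * r \<le> \<bar>\<kappa>\<bar> / 4"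
  proof -
    have VF: "0 \<le> V * F2 * E * E" using V0 F20 E0 by simp
    then show r0: "0 < r" using \<kappa> by (simp add: r_def)
    show "V * F2 * E * E * r \<le> \<bar>\<kappa>\<bar> / 4"
      by (rule mult_le_of_le_divide_add_one[OF VF]) (use r0 in \<open>auto simp: r_def\<close>)
  qed
  define a1 where "a1 = V * C1 * E + F2 * V * B * C1 * E * E"
  \<comment> \<open>\<open>a2 * \<eta>\<close> bounds the distance of the zero of \<open>\<Phi>\<close> to \<open>s0\<close>, and \<open>C3 * \<eta>\<close> the uniform distance of
    the solutions\<close>
  define a2 where "a2 = 2 * B * C1 * E / \<bar>\<kappa>\<bar>"
  have a0: "0 \<le> a1" "0 \<le> a2" using V0 C10 E0 F20 B0 by (simp_all add: a1_def a2_def)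
  define C3 where "C3 = (a2 + B * C1) * E"
  define C4 where "C4 = (2 / m0 + lam) * C3\<^sup>2 + 2 * (1 + 1 / m0) * B\<^sup>2 * C1"
  have C40: "0 \<le> C4" using m lam C10 by (simp add: C4_def)
  define C where "C = sqrt C4 + 1"
  have C: "0 < C" using C40 by (simp add: C_def add_nonneg_pos)
  define k where "k = 1 + (1 / m0 + 1 / lam) / 2"
  have k: "0 < k" using m lam by (simp add: k_def add_pos_nonneg)
  \<comment> \<open>in the ball of this radius all initial values are within \<open>r\<close> of \<open>s0\<close>\<close>
  define \<delta> where "\<delta> = r / k"
  have \<delta>: "0 < \<delta>" "\<delta> * k = r" using r k by (auto simp: \<delta>_def)
  define \<eta>s where "\<eta>s = min 1 (min (\<bar>\<kappa>\<bar> / 4 / (a1 + 1)) (min (r / (a2 + 1)) ((\<delta> / C)\<^sup>2)))"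
  have \<eta>s: "0 < \<eta>s" using \<kappa> a0 r \<delta> C by (simp add: \<eta>s_def)
  have "\<forall>\<^sub>F \<epsilon> in at_right 0. \<forall>x\<in>O1. dist (p \<epsilon> x) (p0 x) < \<eta>s / 2"
    using uniform_limitD[OF assms(10), of "\<eta>s / 2"] \<eta>s by (simp add: O1_def)
  then obtain b where b: "0 < b" "\<And>\<epsilon> x. 0 < \<epsilon> \<Longrightarrow> \<epsilon> < b \<Longrightarrow> x \<in> O1 \<Longrightarrow> dist (p \<epsilon> x) (p0 x) < \<eta>s / 2"
    unfolding eventually_at_right_field by auto
  define eps1 where "eps1 = min eps0 (min (b / 2) (\<eta>s / 2))"
  have eps1: "eps1 \<in> {0<..eps0}" using \<open>0 < eps0\<close> b \<eta>s by (auto simp: eps1_def)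
  show ?thesis
  proof (rule bexI[OF _ eps1], rule exI[of _ \<delta>], intro conjI \<delta>(1), rule exI[of _ C], intro conjI C ballI)
    fix \<epsilon> assume "\<epsilon> \<in> {0<..eps1}"
    then have e: "\<epsilon> \<in> {0<..eps0}" "0 < \<epsilon>" "\<epsilon> < b" "\<epsilon> \<le> \<eta>s / 2" using b(1) by (auto simp: eps1_def)
    define N where "N = Linf_norm (Om1 x1 x2) (\<lambda>x. p \<epsilon> x - p0 x)"
    define \<eta> where "\<eta> = N + \<epsilon>"
    have pe: "\<bar>p \<epsilon> x - p0 x\<bar> \<le> \<eta>s / 2" if "x \<in> O1" for x
      using b(2)[OF e(2,3) that] by (simp add: dist_real_def)
    have dc: "continuous_on O1 (\<lambda>x. p \<epsilon> x - p0 x)"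
      by (intro continuous_intros p0c continuous_on_subset[OF pc[OF e(1)]] O1s)
    have sub: "{0..x1} \<subseteq> O1" by (auto simp: O1_def Om1_def)
    note NN = Linf_norm_bounds[OF O1b x12(1) sub dc pe, unfolded O1_def, folded N_def]
    have \<eta>: "0 < \<eta>" "\<eta> \<le> \<eta>s" using NN(1,2) e by (auto simp: \<eta>_def)
    have \<eta>1: "\<eta> \<le> 1" "a1 * \<eta> \<le> \<bar>\<kappa>\<bar> / 4" "a2 * \<eta> \<le> r" "\<eta> \<le> (\<delta> / C)\<^sup>2"
      using \<eta> mult_le_of_le_divide_add_one[OF a0(1), of \<eta> "\<bar>\<kappa>\<bar> / 4"] mult_le_of_le_divide_add_one[OF a0(2), of \<eta> r]
      by (auto simp: \<eta>s_def)
    have d: "integral {0..1} (\<lambda>x. \<bar>qe \<epsilon> x - q0 x\<bar>) \<le> C1 * \<eta>"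
    proof -
      have "integral {0..1} (\<lambda>x. \<bar>qe \<epsilon> x - q0 x\<bar>) \<le> N / (m0 * m0) + \<epsilon> + 2 * \<epsilon> / m0"
        unfolding qe_def q0_def O1_def
        by (rule recip_L1_estimate[OF x12 pc[OF e(1)] p0c[unfolded O1_def] m pm[OF e(1)] p0m[unfolded O1_def] e(2) assms(11)[OF e(1)] NN(1,3)])
      also have "\<dots> \<le> C1 * \<eta>"
      proof -
        have "C1 * \<eta> = N / (m0 * m0) + \<epsilon> + 2 * \<epsilon> / m0 + (\<epsilon> / (m0 * m0) + N + 2 * N / m0)"
          by (simp add: C1_def \<eta>_def algebra_simps add_divide_distrib)
        moreover have "0 \<le> \<epsilon> / (m0 * m0) + N + 2 * N / m0" using m e NN(1) by simp
        ultimately show ?thesis by linarith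
      qed
      finally show ?thesis .
    qed
    note qe = qe[OF e(1)]
    have "\<exists>v z. is_flow (qe \<epsilon>) (\<lambda>t. lam * v t - f (v t)) s v z" for s
      by (rule flow_exists[OF qe _ hlip L0])
         (auto intro!: continuous_intros continuous_on_compose2[OF fd(3)])
    then obtain vv zz where fl: "\<And>s. is_flow (qe \<epsilon>) (\<lambda>t. lam * vv s t - f (vv s t)) s (vv s) (zz s)" by metis
    \<comment> \<open>the shooting function for this \<open>\<epsilon>\<close>\<close>
    define \<Phi> where "\<Phi> s = zz s 1" for s
    have close: "\<bar>vv s x - U x\<bar> + \<bar>zz s x - Z0 x\<bar> \<le> (\<bar>s - s0\<bar> + B * (C1 * \<eta>)) * E" if x: "x \<in> {0..1}" for s x
      using flow_stability[OF qe q0 fl U(1) B d L0 order_refl _ x] hlip unfolding E_def by simp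
    have lin_\<Phi>: "\<bar>\<Phi> s - \<Phi> s' - \<kappa> * (s - s')\<bar> \<le> \<bar>\<kappa>\<bar> / 2 * \<bar>s - s'\<bar>"
      if s: "\<bar>s - s0\<bar> \<le> r" "\<bar>s' - s0\<bar> \<le> r" for s s'
    proof -
      define \<sigma> where "\<sigma> = (r + B * (C1 * \<eta>)) * E"
      have \<sigma>: "\<bar>vv t x - U x\<bar> \<le> \<sigma>" if "\<bar>t - s0\<bar> \<le> r" "x \<in> {0..1}" for t x
      proof -
        have "(\<bar>t - s0\<bar> + B * (C1 * \<eta>)) * E \<le> \<sigma>" unfolding \<sigma>_def using that E0 by (intro mult_right_mono) auto
        then show ?thesis using close[OF that(2), of t] by linarith
      qed
      have "\<bar>zz s 1 - zz s' 1 - \<zeta> 1 * (s - s')\<bar> \<le> (V * (C1 * \<eta>) + F2 * \<sigma> * V) * exp (Q + (lam + F1)) * \<bar>s - s'\<bar>"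
        by (rule secant_close_to_linearization[OF qe q0 fl fl lin \<sigma>[OF s(1)] \<sigma>[OF s(2)] fd(1) F1 F2 F20 V d])
           (use lam in auto)
      also have "(V * (C1 * \<eta>) + F2 * \<sigma> * V) * exp (Q + (lam + F1)) = a1 * \<eta> + V * F2 * E * E * r"
        unfolding \<sigma>_def a1_def L_def[symmetric] E_def[symmetric] by (simp add: algebra_simps)
      also have "(a1 * \<eta> + V * F2 * E * E * r) * \<bar>s - s'\<bar> \<le> \<bar>\<kappa>\<bar> / 2 * \<bar>s - s'\<bar>"
        using \<eta>1(2) r(2) by (intro mult_right_mono) auto
      finally show ?thesis by (simp add: \<Phi>_def \<kappa>_def)
    qed
    have \<Phi>0: "2 * \<bar>\<Phi> s0\<bar> / \<bar>\<kappa>\<bar> \<le> a2 * \<eta>"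
    proof -
      have "\<bar>\<Phi> s0\<bar> \<le> B * (C1 * \<eta>) * E" using close[of 1 s0] U(2) by (simp add: \<Phi>_def)
      then have "2 * \<bar>\<Phi> s0\<bar> / \<bar>\<kappa>\<bar> \<le> 2 * (B * (C1 * \<eta>) * E) / \<bar>\<kappa>\<bar>" by (intro divide_right_mono) auto
      then show ?thesis by (simp add: a2_def mult_ac)
    qed
    obtain s where s: "\<bar>s - s0\<bar> \<le> a2 * \<eta>" "\<Phi> s = 0"
      using near_linear_root[OF \<kappa> lin_\<Phi>] \<Phi>0 \<eta>1(3) by (meson order_trans)
    have sr: "\<bar>s - s0\<bar> \<le> r" using s \<eta>1 by linarith
    have eqs: "vv s \<in> equilibria (p \<epsilon>) lam f"
      by (rule flow_imp_equilibrium[OF assms(8)[OF e(1)] m pm[OF e(1)] fl[unfolded qe_def]])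
         (use s(2) in \<open>auto simp: \<Phi>_def\<close>)
    have H1: "vv s \<in> H1 I01" by (rule flow_imp_wderiv[OF qe fl])
    then have L2: "vv s \<in> L2 I01" by (simp add: H1_def)
    have X: "X_norm (p \<epsilon>) lam (\<lambda>x. vv s x - u0 x) \<le> C * sqrt \<eta>"
    proof -
      have refl_AE: "AE x\<in>I01 in lborel. vv s x = vv s x" by simp
      note XN = X_norm_flow_diff[OF qe q0 fl[of s] U(1) pc[OF e(1)] L2 refl_AE u0L U(3), where lam=lam]
      have \<sigma>: "\<bar>vv s x - U x\<bar> + \<bar>zz s x - Z0 x\<bar> \<le> C3 * \<eta>" if "x \<in> {0..1}" for x
      proof -
        have "(\<bar>s - s0\<bar> + B * (C1 * \<eta>)) * E \<le> (a2 * \<eta> + B * (C1 * \<eta>)) * E"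
          using s(1) E0 by (intro mult_right_mono) auto
        also have "\<dots> = C3 * \<eta>" by (simp add: C3_def algebra_simps)
        finally show ?thesis using close[OF that, of s] by linarith
      qed
      have cl1: "\<bar>p \<epsilon> x - p0 x\<bar> \<le> 1" if "x \<in> O1" for x using pe[OF that] \<eta>s by (simp add: \<eta>s_def)
      have "integral {0..1} (energy (p \<epsilon>) lam (\<lambda>x. qe \<epsilon> x * zz s x - q0 x * Z0 x) (\<lambda>x. vv s x - U x))
        \<le> (2 / m0 + lam) * (C3 * \<eta>)\<^sup>2 + 2 * (1 + 1 / m0) * B\<^sup>2 * (C1 * \<eta>)"
        unfolding qe_def q0_def
        by (rule energy_le[OF O1s pc[OF e(1)] p0c O1b m pm[OF e(1)] p0m cl1 lam B \<sigma> d[unfolded qe_def q0_def] XN(2)[unfolded qe_def q0_def]])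
      also have "\<dots> \<le> C4 * \<eta>"
      proof -
        have "\<eta> * \<eta> \<le> \<eta>" using \<eta> \<eta>1(1) by (simp add: mult_left_le)
        then have "(2 / m0 + lam) * C3\<^sup>2 * (\<eta> * \<eta>) \<le> (2 / m0 + lam) * C3\<^sup>2 * \<eta>"
          using m lam by (intro mult_left_mono) auto
        then show ?thesis by (simp add: C4_def power2_eq_square algebra_simps)
      qed
      finally have "X_norm (p \<epsilon>) lam (\<lambda>x. vv s x - u0 x) \<le> sqrt (C4 * \<eta>)" unfolding XN(1) by simp
      also have "\<dots> = sqrt C4 * sqrt \<eta>" by (rule real_sqrt_mult)
      also have "\<dots> \<le> C * sqrt \<eta>" using \<eta>(1) by (intro mult_right_mono) (auto simp: C_def)
      finally show ?thesis .
    qed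
    have "sqrt \<eta> \<le> \<delta> / C" using \<eta>1(4) \<delta>(1) C by (intro real_le_lsqrt) auto
    then have "C * sqrt \<eta> \<le> \<delta>" using C by (simp add: field_simps)
    then have X\<delta>: "X_norm (p \<epsilon>) lam (\<lambda>x. vv s x - u0 x) \<le> \<delta>" using X by simp
    have uniq: "AE x\<in>I01 in lborel. w x = vv s x"
      if w: "w \<in> equilibria (p \<epsilon>) lam f" "w \<in> H1 I01" "X_norm (p \<epsilon>) lam (\<lambda>x. w x - u0 x) \<le> \<delta>" for w
    proof -
      obtain c v z where cv: "is_flow (qe \<epsilon>) (\<lambda>t. lam * v t - f (v t)) c v z" "z 1 = 0" "AE x\<in>I01 in lborel. w x = v x"
        using equilibrium_imp_flow[OF assms(8)[OF e(1)] m pm[OF e(1)] fd(3) w(1)] unfolding qe_def by blast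
      have wL: "w \<in> L2 I01" using w(2) by (simp add: H1_def)
      note XN = X_norm_flow_diff[OF qe q0 cv(1) U(1) pc[OF e(1)] wL cv(3) u0L U(3), where lam=lam]
      have I: "integral {0..1} (energy (p \<epsilon>) lam (\<lambda>x. qe \<epsilon> x * z x - q0 x * Z0 x) (\<lambda>x. v x - U x)) \<le> \<delta>\<^sup>2"
        using w(3) unfolding XN(1) by (rule sqrt_le_D)
      have "\<bar>c - s0\<bar> \<le> \<delta> * k" unfolding k_def
        using initial_value_le_energy[OF qe q0 cv(1) U(1) m pm[OF e(1)] lam \<delta>(1) XN(2) I] by simp
      then have cr: "\<bar>c - s0\<bar> \<le> r" using \<delta>(2) by simp
      obtain Bc where Bc: "\<And>x. x \<in> {0..1} \<Longrightarrow> \<bar>zz c x\<bar> \<le> Bc"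
        using bd[OF is_flow_continuous(1)[OF qe fl[of c]]] by blast
      have same: "v x = vv c x" "z x = zz c x" if x: "x \<in> {0..1}" for x
      proof -
        have "\<bar>v x - vv c x\<bar> + \<bar>z x - zz c x\<bar> \<le> (\<bar>c - c\<bar> + Bc * 0 + 0) * exp (Q + L)"
          by (rule flow_stability[OF qe qe cv(1) fl Bc _ L0 _ _ x]) (use hlip in auto)
        then show "v x = vv c x" "z x = zz c x" by auto
      qed
      have "\<Phi> c = 0" using same(2)[of 1] cv(2) by (simp add: \<Phi>_def)
      then have "\<bar>\<kappa>\<bar> * \<bar>c - s\<bar> \<le> \<bar>\<kappa>\<bar> / 2 * \<bar>c - s\<bar>" using lin_\<Phi>[OF cr sr] s(2) by (simp add: abs_mult)
      then have "c = s" using \<kappa> by simp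
      then show ?thesis using cv(3) same(1) by (auto elim!: eventually_mono)
    qed
    show "\<exists>u \<in> equilibria (p \<epsilon>) lam f \<inter> {v \<in> H1 I01. X_norm (p \<epsilon>) lam (\<lambda>x. v x - u0 x) \<le> \<delta>}.
      (\<forall>w \<in> equilibria (p \<epsilon>) lam f \<inter> {v \<in> H1 I01. X_norm (p \<epsilon>) lam (\<lambda>x. v x - u0 x) \<le> \<delta>}.
         AE x\<in>I01 in lborel. w x = u x) \<and>
      X_norm (p \<epsilon>) lam (\<lambda>x. u x - u0 x)
        \<le> C * sqrt (Linf_norm (Om1 x1 x2) (\<lambda>x. p \<epsilon> x - p0 x) + \<epsilon>)"
      using eqs H1 X\<delta> X uniq by (intro bexI[of _ "vv s"]) (auto simp: \<eta>_def N_def)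
  qed
qed

end
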